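(* Let $k$ be a field of characteristic $0$ and $s\ge1$. The restricted $\mathcal{R}$-transform $$\mathcal{R}\big|_{\mathfrak{G}^s_+}:(\mathfrak{G}^s_+(k),\boxtimes_V,\underline{1})\rightarrow(\mathfrak{G}^s_+(k),\boxtimes,(\underline{1}_s,\underline{0})),\qquad f\mapsto f\boxtimes\operatorname{Moeb},$$ is a group isomorphism. The respective BCH-group laws $\circ_{\boxtimes_V}$ and $\circ_{\boxtimes}$ are equal up to a linear co-ordinate transformation with a lower-triangular matrix with unit diagonal. Further, the identity $$\operatorname{EXP}_{\boxtimes}\circ\, d\mathcal{R}\big|_{\mathfrak{G}^s_+}\circ\operatorname{LOG}_{\boxtimes_V}=\mathcal{R}\big|_{\mathfrak{G}^s_+}$$ holds, where $d\mathcal{R}|_{\mathfrak{G}^s_+}$ is the differential of $\mathcal{R}|_{\mathfrak{G}^s_+}$ at the identity $\underline{1}$.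
   Context: $\mathfrak{G}^s_+(k)$ is the set of families $f=(f_w)$ indexed by non-empty words $w$ in $\{1,\dots,s\}$, with $f_i=1$ for the one-letter words $i=1,\dots,s$ and $f_w\in k$ arbitrary for $|w|\ge2$; $f$ is viewed as the power series with coefficient $f_w$ at $x_w$. Words are ordered by length and then lexicographically. $\underline{1}=(1,1,1,\dots)$, and $(\underline{1}_s,\underline{0})$ has entries $1$ at the $s$ one-letter words and $0$ elsewhere. Boxed convolution: $(f\boxtimes g)_w=\sum_{\pi\in \mathrm{NC}(|w|)}f_{w,\pi}\,g_{w,K(\pi)}$, where $\mathrm{NC}(n)$ is the set of non-crossing partitions of $\{1,\dots,n\}$, $K(\pi)$ the Kreweras complement, $f_{w,\pi}=\prod_{V\in\pi}f_{w|V}$, $w|V=(i_{v_1}\dots i_{v_m})$ for $w=(i_1\dots i_n)$, $V=\{v_1<\dots<v_m\}$. $\operatorname{Moeb}$ is the $\boxtimes$-inverse of $\operatorname{Zeta}=\underline{1}$ with respect to the unit $(\underline{1}_s,\underline{0})$. $\boxtimes_V$ is the multiplicative free convolution: $(f\boxtimes_V g)_w=(f\bullet_{\mathrm F}g)(x_{i_1}y_{i_1}\cdots x_{i_m}y_{i_m})$ for $w=(i_1\dots i_m)$, where $f,g$ are extended to unital linear functionals on $k\langle x_1,\dots,x_s\rangle$ and (a copy) $k\langle y_1,\dots,y_s\rangle$ by $f(x_w)=f_w$, $g(y_w)=g_w$, and for a product $a_1\cdots a_m$ alternating between the $x$-algebra ($\epsilon_i=1$) and the $y$-algebra ($\epsilon_i=2$),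 recursively $f\bullet_{\mathrm F}g(a_1\cdots a_m)=\sum_{I\subsetneq\{1,\dots,m\}}(-1)^{m-|I|+1}f\bullet_{\mathrm F}g(\prod_{i\in I}a_i)\prod_{i\notin I}\varphi_{\epsilon_i}(a_i)$, $\varphi_1=f$, $\varphi_2=g$, with value $1$ on the empty product and equal to $f$ (resp. $g$) on the $x$- (resp. $y$-) algebra. EXP, LOG and BCH-group law: use as coordinates centred at the identity $(f_w-1)_{|w|\ge2}$ for $\boxtimes_V$ and $(f_w)_{|w|\ge2}$ for $\boxtimes$; both become polynomial group laws $\circ$ on $k^{\mathbb{N}}$ with unit $0$. Let $L_x(y)=x\circ y$ and $J_{L_x}(0)$ the Jacobian matrix of $L_x$ at $y=0$. $\operatorname{EXP}(\xi):=\gamma(1)$, where $\gamma$ is the unique curve, polynomial in each coordinate, with $\gamma(0)=0$ and $\gamma'(t)=J_{L_{\gamma(t)}}(0)\xi$; $\operatorname{LOG}:=\operatorname{EXP}^{-1}$. The BCH-group law on $k^{\mathbb{N}}$ (the Lie algebra in Jacobian coordinates) is $\xi\circ_{\mathrm{BCH}}\eta=\operatorname{LOG}(\operatorname{EXP}(\xi)\circ\operatorname{EXP}(\eta))$, denoted $\circ_{\boxtimes_V}$ resp. $\circ_{\boxtimes}$; it is given by the Baker-Campbell-Hausdorff series. *)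

theory Defs
  imports
    "HOL-Library.Disjoint_Sets"
    "HOL-Computational_Algebra.Polynomial"
    "HOL-Algebra.Group"
begin

section \<open>Families indexed by words\<close>

type_synonym 'k family = "nat list \<Rightarrow> 'k"

definition words :: "nat \<Rightarrow> nat list set" where
  "words s = {w. w \<noteq> [] \<and> set w \<subseteq> {1..s}}"

definition long_words :: "nat \<Rightarrow> nat list set" where
  "long_words s = {w \<in> words s. 2 \<le> length w}"

text \<open>A family only has entries at words in \<open>{1..s}\<close>; the values of the total function at all
  other lists are fixed to be \<open>0\<close>.\<close>

definition gplus :: "nat \<Rightarrow> ('k::field_char_0) family set" where
  "gplus s = {f. (\<forall>i\<in>{1..s}. f [i] = 1) \<and> (\<forall>w. w \<notin> words s \<longrightarrow> f w = 0)}"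

definition zeta :: "nat \<Rightarrow> ('k::field_char_0) family" where
  "zeta s = (\<lambda>w. if w \<in> words s then 1 else 0)"

definition boxed_unit :: "nat \<Rightarrow> ('k::field_char_0) family" where
  "boxed_unit s = (\<lambda>w. if w \<in> words s \<and> length w = 1 then 1 else 0)"


section \<open>Boxed convolution\<close>

text \<open>Positions in a word are counted from \<open>0\<close>, so partitions of \<open>{..<n}\<close> take the role of
  partitions of \<open>{1,\<dots>,n}\<close>, and the restricted word \<open>w|V\<close> is \<open>nths w V\<close>.\<close>

definition noncrossing :: "nat set set \<Rightarrow> bool" where
  "noncrossing P \<longleftrightarrow>
     (\<forall>V\<in>P. \<forall>W\<in>P. V \<noteq> W \<longrightarrow>
        \<not> (\<exists>a\<in>V. \<exists>b\<in>W. \<exists>c\<in>V. \<exists>d\<in>W. a < b \<and> b < c \<and> c < d))"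

definition NC :: "nat \<Rightarrow> nat set set set" where
  "NC n = {P. partition_on {..<n} P \<and> noncrossing P}"

text \<open>The Kreweras complement of \<open>P\<close> is the coarsest partition \<open>Q\<close> of a second copy of the points
  such that \<open>P \<union> Q\<close> is non-crossing for the interleaved order
  \<open>0 < 0' < 1 < 1' < \<dots>\<close>. Here \<open>i\<close> is encoded as \<open>2 * i\<close> and \<open>i'\<close> as \<open>2 * i + 1\<close>.\<close>

definition interleave :: "nat set set \<Rightarrow> nat set set \<Rightarrow> nat set set" where
  "interleave P Q = (\<lambda>V. (\<lambda>i. 2 * i) ` V) ` P \<union> (\<lambda>V. (\<lambda>i. 2 * i + 1) ` V) ` Q"

definition kreweras :: "nat \<Rightarrow> nat set set \<Rightarrow> nat set set" where
  "kreweras n P =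
     (THE Q. Q \<in> NC n \<and> noncrossing (interleave P Q) \<and>
        (\<forall>Q'\<in>NC n. noncrossing (interleave P Q') \<longrightarrow> refines {..<n} Q' Q))"

definition part_coeff :: "('k::field_char_0) family \<Rightarrow> nat list \<Rightarrow> nat set set \<Rightarrow> 'k" where
  "part_coeff f w P = (\<Prod>V\<in>P. f (nths w V))"

definition boxed_conv :: "nat \<Rightarrow> ('k::field_char_0) family \<Rightarrow> 'k family \<Rightarrow> 'k family" where
  "boxed_conv s f g = (\<lambda>w. if w \<in> words s
     then \<Sum>P\<in>NC (length w). part_coeff f w P * part_coeff g w (kreweras (length w) P) else 0)"

definition boxed_group :: "nat \<Rightarrow> ('k::field_char_0) family monoid" where
  "boxed_group s = \<lparr>carrier = gplus s, mult = boxed_conv s, one = boxed_unit s\<rparr>"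

definition moeb :: "nat \<Rightarrow> ('k::field_char_0) family" where
  "moeb s = inv\<^bsub>boxed_group s\<^esub> (zeta s)"

definition R_transform :: "nat \<Rightarrow> ('k::field_char_0) family \<Rightarrow> 'k family" where
  "R_transform s f = boxed_conv s f (moeb s)"


section \<open>Multiplicative free convolution\<close>

text \<open>A monomial in the free product of \<open>k\<langle>x\<^sub>1,\<dots>,x\<^sub>s\<rangle>\<close> and \<open>k\<langle>y\<^sub>1,\<dots>,y\<^sub>s\<rangle>\<close> is a list over
  \<open>nat + nat\<close>, where \<open>Inl i\<close> stands for \<open>x\<^sub>i\<close> and \<open>Inr i\<close> for \<open>y\<^sub>i\<close>. The function \<open>factors\<close>
  writes it as the alternating product of its maximal runs.\<close>

fun factors :: "(nat + nat) list \<Rightarrow> (nat + nat) list list" where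
  "factors [] = []"
| "factors (a # u) =
     (case factors u of
        [] \<Rightarrow> [[a]]
      | b # bs \<Rightarrow> if isl a = isl (hd b) then (a # b) # bs else [a] # b # bs)"

definition run_value :: "('k::field_char_0) family \<Rightarrow> 'k family \<Rightarrow> (nat + nat) list \<Rightarrow> 'k" where
  "run_value f g b = (if isl (hd b) then f (map projl b) else g (map projr b))"

lemma concat_factors: "concat (factors u) = u"
  by (induction u) (auto split: list.splits)

lemma factors_nonempty: "[] \<notin> set (factors u)"
  by (induction u) (auto split: list.splits)

lemma length_concat_nths_le: "length (concat (nths bs I)) \<le> length (concat bs)"
  by (induction bs arbitrary: I) (auto simp: nths_Cons intro: le_SucI trans_le_add2)

lemma length_concat_nths_less:
  assumes "[] \<notin> set bs" "I \<subset> {..<length bs}"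
  shows "length (concat (nths bs I)) < length (concat bs)"
proof -
  obtain i where i: "i < length bs" "i \<notin> I"
    using assms(2) by auto
  show ?thesis
    using assms(1) i
  proof (induction bs arbitrary: I i)
    case (Cons b bs)
    let ?J = "{j. Suc j \<in> I}"
    show ?case
    proof (cases i)
      case 0
      then show ?thesis
        using Cons.prems length_concat_nths_le[of bs ?J] by (auto simp: nths_Cons)
          (metis add_strict_increasing length_greater_0_conv)
    next
      case (Suc j)
      then have "length (concat (nths bs ?J)) < length (concat bs)"
        using Cons.prems by (intro Cons.IH[of j]) auto
      then show ?thesis
        by (auto simp: nths_Cons)
    qed
  qed simp
qed

text \<open>The values of \<open>f \<bullet>\<^sub>F g\<close> on monomials, which determine the linear functional. For monomial
  factors \<open>a\<^sub>1, \<dots>, a\<^sub>m\<close> all products in the defining recursion are again monomials; the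
  sub-products need not be alternating in the \<open>a\<^sub>i\<close>, so they are factored anew. For \<open>m = 1\<close> the
  recursion returns the value of \<open>f\<close> or \<open>g\<close>.\<close>

function free_product_functional ::
    "('k::field_char_0) family \<Rightarrow> 'k family \<Rightarrow> (nat + nat) list \<Rightarrow> 'k" where
  "free_product_functional f g u =
     (if u = [] then 1
      else let as = factors u; m = length as in
        \<Sum>I\<in>{I. I \<subset> {..<m}}. (-1) ^ (m - card I + 1)
          * free_product_functional f g (concat (nths as I))
          * (\<Prod>i\<in>{..<m} - I. run_value f g (as ! i)))"
  by pat_completeness auto
termination
  by (relation "measure (\<lambda>(f, g, u). length u)")
    (auto intro: length_concat_nths_less[OF factors_nonempty, unfolded concat_factors])

declare free_product_functional.simps [simp del]

definition free_mult_conv :: "nat \<Rightarrow> ('k::field_char_0) family \<Rightarrow> 'k family \<Rightarrow> 'k family" where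
  "free_mult_conv s f g = (\<lambda>w. if w \<in> words s
     then free_product_functional f g (concat (map (\<lambda>i. [Inl i, Inr i]) w)) else 0)"

definition free_mult_group :: "nat \<Rightarrow> ('k::field_char_0) family monoid" where
  "free_mult_group s = \<lparr>carrier = gplus s, mult = free_mult_conv s, one = zeta s\<rparr>"


section \<open>Jacobians, EXP, LOG and the BCH-group law\<close>

text \<open>The coordinate space \<open>k\<^sup>\<nat>\<close>, with coordinates indexed directly by the words of length at least
  \<open>2\<close>. These are ordered by \<open>lenlex less_than\<close> (length first, then lexicographically), a well-order
  of type \<open>\<omega>\<close> on \<open>long_words s\<close>.\<close>

definition coords :: "nat \<Rightarrow> ('k::field_char_0) family set" where
  "coords s = {x. \<forall>w. w \<notin> long_words s \<longrightarrow> x w = 0}"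

text \<open>Matrices are only applied when every row has finitely many non-zero entries; the sum runs over
  these.\<close>

definition mat_vec :: "nat \<Rightarrow> (nat list \<Rightarrow> nat list \<Rightarrow> 'k) \<Rightarrow> ('k::field_char_0) family \<Rightarrow> 'k family"
  where "mat_vec s A x = (\<lambda>w. if w \<in> long_words s
     then \<Sum>v | v \<in> long_words s \<and> A w v \<noteq> 0. A w v * x v else 0)"

definition unit_lower_triangular :: "nat \<Rightarrow> (nat list \<Rightarrow> nat list \<Rightarrow> 'k::field_char_0) \<Rightarrow> bool" where
  "unit_lower_triangular s A \<longleftrightarrow>
     (\<forall>w\<in>long_words s. A w w = 1) \<and>
     (\<forall>w\<in>long_words s. \<forall>v\<in>long_words s. (w, v) \<in> lenlex less_than \<longrightarrow> A w v = 0)"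

text \<open>The derivative of a polynomial function; over an infinite field the polynomial is determined by
  the function. The Jacobian consists of the formal partial derivatives of a polynomial map.\<close>

definition poly_fun_deriv :: "('k::field_char_0 \<Rightarrow> 'k) \<Rightarrow> 'k \<Rightarrow> 'k" where
  "poly_fun_deriv h a = poly (pderiv (THE p. \<forall>t. poly p t = h t)) a"

definition jacobian ::
    "(('k::field_char_0) family \<Rightarrow> 'k family) \<Rightarrow> 'k family \<Rightarrow> nat list \<Rightarrow> nat list \<Rightarrow> 'k" where
  "jacobian F a w v = poly_fun_deriv (\<lambda>t. F (a(v := t)) w) (a v)"

text \<open>Coordinates centred at the identity: \<open>f\<^sub>w - 1\<close> for the multiplicative free convolution and
  \<open>f\<^sub>w\<close> for the boxed convolution, at the words of length at least \<open>2\<close>.\<close>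

definition to_coords :: "('k::field_char_0) family monoid \<Rightarrow> 'k family \<Rightarrow> 'k family" where
  "to_coords G f = (\<lambda>w. f w - \<one>\<^bsub>G\<^esub> w)"

definition of_coords :: "('k::field_char_0) family monoid \<Rightarrow> 'k family \<Rightarrow> 'k family" where
  "of_coords G x = (\<lambda>w. \<one>\<^bsub>G\<^esub> w + x w)"

definition coord_law :: "('k::field_char_0) family monoid \<Rightarrow> 'k family \<Rightarrow> 'k family \<Rightarrow> 'k family" where
  "coord_law G x y = to_coords G (of_coords G x \<otimes>\<^bsub>G\<^esub> of_coords G y)"

definition exp_curve ::
    "nat \<Rightarrow> ('k::field_char_0) family monoid \<Rightarrow> 'k family \<Rightarrow> (nat list \<Rightarrow> 'k poly) \<Rightarrow> bool" where
  "exp_curve s G \<xi> \<gamma> \<longleftrightarrow>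
     (\<forall>w. w \<notin> long_words s \<longrightarrow> \<gamma> w = 0) \<and>
     (\<forall>w\<in>long_words s. poly (\<gamma> w) 0 = 0) \<and>
     (\<forall>w\<in>long_words s. \<forall>t. poly (pderiv (\<gamma> w)) t =
        mat_vec s (jacobian (coord_law G (\<lambda>v. poly (\<gamma> v) t)) (\<lambda>_. 0)) \<xi> w)"

definition EXP :: "nat \<Rightarrow> ('k::field_char_0) family monoid \<Rightarrow> 'k family \<Rightarrow> 'k family" where
  "EXP s G \<xi> = (\<lambda>w. poly ((THE \<gamma>. exp_curve s G \<xi> \<gamma>) w) 1)"

definition LOG :: "nat \<Rightarrow> ('k::field_char_0) family monoid \<Rightarrow> 'k family \<Rightarrow> 'k family" where
  "LOG s G = the_inv_into (coords s) (EXP s G)"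

definition BCH_law ::
    "nat \<Rightarrow> ('k::field_char_0) family monoid \<Rightarrow> 'k family \<Rightarrow> 'k family \<Rightarrow> 'k family" where
  "BCH_law s G \<xi> \<eta> = LOG s G (coord_law G (EXP s G \<xi>) (EXP s G \<eta>))"

definition differential_at_one ::
    "nat \<Rightarrow> ('k::field_char_0) family monoid \<Rightarrow> 'k family monoid \<Rightarrow>
      ('k family \<Rightarrow> 'k family) \<Rightarrow> 'k family \<Rightarrow> 'k family" where
  "differential_at_one s G H F =
     mat_vec s (jacobian (\<lambda>x. to_coords H (F (of_coords G x))) (\<lambda>_. 0))"

end

theory Submission
  imports Defs
begin

text \<open>
  Splitting a non-crossing partition at the second point of the block of the first point turns boxed
  convolution into a recursion on words in which the weights of the first block and of the last
  Kreweras block are free; with these weights associativity is an induction on length. Boxed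
  convolution and all maps built from it are unipotent for the length of words, which gives inverses.

  If \<open>k\<close> is the family of free cumulants of \<open>f\<close>, the functional that sums \<open>k\<close> over the blocks of
  \<open>x\<close>-letters and \<open>g\<close> over the complementary words of \<open>y\<close>-letters vanishes on alternating products of
  centred monomials, so it is the free product of \<open>f\<close> and \<open>g\<close>. On \<open>x\<^sub>1 y\<^sub>1 \<dots> x\<^sub>n y\<^sub>n\<close> it satisfies
  the recursion of boxed convolution; hence \<open>f \<boxtimes>\<^sub>V g = R f \<boxtimes> g\<close>, and \<open>R\<close> is an isomorphism.

  A polynomial group morphism carries left-invariant vector fields to left-invariant vector fields, hence
  exponential curves to exponential curves. So \<open>EXP \<circ> dR = R \<circ> EXP\<close>, and \<open>dR\<close> is a morphism of
  the BCH-group laws, unit lower triangular because \<open>R\<close> is unipotent.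
\<close>


section \<open>Boxed convolution as a recursion on words\<close>

text \<open>Reading a word from the left leaves two blocks unfinished: the block of the first letter
  and the Kreweras block that reaches the last one. What has been read of them is absorbed into
  their weights, as in \<open>\<lambda>u. F (a # u)\<close>; so the inductions must allow arbitrary
  weights even where the result concerns only two families \<open>f\<close> and \<open>g\<close>.
  This takes the place of the usual bookkeeping with nested partitions and complements. The
  recursion that defines the free product says that a product of centred factors has value 0. A
  functional with this property and the right values on pure words is therefore the free product,
  and it is enough to exhibit one. There are infinitely many coordinates, but the value of each map
  at a word \<open>w\<close> involves only shorter words and \<open>w\<close> itself, the latter
  linearly with coefficient 1. Equations and differential equations can hence be solved length by
  length, by polynomials, over any field of characteristic 0.\<close>

definition lconv :: "('a list \<Rightarrow> 'k::comm_ring_1) \<Rightarrow> ('a list \<Rightarrow> 'k) \<Rightarrow> 'a list \<Rightarrow> 'k" where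
  "lconv X Y w = (\<Sum>i<length w. X (take i w) * Y (drop i w))"

lemma lconv_Nil [simp]: "lconv X Y [] = 0"
  by (simp add: lconv_def)

lemma lconv_Cons: "lconv X Y (a # w) = X [] * Y (a # w) + lconv (\<lambda>u. X (a # u)) Y w"
  by (simp add: lconv_def sum.lessThan_Suc_shift del: sum.lessThan_Suc)

lemma lconv_add_left: "lconv (\<lambda>u. X u + X' u) Y w = lconv X Y w + lconv X' Y w"
  by (simp add: lconv_def sum.distrib algebra_simps)

lemma lconv_add_right: "lconv X (\<lambda>u. Y u + Y' u) w = lconv X Y w + lconv X Y' w"
  by (simp add: lconv_def sum.distrib algebra_simps)

lemma lconv_scale_left: "lconv (\<lambda>u. c * X u) Y w = c * lconv X Y w"
  by (simp add: lconv_def sum_distrib_left algebra_simps)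

lemma lconv_scale_right: "lconv X (\<lambda>u. c * Y u) w = c * lconv X Y w"
  by (simp add: lconv_def sum_distrib_left algebra_simps)

text \<open>The left piece of a cut may be empty, the right one may not. In a double cut on the
  left-hand side the middle piece may thus be empty; these cuts are what the extra term
  \<open>Y [] * X u\<close> accounts for.\<close>

lemma lconv_assoc: "lconv X (lconv Y Z) w = lconv (\<lambda>u. Y [] * X u + lconv X Y u) Z w"
proof (induction w arbitrary: X)
  case (Cons a w)
  show ?case
    by (simp add: lconv_Cons Cons.IH lconv_add_left lconv_scale_left algebra_simps)
qed simp

lemma lconv_cong:
  assumes "\<And>i. i < length w \<Longrightarrow> X (take i w) = X' (take i w)"
    and "\<And>i. i < length w \<Longrightarrow> Y (drop i w) = Y' (drop i w)"
  shows "lconv X Y w = lconv X' Y' w"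
  unfolding lconv_def using assms by (intro sum.cong) auto

lemma lconv_if_Nil: "lconv X (\<lambda>u. if u = [] then 0 else Y u) = lconv X Y"
  by (intro ext lconv_cong) auto

text \<open>\<open>F\<close> weights the block of the first letter and \<open>G\<close> the Kreweras block of the last letter; all other
  blocks are weighted by \<open>f\<close> and \<open>g\<close>. The summands correspond to the second letter of the first block.\<close>

fun nc_rec :: "('a list \<Rightarrow> 'k::comm_ring_1) \<Rightarrow> ('a list \<Rightarrow> 'k) \<Rightarrow>
    ('a list \<Rightarrow> 'k) \<Rightarrow> ('a list \<Rightarrow> 'k) \<Rightarrow> 'a list \<Rightarrow> 'k" where
  "nc_rec f g F G [] = F [] * G []"
| "nc_rec f g F G (a # w) = F [a] * nc_rec f g f (\<lambda>u. G (a # u)) w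
     + (\<Sum>i<length w. nc_rec f g f (\<lambda>u. g (a # u)) (take i w) * nc_rec f g (\<lambda>u. F (a # u)) G (drop i w))"

lemma nc_rec_Cons: "nc_rec f g F G (a # w) = F [a] * nc_rec f g f (\<lambda>u. G (a # u)) w
     + lconv (nc_rec f g f (\<lambda>u. g (a # u))) (nc_rec f g (\<lambda>u. F (a # u)) G) w"
  by (simp add: lconv_def)

declare nc_rec.simps(2) [simp del]

section \<open>Linearity and locality of the recursion in its weights\<close>

lemma nc_rec_linear_left: "nc_rec f g (\<lambda>u. c * F u + F' u) G w = c * nc_rec f g F G w + nc_rec f g F' G w"
proof (induction w arbitrary: F F' G rule: length_induct)
  case (1 w)
  show ?case
  proof (cases w)
    case (Cons a v)
    have "lconv X (nc_rec f g (\<lambda>u. c * F (a # u) + F' (a # u)) G) v =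
        lconv X (\<lambda>u. c * nc_rec f g (\<lambda>u. F (a # u)) G u + nc_rec f g (\<lambda>u. F' (a # u)) G u) v" for X
      using 1[rule_format] by (intro lconv_cong) (auto simp: Cons)
    then show ?thesis
      by (simp add: Cons nc_rec_Cons lconv_add_right lconv_scale_right algebra_simps)
  qed (simp add: algebra_simps)
qed

lemma nc_rec_linear_right: "nc_rec f g F (\<lambda>u. c * G u + G' u) w = c * nc_rec f g F G w + nc_rec f g F G' w"
proof (induction w arbitrary: F G G' rule: length_induct)
  case (1 w)
  show ?case
  proof (cases w)
    case (Cons a v)
    have "lconv X (nc_rec f g (\<lambda>u. F (a # u)) (\<lambda>u. c * G u + G' u)) v =
        lconv X (\<lambda>u. c * nc_rec f g (\<lambda>u. F (a # u)) G u + nc_rec f g (\<lambda>u. F (a # u)) G' u) v" for X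
      using 1[rule_format] by (intro lconv_cong) (auto simp: Cons)
    then show ?thesis
      using 1[rule_format, of v]
      by (simp add: Cons nc_rec_Cons lconv_add_right lconv_scale_right algebra_simps)
  qed (simp add: algebra_simps)
qed

lemma nc_rec_linear_left': "nc_rec f g (\<lambda>u. c * F u + F' u) G = (\<lambda>w. c * nc_rec f g F G w + nc_rec f g F' G w)"
  by (simp add: fun_eq_iff nc_rec_linear_left)

lemma nc_rec_add_right: "nc_rec f g F (\<lambda>u. G u + G' u) = (\<lambda>w. nc_rec f g F G w + nc_rec f g F G' w)"
  using nc_rec_linear_right[of f g F 1 G G'] by (simp add: fun_eq_iff)

lemma nc_rec_zero_right: "nc_rec f g F (\<lambda>u. 0) w = 0"
  using nc_rec_linear_right[of f g F 0 "\<lambda>u. 0" "\<lambda>u. 0" w] nc_rec_add_right[of f g F "\<lambda>u. 0" "\<lambda>u. 0"]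
  by (simp add: fun_eq_iff)

lemma nc_rec_scale_right: "nc_rec f g F (\<lambda>u. c * G u) w = c * nc_rec f g F G w"
  using nc_rec_linear_right[of f g F c G "\<lambda>u. 0" w] by (simp add: nc_rec_zero_right)

lemma nc_rec_cong:
  assumes "\<And>u. set u \<subseteq> S \<Longrightarrow> length u \<le> length w \<Longrightarrow> f u = f' u \<and> g u = g' u \<and> F u = F' u \<and> G u = G' u"
    and "set w \<subseteq> S"
  shows "nc_rec f g F G w = nc_rec f' g' F' G' w"
  using assms
proof (induction w arbitrary: F F' G G' rule: length_induct)
  case (1 w)
  note eq = 1(2)
  show ?case
  proof (cases w)
    case Nil
    then show ?thesis using eq[of "[]"] by simp
  next
    case (Cons a v)
    have v: "a \<in> S" "set v \<subseteq> S" "length v < length w" using 1 Cons by auto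
    have tk: "set (take i v) \<subseteq> S" "set (drop i v) \<subseteq> S" for i
      using v set_take_subset[of i v] set_drop_subset[of i v] by auto
    show ?thesis
      unfolding Cons nc_rec_Cons
    proof (intro arg_cong2[where f="(+)"] arg_cong2[where f="(*)"] lconv_cong)
      show "F [a] = F' [a]" using v eq[of "[a]"] by auto
      show "nc_rec f g f (\<lambda>u. G (a # u)) v = nc_rec f' g' f' (\<lambda>u. G' (a # u)) v"
        using v eq eq[of "a # _"] by (intro 1(1)[rule_format]) auto
    next
      fix i assume "i < length v"
      then show "nc_rec f g f (\<lambda>u. g (a # u)) (take i v) = nc_rec f' g' f' (\<lambda>u. g' (a # u)) (take i v)"
        using v tk(1)[of i] eq eq[of "a # _"] by (intro 1(1)[rule_format]) auto
    next
      fix i assume "i < length v"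
      then show "nc_rec f g (\<lambda>u. F (a # u)) G (drop i v) = nc_rec f' g' (\<lambda>u. F' (a # u)) G' (drop i v)"
        using v tk(2)[of i] eq eq[of "a # _"] by (intro 1(1)[rule_format]) auto
    qed
  qed
qed

text \<open>Only the partition with a single block evaluates a weight \<open>f\<close> or
  \<open>F\<close> at all of \<open>w\<close>. Its Kreweras complement consists of singletons, all
  of weight 1 except the last one, which contributes \<open>G [last w]\<close>.\<close>

lemma nc_rec_diff_left:
  assumes "\<And>u. set u \<subseteq> S \<Longrightarrow> length u < length w \<Longrightarrow> f u = f' u \<and> F u = F' u"
    and "\<And>a. a \<in> S \<Longrightarrow> g [a] = 1" "f [] = 1" "set w \<subseteq> S" "w \<noteq> []"
  shows "nc_rec f g F G w - nc_rec f' g F' G w = (F w - F' w) * G [last w]"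
  using assms(1,4,5)
proof (induction w arbitrary: F F')
  case (Cons a v)
  show ?case
  proof (cases "v = []")
    case True
    then show ?thesis using Cons.prems(1)[of "[]"] assms(3) by (simp add: nc_rec_Cons algebra_simps)
  next
    case False
    then obtain b t where bt: "v = b # t" by (cases v) auto
    have aS: "a \<in> S" "set v \<subseteq> S" using Cons.prems by auto
    have eq: "f u = f' u" "F u = F' u" if "set u \<subseteq> S" "length u \<le> length v" for u
      using Cons.prems(1) that by auto
    have 1: "nc_rec f g f (\<lambda>u. G (a # u)) v = nc_rec f' g f' (\<lambda>u. G (a # u)) v"
      using aS eq by (intro nc_rec_cong[where S=S]) auto
    have 2: "lconv (\<lambda>u. nc_rec f g f (\<lambda>u. g (a # u)) (b # u)) (nc_rec f g (\<lambda>u. F (a # u)) G) t =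
        lconv (\<lambda>u. nc_rec f' g f' (\<lambda>u. g (a # u)) (b # u)) (nc_rec f' g (\<lambda>u. F' (a # u)) G) t"
    proof (intro lconv_cong)
      fix i assume i: "i < length t"
      show "nc_rec f g f (\<lambda>u. g (a # u)) (b # take i t) = nc_rec f' g f' (\<lambda>u. g (a # u)) (b # take i t)"
        using aS eq i set_take_subset[of i t] by (intro nc_rec_cong[where S=S]) (auto simp: bt)
      show "nc_rec f g (\<lambda>u. F (a # u)) G (drop i t) = nc_rec f' g (\<lambda>u. F' (a # u)) G (drop i t)"
        using aS eq i set_drop_subset[of i t] by (intro nc_rec_cong[where S=S]) (auto simp: bt)
    qed
    have 3: "nc_rec f g (\<lambda>u. F (a # u)) G v - nc_rec f' g (\<lambda>u. F' (a # u)) G v = (F (a # v) - F' (a # v)) * G [last v]"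
      using Cons.prems False by (intro Cons.IH) auto
    have "f' [] = 1" using eq(1)[of "[]"] assms(3) by simp
    then have "nc_rec f g F G (a # v) - nc_rec f' g F' G (a # v) =
        nc_rec f g (\<lambda>u. F (a # u)) G v - nc_rec f' g (\<lambda>u. F' (a # u)) G v"
      using eq(2)[of "[a]"] aS assms(2)[of a] assms(3)
      by (simp add: nc_rec_Cons[of f g F] nc_rec_Cons[of f' g F'] 1[unfolded bt] bt lconv_Cons 2)
    then show ?thesis using 3 False by simp
  qed
qed simp

text \<open>The mirror case: the complement is a single block only for the partition into
  singletons, and there the first block contributes \<open>F [hd w]\<close>.\<close>

lemma nc_rec_diff_right:
  assumes "\<And>u. set u \<subseteq> S \<Longrightarrow> length u < length w \<Longrightarrow> g u = g' u \<and> G u = G' u"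
    and "\<And>a. a \<in> S \<Longrightarrow> f [a] = 1" "f [] = 1" "set w \<subseteq> S" "w \<noteq> []"
  shows "nc_rec f g F G w - nc_rec f g' F G' w = F [hd w] * (G w - G' w)"
  using assms(1,4,5)
proof (induction w arbitrary: F G G')
  case (Cons a v)
  show ?case
  proof (cases "v = []")
    case True
    then show ?thesis using assms(3) by (simp add: nc_rec_Cons algebra_simps)
  next
    case False
    have aS: "a \<in> S" "set v \<subseteq> S" using Cons.prems by auto
    have eq: "g u = g' u" "G u = G' u" if "set u \<subseteq> S" "length u \<le> length v" for u
      using Cons.prems(1) that by auto
    have 2: "lconv (nc_rec f g f (\<lambda>u. g (a # u))) (nc_rec f g (\<lambda>u. F (a # u)) G) v =
        lconv (nc_rec f g' f (\<lambda>u. g' (a # u))) (nc_rec f g' (\<lambda>u. F (a # u)) G') v"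
    proof (intro lconv_cong)
      fix i assume i: "i < length v"
      show "nc_rec f g f (\<lambda>u. g (a # u)) (take i v) = nc_rec f g' f (\<lambda>u. g' (a # u)) (take i v)"
        using aS eq i set_take_subset[of i v] by (intro nc_rec_cong[where S=S]) auto
      show "nc_rec f g (\<lambda>u. F (a # u)) G (drop i v) = nc_rec f g' (\<lambda>u. F (a # u)) G' (drop i v)"
        using aS eq i set_drop_subset[of i v] by (intro nc_rec_cong[where S=S]) auto
    qed
    have 3: "nc_rec f g f (\<lambda>u. G (a # u)) v - nc_rec f g' f (\<lambda>u. G' (a # u)) v = f [hd v] * (G (a # v) - G' (a # v))"
      using Cons.prems False by (intro Cons.IH) auto
    have "hd v \<in> S" using False aS by auto
    then have "f [hd v] = 1" using assms(2) by simp
    then show ?thesis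
      using 3 by (simp add: nc_rec_Cons[of f g F] nc_rec_Cons[of f g' F] 2 right_diff_distrib[symmetric])
  qed
qed simp

lemma nc_rec_zero_left:
  assumes "\<And>u. u \<noteq> [] \<Longrightarrow> F u = 0" "w \<noteq> []"
  shows "nc_rec f g F G w = 0"
proof -
  have zero: "nc_rec f g (\<lambda>u. 0) G w = 0" for w
    using nc_rec_linear_left[of f g "-1" "\<lambda>u. 0" "\<lambda>u. 0" G w] by simp
  obtain a v where "w = a # v" using assms(2) by (cases w) auto
  then show ?thesis using assms(1) by (simp add: nc_rec_Cons zero lconv_def)
qed

lemma nc_rec_unit_left:
  assumes "e [] = 1" "\<And>a. a \<in> S \<Longrightarrow> e [a] = 1" "\<And>u. 2 \<le> length u \<Longrightarrow> e u = 0" "set w \<subseteq> S"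
  shows "nc_rec e g e G w = G w"
  using assms(4)
proof (induction w arbitrary: G)
  case (Cons a w)
  have "lconv X (nc_rec e g (\<lambda>u. e (a # u)) G) w = 0" for X
    unfolding lconv_def using assms(3)
    by (intro sum.neutral ballI, subst nc_rec_zero_left) (auto simp: Suc_le_eq)
  then show ?case using Cons assms(2)[of a] by (simp add: nc_rec_Cons)
qed (simp add: assms(1))

section \<open>Associativity of the recursion\<close>

lemma lconv_shift: "(\<lambda>u. lconv X Y (a # u)) = (\<lambda>u. X [] * Y (a # u) + lconv (\<lambda>u. X (a # u)) Y u)"
  by (simp add: lconv_Cons fun_eq_iff)

text \<open>If the first block is divided into an initial part weighted by \<open>X\<close> and a
  non-empty rest weighted by \<open>Y\<close>, the word is cut just before the rest. The Kreweras
  block that ends at the cut is enclosed between two consecutive points of the first block, so it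
  gets the ordinary weight \<open>g\<close>.\<close>

lemma nc_rec_lconv_left:
  assumes "g [] = 1"
  shows "nc_rec f g (lconv X Y) H w = lconv (nc_rec f g X g) (nc_rec f g Y H) w"
proof (induction w arbitrary: X rule: length_induct)
  case (1 w)
  show ?case
  proof (cases w)
    case (Cons a v)
    have IH: "lconv Z (nc_rec f g (lconv (\<lambda>u. X (a # u)) Y) H) v =
        lconv Z (lconv (nc_rec f g (\<lambda>u. X (a # u)) g) (nc_rec f g Y H)) v" for Z
      using 1[rule_format] by (intro lconv_cong) (auto simp: Cons)
    have "nc_rec f g (lconv X Y) H w =
      X [] * nc_rec f g Y H w + lconv (nc_rec f g f (\<lambda>u. g (a # u))) (nc_rec f g (lconv (\<lambda>u. X (a # u)) Y) H) v"
      by (simp add: Cons nc_rec_Cons lconv_shift nc_rec_linear_left' lconv_add_right lconv_scale_right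
          lconv_Cons algebra_simps)
    also have "\<dots> = lconv (nc_rec f g X g) (nc_rec f g Y H) w"
      by (simp add: IH Cons lconv_Cons assms lconv_assoc) (simp add: nc_rec_Cons)
    finally show ?thesis .
  qed simp
qed

text \<open>Here the last Kreweras block is divided, and the word is cut after its initial part. The
  letters after the cut form a union of blocks, so their first block has the ordinary weight
  \<open>f\<close>. The leading letter is split off because \<open>F\<close> must stay with the left
  piece, and an empty left piece would lose it.\<close>

lemma nc_rec_lconv_right:
  assumes "f [] = 1"
  shows "nc_rec f g F (lconv X Y) (a # w) =
    X [] * nc_rec f g F Y (a # w) + lconv (\<lambda>u. nc_rec f g F X (a # u)) (nc_rec f g f Y) w"
proof (induction "length w" arbitrary: F X a w rule: less_induct)
  case less
  have IH1: "nc_rec f g f (lconv (\<lambda>u. X (a # u)) Y) w = lconv (nc_rec f g f (\<lambda>u. X (a # u))) (nc_rec f g f Y) w"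
  proof (cases w)
    case (Cons b v)
    then show ?thesis by (subst Cons, subst less) (auto simp: assms lconv_Cons)
  qed simp
  have IH2: "lconv Z (nc_rec f g (\<lambda>u. F (a # u)) (lconv X Y)) w =
    lconv Z (\<lambda>v. X [] * nc_rec f g (\<lambda>u. F (a # u)) Y v + lconv (\<lambda>u. if u = [] then 0 else nc_rec f g (\<lambda>u. F (a # u)) X u) (nc_rec f g f Y) v) w" for Z
  proof (intro lconv_cong refl)
    fix i assume i: "i < length w"
    then obtain b v where bv: "drop i w = b # v" by (cases "drop i w") auto
    then have "length v < length w" using i
      by (metis length_drop length_Cons Suc_le_lessD diff_le_self)
    then show "nc_rec f g (\<lambda>u. F (a # u)) (lconv X Y) (drop i w) = X [] * nc_rec f g (\<lambda>u. F (a # u)) Y (drop i w)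
          + lconv (\<lambda>u. if u = [] then 0 else nc_rec f g (\<lambda>u. F (a # u)) X u) (nc_rec f g f Y) (drop i w)"
      by (simp add: bv less lconv_Cons)
  qed
  show ?case
    unfolding nc_rec_Cons[of f g F "lconv X Y"] lconv_shift nc_rec_linear_right IH1 IH2
    by (simp add: lconv_add_right lconv_scale_right lconv_Cons lconv_assoc nc_rec_Cons lconv_if_Nil lconv_add_left
        lconv_scale_left algebra_simps)
qed

lemma nc_rec_lconv_right':
  assumes "f [] = 1"
  shows "nc_rec f g f (lconv X Y) w = lconv (nc_rec f g f X) (nc_rec f g f Y) w"
  by (cases w) (simp_all add: nc_rec_lconv_right assms lconv_Cons)

text \<open>Shifting an inner recursion by a letter, as in \<open>sh\<close>, produces products and
  \<open>lconv\<close> sums. The preceding lemmas push the outer recursion through them, and both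
  sides become the same sum over double cuts. \<open>g [a] = 1\<close> matches the factor that the
  shifted weight \<open>nc_rec g h g h\<close> brings in on the right.\<close>

theorem nc_rec_assoc:
  assumes "f [] = 1" "g [] = 1" "h [] = 1" "\<And>a. a \<in> S \<Longrightarrow> g [a] = 1" "set w \<subseteq> S"
  shows "nc_rec (nc_rec f g f g) h (nc_rec f g F G) H w = nc_rec f (nc_rec g h g h) F (nc_rec g h G H) w"
  using assms(5)
proof (induction w arbitrary: F G H rule: length_induct)
  case (1 w)
  show ?case
  proof (cases w)
    case (Cons a v)
    let ?fg = "nc_rec f g f g" and ?gh = "nc_rec g h g h"
    have S: "a \<in> S" "set v \<subseteq> S" "\<And>i. set (take i v) \<subseteq> S" "\<And>i. set (drop i v) \<subseteq> S"
      using 1(2) by (auto simp: Cons dest: in_set_takeD in_set_dropD)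
    have sh: "(\<lambda>u. nc_rec f g F G (a # u)) = (\<lambda>u. F [a] * nc_rec f g f (\<lambda>u. G (a # u)) u
       + lconv (nc_rec f g f (\<lambda>u. g (a # u))) (nc_rec f g (\<lambda>u. F (a # u)) G) u)" for f g F G
      by (simp add: nc_rec_Cons fun_eq_iff)
    have IH: "nc_rec ?fg h (nc_rec f g F G) H u = nc_rec f ?gh F (nc_rec g h G H) u"
      if "length u < length w" "set u \<subseteq> S" for u F G H
      using 1(1) that by blast
    have E1: "nc_rec ?fg h (\<lambda>u. nc_rec f g F G (a # u)) H u =
        F [a] * nc_rec f ?gh f (nc_rec g h (\<lambda>u. G (a # u)) H) u
        + lconv (nc_rec f ?gh f (nc_rec g h (\<lambda>u. g (a # u)) h)) (nc_rec f ?gh (\<lambda>u. F (a # u)) (nc_rec g h G H)) u"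
      if "u \<in> range (\<lambda>i. drop i v)" for u
    proof -
      have u: "length u < length w" "set u \<subseteq> S"
        using that S(4) by (fastforce simp: Cons)+
      have "set (take i u) \<subseteq> S" "set (drop i u) \<subseteq> S" for i
        using u(2) set_take_subset[of i u] set_drop_subset[of i u] by auto
      then have "lconv (nc_rec ?fg h (nc_rec f g f (\<lambda>u. g (a # u))) h) (nc_rec ?fg h (nc_rec f g (\<lambda>u. F (a # u)) G) H) u =
         lconv (nc_rec f ?gh f (nc_rec g h (\<lambda>u. g (a # u)) h)) (nc_rec f ?gh (\<lambda>u. F (a # u)) (nc_rec g h G H)) u"
        using u by (intro lconv_cong IH) auto
      then show ?thesis
        by (simp add: sh nc_rec_linear_left nc_rec_lconv_left assms IH u)
    qed
    have E2: "lconv (nc_rec ?fg h ?fg (\<lambda>u. h (a # u))) (nc_rec ?fg h (\<lambda>u. nc_rec f g F G (a # u)) H) v =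
       lconv (nc_rec f ?gh f (nc_rec g h g (\<lambda>u. h (a # u)))) (\<lambda>u. F [a] * nc_rec f ?gh f (nc_rec g h (\<lambda>u. G (a # u)) H) u
        + lconv (nc_rec f ?gh f (nc_rec g h (\<lambda>u. g (a # u)) h)) (nc_rec f ?gh (\<lambda>u. F (a # u)) (nc_rec g h G H)) u) v"
      using S by (intro lconv_cong E1 IH) (auto simp: Cons)
    have E3: "nc_rec ?fg h ?fg (\<lambda>u. H (a # u)) v = nc_rec f ?gh f (nc_rec g h g (\<lambda>u. H (a # u))) v"
      using S by (intro IH) (auto simp: Cons)
    have E4: "nc_rec f g F G [a] = F [a] * G [a]"
      by (simp add: nc_rec_Cons assms)
    show ?thesis
      unfolding Cons nc_rec_Cons[of ?fg] nc_rec_Cons[of f ?gh] E2 E3 E4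
      by (simp add: sh nc_rec_add_right nc_rec_scale_right nc_rec_lconv_right' assms S lconv_add_right lconv_scale_right
          lconv_assoc lconv_add_left algebra_simps)
  qed simp
qed


section \<open>Non-crossing partitions and the Kreweras complement\<close>

text \<open>For \<open>i < j\<close>, \<open>sep P i j\<close> says that \<open>{i<..j}\<close> is a union of blocks of \<open>P\<close>, if \<open>P\<close> is a partition; this is
  when \<open>i'\<close> and \<open>j'\<close> lie in the same block of the Kreweras complement.\<close>

definition cuts :: "nat \<Rightarrow> nat \<Rightarrow> nat \<Rightarrow> bool" where
  "cuts i j p \<longleftrightarrow> (i < p \<longleftrightarrow> j < p)"

definition sep :: "nat set set \<Rightarrow> nat \<Rightarrow> nat \<Rightarrow> bool" where
  "sep P i j \<longleftrightarrow> (\<forall>V\<in>P. \<forall>p\<in>V. \<forall>q\<in>V. cuts i j p = cuts i j q)"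

lemma sep_refl: "sep P i i"
  by (simp add: sep_def cuts_def)

lemma cuts_less: "i < j \<Longrightarrow> cuts i j p \<longleftrightarrow> p \<le> i \<or> j < p"
  by (auto simp: cuts_def)

lemma cuts_sym: "cuts i j = cuts j i"
  by (auto simp: cuts_def fun_eq_iff)

lemma sep_sym: "sep P i j \<Longrightarrow> sep P j i"
  unfolding sep_def using cuts_sym[of i j] by (simp only:)

text \<open>\<open>cuts i j p\<close> says that \<open>p\<close> lies on the same side of
  \<open>i'\<close> and \<open>j'\<close>, and of \<open>cuts i j p\<close>,
  \<open>cuts j k p\<close> and \<open>cuts i k p\<close> any two determine the third. So
  \<open>sep P\<close> is an equivalence relation for every \<open>P\<close>, crossing or
  not.\<close>

lemma sep_trans:
  assumes "sep P i j" "sep P j k"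
  shows "sep P i k"
  unfolding sep_def
proof (intro ballI)
  fix V p q assume "V \<in> P" "p \<in> V" "q \<in> V"
  then have "cuts i j p = cuts i j q" "cuts j k p = cuts j k q"
    using assms unfolding sep_def by blast+
  then show "cuts i k p = cuts i k q" unfolding cuts_def by argo
qed

text \<open>Handling partitions through this relation turns statements on Kreweras complements into
  statements about pairs of points.\<close>

definition same_block :: "nat set set \<Rightarrow> nat \<Rightarrow> nat \<Rightarrow> bool" where
  "same_block P x y \<longleftrightarrow> (\<exists>V\<in>P. x \<in> V \<and> y \<in> V)"

lemma sep_iff: "sep P i j \<longleftrightarrow>
    (\<forall>p q. same_block P p q \<longrightarrow> cuts i j p = cuts i j q)"
  unfolding sep_def same_block_def by blast

lemma same_block_trans:
  assumes "partition_on A P" "same_block P x y" "same_block P y z"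
  shows "same_block P x z"
proof -
  obtain V W where VW: "V \<in> P" "W \<in> P" "x \<in> V" "y \<in> V" "y \<in> W" "z \<in> W"
    using assms unfolding same_block_def by auto
  then have "V = W" using assms(1) partition_onD2 by (auto dest: disjointD)
  then show ?thesis using VW unfolding same_block_def by auto
qed

lemma same_block_sym: "same_block P x y \<Longrightarrow> same_block P y x"
  unfolding same_block_def by blast

lemma noncrossingD:
  assumes "noncrossing P" "V \<in> P" "W \<in> P" "V \<noteq> W" "a \<in> V" "b \<in> W" "c \<in> V" "d \<in> W"
    and "a < b" "b < c" "c < d"
  shows False
proof -
  have "\<not> (\<exists>a\<in>V. \<exists>b\<in>W. \<exists>c\<in>V. \<exists>d\<in>W. a < b \<and> b < c \<and> c < d)"
    by (rule assms(1)[unfolded noncrossing_def, THEN bspec, THEN bspec, THEN mp, OF assms(2-4)])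
  moreover have "\<exists>a\<in>V. \<exists>b\<in>W. \<exists>c\<in>V. \<exists>d\<in>W. a < b \<and> b < c \<and> c < d"
    by (rule bexI[OF _ assms(5)], rule bexI[OF _ assms(6)], rule bexI[OF _ assms(7)],
        rule bexI[OF _ assms(8)]) (simp add: assms(9-))
  ultimately show False ..
qed

lemma noncrossingI:
  assumes "\<And>V W a b c d. V \<in> P \<Longrightarrow> W \<in> P \<Longrightarrow> V \<noteq> W \<Longrightarrow> a \<in> V \<Longrightarrow> b \<in> W \<Longrightarrow> c \<in> V \<Longrightarrow> d \<in> W \<Longrightarrow>
    a < b \<Longrightarrow> b < c \<Longrightarrow> c < d \<Longrightarrow> False"
  shows "noncrossing P"
  unfolding noncrossing_def
proof (intro ballI impI notI)
  fix V W assume VW: "V \<in> P" "W \<in> P" "V \<noteq> W"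
    and "\<exists>a\<in>V. \<exists>b\<in>W. \<exists>c\<in>V. \<exists>d\<in>W. a < b \<and> b < c \<and> c < d"
  then show False using assms[OF VW] by (elim bexE conjE)
qed

lemma noncrossing_iff:
  assumes "partition_on A P"
  shows "noncrossing P \<longleftrightarrow>
    (\<forall>a b c d. a < b \<longrightarrow> b < c \<longrightarrow> c < d \<longrightarrow> same_block P a c \<longrightarrow> same_block P b d \<longrightarrow> same_block P a b)"
    (is "_ \<longleftrightarrow> ?R")
proof
  assume *: "noncrossing P"
  show ?R
  proof (intro allI impI)
    fix a b c d :: nat assume l: "a < b" "b < c" "c < d" and "same_block P a c" "same_block P b d"
    then obtain V W where VW: "V \<in> P" "W \<in> P" "a \<in> V" "c \<in> V" "b \<in> W" "d \<in> W"
      unfolding same_block_def by auto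
    have "V = W"
      by (rule ccontr) (rule noncrossingD[OF * VW(1,2) _ VW(3,5,4,6) l])
    then show "same_block P a b" using VW unfolding same_block_def by auto
  qed
next
  assume *: ?R
  show "noncrossing P"
  proof (rule noncrossingI)
    fix V W a b c d assume VW: "V \<in> P" "W \<in> P" "V \<noteq> W"
      and l: "a \<in> V" "b \<in> W" "c \<in> V" "d \<in> W" "a < b" "b < c" "c < d"
    then have "same_block P a c" "same_block P b d"
      using VW by (auto simp: same_block_def)
    then have "same_block P a b" using * l by simp
    then obtain U where U: "U \<in> P" "a \<in> U" "b \<in> U" unfolding same_block_def by auto
    then have "U = V" and "U = W"
      using VW l assms partition_onD2 by (auto dest: disjointD)
    then show False using VW by simp
  qed
qed

text \<open>Blocks from the same copy cross only if they crossed before interleaving. A block of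
  \<open>P\<close> crosses a block of \<open>Q\<close> only if two points of the latter have some
  but not all points of the former between them, which \<open>sep\<close> excludes.\<close>

lemma noncrossing_interleave:
  assumes "noncrossing P" "noncrossing Q"
    and sep: "\<And>i j. same_block Q i j \<Longrightarrow> sep P i j"
  shows "noncrossing (interleave P Q)"
proof (rule noncrossingI)
  let ?e = "(`) (\<lambda>i::nat. 2 * i)" and ?o = "(`) (\<lambda>i::nat. 2 * i + 1)"
  fix V W a b c d
  assume VW: "V \<in> interleave P Q" "W \<in> interleave P Q" "V \<noteq> W"
    and l: "a \<in> V" "b \<in> W" "c \<in> V" "d \<in> W" "a < b" "b < c" "c < d"
  have cross: False if "X \<in> P" "Y \<in> Q" "p \<in> X" "q \<in> X" "i \<in> Y" "j \<in> Y"
      "cuts i j p \<noteq> cuts i j q" for X Y p q i j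
    using sep[of i j] that unfolding sep_def same_block_def by auto
  consider (PP) X Y where "X \<in> P" "Y \<in> P" "V = ?e X" "W = ?e Y"
    | (QQ) X Y where "X \<in> Q" "Y \<in> Q" "V = ?o X" "W = ?o Y"
    | (PQ) X Y where "X \<in> P" "Y \<in> Q" "V = ?e X" "W = ?o Y"
    | (QP) X Y where "X \<in> Q" "Y \<in> P" "V = ?o X" "W = ?e Y"
  proof -
    have "(\<exists>X\<in>P. V = ?e X) \<or> (\<exists>X\<in>Q. V = ?o X)" "(\<exists>Y\<in>P. W = ?e Y) \<or> (\<exists>Y\<in>Q. W = ?o Y)"
      using VW by (auto simp: interleave_def)
    then show ?thesis using that by metis
  qed
  then show False
  proof cases
    case PP
    then obtain a' b' c' d' where "a' \<in> X" "b' \<in> Y" "c' \<in> X" "d' \<in> Y" "a' < b'" "b' < c'" "c' < d'"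
      using l by auto
    then show False using noncrossingD[OF assms(1) PP(1,2)] PP(3,4) VW(3) by blast
  next
    case QQ
    then obtain a' b' c' d' where "a' \<in> X" "b' \<in> Y" "c' \<in> X" "d' \<in> Y" "a' < b'" "b' < c'" "c' < d'"
      using l by auto
    then show False using noncrossingD[OF assms(2) QQ(1,2)] QQ(3,4) VW(3) by blast
  next
    case PQ
    then obtain a' b' c' d' where *: "a' \<in> X" "b' \<in> Y" "c' \<in> X" "d' \<in> Y"
      "2 * a' < 2 * b' + 1" "2 * b' + 1 < 2 * c'" "2 * c' < 2 * d' + 1"
      using l by auto
    then show False
      by (intro cross[of X Y a' c' b' d'] PQ) (auto simp: cuts_def)
  next
    case QP
    then obtain a' b' c' d' where *: "a' \<in> X" "b' \<in> Y" "c' \<in> X" "d' \<in> Y"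
      "2 * a' + 1 < 2 * b'" "2 * b' < 2 * c' + 1" "2 * c' + 1 < 2 * d'"
      using l by auto
    then show False
      by (intro cross[of Y X b' d' a' c'] QP) (auto simp: cuts_def)
  qed
qed

lemma sep_if_noncrossing_interleave:
  assumes "noncrossing (interleave P Q)" "same_block Q i j"
  shows "sep P i j"
proof -
  have main: False
    if ij: "i < j" "W \<in> Q" "i \<in> W" "j \<in> W" and V: "V \<in> P" "p \<in> V" "q \<in> V"
      and p: "i < p" "p \<le> j" and q: "q \<le> i \<or> j < q" for i j p q V W
  proof -
    let ?e = "(`) (\<lambda>i::nat. 2 * i)" and ?o = "(`) (\<lambda>i::nat. 2 * i + 1)"
    have in': "?e V \<in> interleave P Q" "?o W \<in> interleave P Q"
      using ij V by (auto simp: interleave_def)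
    have ne: "?e V \<noteq> ?o W"
    proof
      assume "?e V = ?o W"
      then have "2 * p \<in> ?o W" using V by blast
      then show False by (auto simp: image_iff) presburger
    qed
    have mem: "2 * p \<in> ?e V" "2 * q \<in> ?e V" "2 * i + 1 \<in> ?o W" "2 * j + 1 \<in> ?o W"
      using ij V by auto
    from q show False
    proof
      assume "q \<le> i"
      then have "2 * q < 2 * i + 1" "2 * i + 1 < 2 * p" "2 * p < 2 * j + 1" using p by auto
      then show False using noncrossingD[OF assms(1) in' ne mem(2,3,1,4)] by simp
    next
      assume "j < q"
      then have "2 * i + 1 < 2 * p" "2 * p < 2 * j + 1" "2 * j + 1 < 2 * q" using p by auto
      then show False using noncrossingD[OF assms(1) in'(2,1) ne[symmetric] mem(3,1,4,2)] by simp
    qed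
  qed
  obtain W where W: "W \<in> Q" "i \<in> W" "j \<in> W" using assms(2) unfolding same_block_def by blast
  show ?thesis
    unfolding sep_def
  proof (intro ballI)
    fix V p q assume V: "V \<in> P" "p \<in> V" "q \<in> V"
    show "cuts i j p = cuts i j q"
    proof (cases i j rule: linorder_cases)
      case less
      then show ?thesis
        using main[OF less W V(1,2,3)] main[OF less W V(1,3,2)] by (metis cuts_less[OF less] not_le)
    next
      case greater
      then show ?thesis
        using main[OF greater W(1,3,2) V(1,2,3)] main[OF greater W(1,3,2) V(1,3,2)] by (metis cuts_sym cuts_less[OF greater] not_le)
    qed (simp add: cuts_def)
  qed
qed

lemma refines_iff:
  assumes "partition_on A Q'" "partition_on A Q"
  shows "refines A Q' Q \<longleftrightarrow> (\<forall>i j. same_block Q' i j \<longrightarrow> same_block Q i j)"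
proof
  assume "refines A Q' Q"
  then show "\<forall>i j. same_block Q' i j \<longrightarrow> same_block Q i j"
    unfolding refines_def same_block_def by blast
next
  assume *: "\<forall>i j. same_block Q' i j \<longrightarrow> same_block Q i j"
  have "\<exists>Y\<in>Q. X \<subseteq> Y" if X: "X \<in> Q'" for X
  proof -
    obtain x where x: "x \<in> X" using X assms(1) by (metis partition_onD3 ex_in_conv)
    then obtain Y where Y: "Y \<in> Q" "x \<in> Y" using assms X by (metis UnionE UnionI partition_onD1)
    have "y \<in> Y" if "y \<in> X" for y
    proof -
      have "same_block Q x y" using * X x that unfolding same_block_def by blast
      then show ?thesis using Y assms(2) unfolding same_block_def partition_on_def disjoint_def by blast
    qed
    then show ?thesis using Y by blast
  qed
  then show "refines A Q' Q" using assms by (simp add: refines_def)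
qed

text \<open>If \<open>interleave P Q'\<close> is non-crossing, the relation of \<open>Q'\<close> is
  contained in \<open>sep P\<close>; a partition whose relation is exactly \<open>sep P\<close> is
  thus the coarsest one. Later computations of complements check this pointwise criterion instead of
  the definite description.\<close>

lemma kreweras_eqI:
  assumes P: "P \<in> NC n" and Q: "partition_on {..<n} Q"
    and sb: "\<And>i j. i < n \<Longrightarrow> j < n \<Longrightarrow> same_block Q i j \<longleftrightarrow> sep P i j"
  shows "kreweras n P = Q"
proof -
  have lt: "i < n" "j < n" if "same_block Q' i j" "partition_on {..<n} Q'" for i j Q'
    using that unfolding same_block_def partition_on_def by auto
  have nc: "noncrossing Q"
    unfolding noncrossing_iff[OF Q]
  proof (intro allI impI)
    fix a b c d :: nat assume l: "a < b" "b < c" "c < d" and s: "same_block Q a c" "same_block Q b d"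
    then have n: "a < n" "b < n" "c < n" "d < n" using lt Q by blast+
    have "sep P a c" "sep P b d" using s sb n by blast+
    \<comment> \<open>As sets, \<open>{a<..b}\<close> is \<open>{a<..c}\<close> minus
      \<open>{b<..d}\<close>.\<close>
    have ab: "cuts a b p \<longleftrightarrow> cuts a c p \<or> \<not> cuts b d p" for p
      using l by (auto simp: cuts_less)
    have "sep P a b"
      unfolding sep_def
    proof (intro ballI)
      fix V p q assume "V \<in> P" "p \<in> V" "q \<in> V"
      then have "cuts a c p = cuts a c q" "cuts b d p = cuts b d q"
        using \<open>sep P a c\<close> \<open>sep P b d\<close> unfolding sep_def by blast+
      then show "cuts a b p = cuts a b q"
        by (simp add: ab)
    qed
    then show "same_block Q a b" using sb n by blast
  qed
  have QNC: "Q \<in> NC n" using Q nc by (simp add: NC_def)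
  have ni: "noncrossing (interleave P Q)"
  proof (rule noncrossing_interleave[OF _ nc])
    show "noncrossing P" using P by (simp add: NC_def)
    show "sep P i j" if "same_block Q i j" for i j
      by (rule sb[OF lt[OF that Q], THEN iffD1, OF that])
  qed
  have max: "refines {..<n} Q' Q" if "Q' \<in> NC n" "noncrossing (interleave P Q')" for Q'
  proof -
    have Q': "partition_on {..<n} Q'" using that by (simp add: NC_def)
    have "same_block Q i j" if "same_block Q' i j" for i j
      using sb[OF lt[OF that Q']] sep_if_noncrossing_interleave[OF _ that] \<open>noncrossing (interleave P Q')\<close>
      by blast
    then show ?thesis unfolding refines_iff[OF Q' Q] by (intro allI impI)
  qed
  show ?thesis
    unfolding kreweras_def
  proof (rule the_equality)
    fix Q' assume Q': "Q' \<in> NC n \<and> noncrossing (interleave P Q') \<and>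
        (\<forall>Q''\<in>NC n. noncrossing (interleave P Q'') \<longrightarrow> refines {..<n} Q'' Q')"
    show "Q' = Q"
    proof (rule refines_asym)
      show "refines {..<n} Q' Q" using Q' by (intro max) simp_all
      show "refines {..<n} Q Q'" by (rule Q'[THEN conjunct2, THEN conjunct2, rule_format, OF QNC ni])
    qed
  qed (intro conjI ballI impI QNC ni max)
qed

text \<open>The quotient of \<open>{..<n}\<close> by \<open>sep P\<close> meets the criterion, so
  the complement exists.\<close>

lemma kreweras_props:
  assumes P: "P \<in> NC n"
  shows partition_on_kreweras: "partition_on {..<n} (kreweras n P)"
    and same_block_kreweras: "\<And>i j. i < n \<Longrightarrow> j < n \<Longrightarrow> same_block (kreweras n P) i j \<longleftrightarrow> sep P i j"
proof -
  let ?r = "{(i, j). i < n \<and> j < n \<and> sep P i j}"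
  have r: "equiv {..<n} ?r"
    by (rule equivI) (auto simp: refl_on_def sym_def trans_def intro: sep_refl sep_sym sep_trans)
  have "same_block ({..<n} // ?r) i j \<longleftrightarrow> sep P i j" if "i < n" "j < n" for i j
  proof -
    have "same_block ({..<n} // ?r) i j \<longleftrightarrow> (i, j) \<in> ?r"
    proof
      assume "same_block ({..<n} // ?r) i j"
      then obtain V where V: "V \<in> {..<n} // ?r" "i \<in> V" "j \<in> V"
        unfolding same_block_def by blast
      then show "(i, j) \<in> ?r" using quotient_eq_iff[OF r V(1,1,2,3)] by blast
    next
      assume "(i, j) \<in> ?r"
      moreover have "(i, i) \<in> ?r" using that by (simp add: sep_refl)
      ultimately show "same_block ({..<n} // ?r) i j"
        unfolding same_block_def
        by (intro bexI[of _ "?r `` {i}"] quotientI) (use that in auto)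
    qed
    then show ?thesis using that by simp
  qed
  then have "kreweras n P = {..<n} // ?r"
    by (intro kreweras_eqI P partition_on_quotient r)
  then show "partition_on {..<n} (kreweras n P)"
    and "\<And>i j. i < n \<Longrightarrow> j < n \<Longrightarrow> same_block (kreweras n P) i j \<longleftrightarrow> sep P i j"
    using r partition_on_quotient \<open>\<And>i j. i < n \<Longrightarrow> j < n \<Longrightarrow> same_block ({..<n} // ?r) i j \<longleftrightarrow> sep P i j\<close>
    by auto
qed

section \<open>Building partitions by shifting blocks and attaching a point\<close>

lemma partition_on_Un:
  assumes "partition_on A P" "partition_on B Q" "A \<inter> B = {}"
  shows "partition_on (A \<union> B) (P \<union> Q)"
proof (rule partition_onI)
  show "\<Union> (P \<union> Q) = A \<union> B" "{} \<notin> P \<union> Q"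
    using assms by (auto simp: partition_on_def)
  fix p q assume pq: "p \<in> P \<union> Q" "q \<in> P \<union> Q" "p \<noteq> q"
  have sub: "X \<subseteq> A" if "X \<in> P" for X using that assms by (auto simp: partition_on_def)
  have sub': "X \<subseteq> B" if "X \<in> Q" for X using that assms by (auto simp: partition_on_def)
  have "disjnt A B" using assms(3) by (simp add: disjnt_def)
  then have mix: "disjnt X Y" "disjnt Y X" if "X \<in> P" "Y \<in> Q" for X Y
    using that sub[of X] sub'[of Y] by (meson disjnt_subset1 disjnt_subset2 disjnt_sym)+
  show "disjnt p q"
    using pq mix pairwiseD[OF partition_onD2[OF assms(1)], of p q]
      pairwiseD[OF partition_onD2[OF assms(2)], of p q] by blast
qed

text \<open>Used on both sides: in \<open>glue\<close> the point 0 is put into the block of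
  \<open>Suc i\<close>, and in the complement of \<open>lead P\<close> it is put into the block of
  the last point.\<close>

definition attach :: "(nat \<Rightarrow> nat) \<Rightarrow> nat \<Rightarrow> nat \<Rightarrow> nat set \<Rightarrow> nat set" where
  "attach f a c V = (if c \<in> V then insert a (f ` V) else f ` V)"

lemma partition_on_attach:
  assumes P: "partition_on A P" and f: "inj_on f A" "a \<notin> f ` A" "c \<in> A"
  shows "partition_on (insert a (f ` A)) (attach f a c ` P)"
proof -
  have A: "A = \<Union> P" using P by (simp add: partition_on_def)
  have "partition_on (attach f a c A) (attach f a c ` P - {{}})"
  proof (rule partition_on_transform[OF P])
    show "\<Union> (attach f a c ` P) = attach f a c (\<Union> P)"
      using f(3) unfolding A attach_def by (auto split: if_splits)
    fix p q assume "p \<in> P" "q \<in> P" "disjnt p q"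
    moreover from this have "p \<subseteq> A" "q \<subseteq> A" using A by auto
    moreover from this calculation have "f ` p \<inter> f ` q = {}"
      using f(1) by (metis disjnt_def image_empty inj_on_image_Int)
    ultimately show "disjnt (attach f a c p) (attach f a c q)"
      using f(2) by (auto simp: attach_def disjnt_def)
  qed
  moreover have "{} \<notin> attach f a c ` P"
    using partition_onD3[OF P] by (auto simp: attach_def split: if_splits)
  ultimately show ?thesis using f(3) by (simp add: attach_def)
qed

lemma inj_on_attach:
  assumes "inj f" "a \<notin> range f"
  shows "inj_on (attach f a c) P"
proof (rule inj_on_inverseI)
  fix V show "f -` attach f a c V = V"
    using assms by (auto simp: attach_def dest: injD)
qed

text \<open>Retracting the new point to the point it is attached to turns \<open>attach\<close> into a shift.\<close>

lemma same_block_attach: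
  assumes "inj f" "a \<notin> range f" "partition_on A P" "c \<in> A"
  shows "same_block (attach f a c ` P) x y \<longleftrightarrow>
    (\<exists>x' y'. (if x = a then f c else x) = f x' \<and> (if y = a then f c else y) = f y' \<and> same_block P x' y')"
proof -
  have *: "x \<in> attach f a c V \<longleftrightarrow> (\<exists>x'\<in>V. (if x = a then f c else x) = f x')" for x V
    using assms(1,2) by (auto simp: attach_def inj_def)
  show ?thesis by (simp add: same_block_def *) blast
qed

lemma same_block_image:
  "same_block ((`) f ` P) x y \<longleftrightarrow> (\<exists>x' y'. x = f x' \<and> y = f y' \<and> same_block P x' y')"
  unfolding same_block_def by blast

lemma same_block_Un: "same_block (P \<union> Q) x y \<longleftrightarrow> same_block P x y \<or> same_block Q x y"
  unfolding same_block_def by blast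

lemma same_block_lt:
  assumes "partition_on {..<n} P" "same_block P x y"
  shows "x < n" "y < n"
  using assms unfolding same_block_def partition_on_def by auto

lemma same_block_refl: "partition_on A P \<Longrightarrow> x \<in> A \<Longrightarrow> same_block P x x"
  unfolding same_block_def partition_on_def by auto

lemma sepD: "sep P i j \<Longrightarrow> same_block P p q \<Longrightarrow> cuts i j p = cuts i j q"
  unfolding sep_iff by blast

lemma sepI: "(\<And>p q. same_block P p q \<Longrightarrow> cuts i j p = cuts i j q) \<Longrightarrow> sep P i j"
  unfolding sep_iff by blast

lemma sep_Un: "sep (P \<union> Q) i j \<longleftrightarrow> sep P i j \<and> sep Q i j"
  unfolding sep_def by blast

text \<open>A partition of \<open>{..<Suc m}\<close> is of the form \<open>lead P\<close> if \<open>{0}\<close> is a block, and \<open>glue i P Q\<close> if \<open>Suc i\<close> is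
  the second element of the block of \<open>0\<close>.\<close>

definition lead :: "nat set set \<Rightarrow> nat set set" where
  "lead P = insert {0} ((`) Suc ` P)"

definition glue :: "nat \<Rightarrow> nat set set \<Rightarrow> nat set set \<Rightarrow> nat set set" where
  "glue i P Q = (`) Suc ` P \<union> attach ((+) (Suc i)) 0 0 ` Q"

lemma partition_on_image_inj:
  assumes "partition_on A P" "inj_on f A"
  shows "partition_on (f ` A) ((`) f ` P)"
  using partition_on_inj_image[OF assms] partition_onD3[OF assms(1)] by (simp add: image_iff)

lemma lessThan_split:
  assumes "i < m"
  shows "{..<Suc m} = Suc ` {..<i} \<union> insert 0 ((+) (Suc i) ` {..<m - i})"
proof
  show "{..<Suc m} \<subseteq> Suc ` {..<i} \<union> insert 0 ((+) (Suc i) ` {..<m - i})"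
  proof
    fix x assume x: "x \<in> {..<Suc m}"
    show "x \<in> Suc ` {..<i} \<union> insert 0 ((+) (Suc i) ` {..<m - i})"
    proof (cases "x \<le> i")
      case True
      then show ?thesis by (cases x) auto
    next
      case False
      then have "x = Suc i + (x - Suc i)" "x - Suc i < m - i" using x by auto
      then show ?thesis by blast
    qed
  qed
qed (use assms in auto)

lemma lead_NC:
  assumes "P \<in> NC m"
  shows "lead P \<in> NC (Suc m)"
proof -
  have P: "partition_on {..<m} P" "noncrossing P" using assms by (auto simp: NC_def)
  have part: "partition_on {..<Suc m} (lead P)"
    using partition_on_Un[OF partition_on_space[of "{0}"] partition_on_image_inj[OF P(1) inj_on_subset[OF inj_Suc]]]
    by (auto simp: lead_def lessThan_Suc_eq_insert_0)
  have "noncrossing (lead P)"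
  proof (rule noncrossingI)
    fix V W a b c d
    assume VW: "V \<in> lead P" "W \<in> lead P" "V \<noteq> W" and abcd: "a \<in> V" "b \<in> W" "c \<in> V" "d \<in> W"
      "a < b" "b < c" "c < d"
    then have "V \<noteq> {0}" "W \<noteq> {0}" by auto
    then obtain V' W' where V'W': "V' \<in> P" "W' \<in> P" "V = Suc ` V'" "W = Suc ` W'"
      using VW by (auto simp: lead_def)
    then obtain a' b' c' d' where "a = Suc a'" "b = Suc b'" "c = Suc c'" "d = Suc d'"
       "a' \<in> V'" "b' \<in> W'" "c' \<in> V'" "d' \<in> W'" using abcd by auto
    then show False
      using VW(3) abcd(5-) by (intro noncrossingD[OF P(2) V'W'(1,2), of a' b' c' d']) (auto simp: V'W')
  qed
  with part show ?thesis by (simp add: NC_def)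
qed

lemma partition_on_glue:
  assumes "i < m" "partition_on {..<i} P" "partition_on {..<m - i} Q"
  shows "partition_on {..<Suc m} (glue i P Q)"
  unfolding lessThan_split[OF assms(1)] glue_def
  by (intro partition_on_Un partition_on_image_inj partition_on_attach assms) (use assms(1) in auto)

lemma glue_NC:
  assumes "i < m" "P \<in> NC i" "Q \<in> NC (m - i)"
  shows "glue i P Q \<in> NC (Suc m)"
proof -
  have P: "partition_on {..<i} P" "noncrossing P" and Q: "partition_on {..<m - i} Q" "noncrossing Q"
    using assms by (auto simp: NC_def)
  note nP = noncrossing_iff[OF P(1), THEN iffD1, OF P(2), rule_format]
  note nQ = noncrossing_iff[OF Q(1), THEN iffD1, OF Q(2), rule_format]
  note part = partition_on_glue[OF assms(1) P(1) Q(1)]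
  have m: "0 \<in> {..<m - i}" using assms(1) by simp
  \<comment> \<open>Retraction of 0 onto its neighbour \<open>Suc i\<close> in the same block; it
    makes the blocks from \<open>Q\<close> plain shifts.\<close>
  define r where "r x = (if x = 0 then Suc i else x)" for x :: nat
  have sb: "same_block (glue i P Q) x y \<longleftrightarrow>
      (\<exists>x' y'. x = Suc x' \<and> y = Suc y' \<and> same_block P x' y') \<or>
      (\<exists>x' y'. r x = Suc i + x' \<and> r y = Suc i + y' \<and> same_block Q x' y')" for x y
    unfolding glue_def same_block_Un same_block_image
    by (subst same_block_attach[OF _ _ Q(1) m]) (auto simp: r_def)
  have "noncrossing (glue i P Q)"
    unfolding noncrossing_iff[OF part]
  proof (intro allI impI)
    fix a b c d assume l: "a < b" "b < c" "c < d"
      and s: "same_block (glue i P Q) a c" "same_block (glue i P Q) b d"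
    from s[unfolded sb] consider
      (PP) a' b' c' d' where "a = Suc a'" "c = Suc c'" "same_block P a' c'" "b = Suc b'" "d = Suc d'" "same_block P b' d'"
    | (PQ) a' b' c' d' where "a = Suc a'" "c = Suc c'" "same_block P a' c'" "r b = Suc i + b'" "r d = Suc i + d'" "same_block Q b' d'"
    | (QP) a' b' c' d' where "r a = Suc i + a'" "r c = Suc i + c'" "same_block Q a' c'" "b = Suc b'" "d = Suc d'" "same_block P b' d'"
    | (QQ) a' b' c' d' where "r a = Suc i + a'" "r c = Suc i + c'" "same_block Q a' c'" "r b = Suc i + b'" "r d = Suc i + d'" "same_block Q b' d'"
      by blast
    then show "same_block (glue i P Q) a b"
    proof cases
      case PP
      then have "same_block P a' b'" using nP[of a' b' c' d'] l by simp
      then show ?thesis unfolding sb using PP by blast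
    next
      case PQ
      then have "c' < i" using same_block_lt[OF P(1)] by blast
      then show ?thesis using PQ l by (simp add: r_def split: if_splits)
    next
      case QP
      then have "d' < i" using same_block_lt[OF P(1)] by blast
      then show ?thesis using QP l by (simp add: r_def split: if_splits)
    next
      case QQ
      \<comment> \<open>Only \<open>a\<close> can be 0, and only 0 is moved by \<open>r\<close>. So
        the order stays strict between \<open>b\<close>, \<open>c\<close> and \<open>d\<close>, but
        \<open>a'\<close> and \<open>b'\<close> coincide for \<open>a = 0\<close> and
        \<open>b = Suc i\<close>.\<close>
      have "b' < c'" "c' < d'" using QQ l by (auto simp: r_def split: if_splits)
      moreover have "a' \<le> b'" using QQ l by (auto simp: r_def split: if_splits)
      moreover have "same_block Q a' a'"
        using QQ(3) same_block_sym same_block_trans[OF Q(1)] by blast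
      ultimately have "same_block Q a' b'" using nQ[of a' b' c' d'] QQ by (cases "a' = b'") auto
      then show ?thesis unfolding sb using QQ by blast
    qed
  qed
  with part show ?thesis by (simp add: NC_def)
qed

text \<open>Since \<open>{0}\<close> is a block, all points after 0 form a union of blocks, so
  \<open>0'\<close> lies in the complementary block of the last point. For an empty rest there is no
  other point to attach it to, and that case is separate.\<close>

lemma kreweras_lead:
  assumes "P \<in> NC (Suc m)"
  shows "kreweras (Suc (Suc m)) (lead P) = attach Suc 0 m ` kreweras (Suc m) P"
proof (rule kreweras_eqI[OF lead_NC[OF assms]])
  let ?K = "kreweras (Suc m) P"
  have K: "partition_on {..<Suc m} ?K" and P: "partition_on {..<Suc m} P"
    using assms partition_on_kreweras by (auto simp: NC_def)
  show "partition_on {..<Suc (Suc m)} (attach Suc 0 m ` ?K)"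
    using partition_on_attach[OF K inj_on_subset[OF inj_Suc subset_UNIV], where a=0 and c=m]
    by (simp add: lessThan_Suc_eq_insert_0[of "Suc m"])
  define r where "r x = (if x = 0 then Suc m else x)" for x :: nat
  fix i j assume ij: "i < Suc (Suc m)" "j < Suc (Suc m)"
  obtain i' where i': "r i = Suc i'" "i' < Suc m" using ij(1) by (cases i) (auto simp: r_def)
  obtain j' where j': "r j = Suc j'" "j' < Suc m" using ij(2) by (cases j) (auto simp: r_def)
  have "same_block (attach Suc 0 m ` ?K) i j \<longleftrightarrow> same_block ?K i' j'"
    by (subst same_block_attach[OF _ _ K]) (use i' j' in \<open>auto simp: r_def\<close>)
  also have "\<dots> \<longleftrightarrow> sep P i' j'" using same_block_kreweras[OF assms] i' j' by blast
  also have "\<dots> \<longleftrightarrow> sep (lead P) i j"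
  proof -
    \<comment> \<open>Retracting an endpoint 0 to \<open>Suc m\<close> moves it from the left of
      every \<open>Suc p\<close> to its right. If exactly one endpoint is 0, this reverses
      \<open>cuts\<close> for all \<open>p\<close> alike, and so it leaves \<open>sep\<close>
      unchanged.\<close>
    have c: "cuts i j (Suc p) = (cuts i' j' p \<longleftrightarrow> (i = 0 \<longleftrightarrow> j = 0))" if "p < Suc m" for p
      using that i' j' by (auto simp: cuts_def r_def split: if_splits)
    have "sep (lead P) i j \<longleftrightarrow> sep ((`) Suc ` P) i j"
      using sep_Un[of "{{0}}" "(`) Suc ` P" i j] by (simp add: lead_def sep_def)
    also have "\<dots> \<longleftrightarrow> (\<forall>p q. same_block P p q \<longrightarrow> cuts i j (Suc p) = cuts i j (Suc q))"
      unfolding sep_iff same_block_image by blast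
    also have "\<dots> \<longleftrightarrow> sep P i' j'"
    proof -
      have "cuts i j (Suc p) = cuts i j (Suc q) \<longleftrightarrow> cuts i' j' p = cuts i' j' q" if "same_block P p q" for p q
        unfolding c[OF same_block_lt(1)[OF P that]] c[OF same_block_lt(2)[OF P that]] by blast
      then show ?thesis unfolding sep_iff by blast
    qed
    finally show ?thesis by blast
  qed
  finally show "same_block (attach Suc 0 m ` ?K) i j \<longleftrightarrow> sep (lead P) i j" .
qed

lemma kreweras_lead_0: "kreweras (Suc 0) (lead {}) = {{0}}"
proof (rule kreweras_eqI)
  show "lead {} \<in> NC (Suc 0)"
    by (rule lead_NC) (simp add: NC_def partition_on_empty noncrossing_def)
qed (auto simp: same_block_def sep_refl partition_on_space lessThan_Suc)

text \<open>The points 0 and \<open>Suc i\<close> share a block, so a union of blocks contains both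
  or neither. Hence no complementary block joins a point up to \<open>i'\<close> to a later one. Up
  to \<open>i'\<close> the shifted blocks of \<open>P\<close> decide, as in \<open>lead P\<close>;
  afterwards only those of \<open>Q\<close> do.\<close>

lemma kreweras_glue:
  assumes "i < m" "P \<in> NC i" "Q \<in> NC (m - i)"
  shows "kreweras (Suc m) (glue i P Q) =
    kreweras (Suc i) (lead P) \<union> (`) ((+) (Suc i)) ` kreweras (m - i) Q"
proof (rule kreweras_eqI[OF glue_NC[OF assms]])
  let ?K = "kreweras (Suc i) (lead P)" and ?L = "kreweras (m - i) Q" and ?s = "(+) (Suc i)"
  have K: "partition_on {..<Suc i} ?K" and L: "partition_on {..<m - i} ?L"
    and P: "partition_on {..<i} P" and Q: "partition_on {..<m - i} Q"
    using assms partition_on_kreweras lead_NC by (auto simp: NC_def)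
  have m: "{..<Suc m} = {..<Suc i} \<union> ?s ` {..<m - i}"
    using lessThan_split[OF assms(1)] by (auto simp: lessThan_Suc_eq_insert_0)
  show "partition_on {..<Suc m} (?K \<union> (`) ?s ` ?L)"
    unfolding m by (intro partition_on_Un partition_on_image_inj K L) auto
  fix x y assume xy: "x < Suc m" "y < Suc m"
  have s0: "sep (glue i P Q) x y \<longleftrightarrow> (\<forall>p q. same_block P p q \<longrightarrow> cuts x y (Suc p) = cuts x y (Suc q)) \<and>
     (\<forall>p q. same_block Q p q \<longrightarrow> (\<forall>p'\<in>attach ?s 0 0 {p}. \<forall>q'\<in>attach ?s 0 0 {q}. cuts x y p' = cuts x y q'))"
  proof -
    have "sep ((`) Suc ` P) x y \<longleftrightarrow> (\<forall>p q. same_block P p q \<longrightarrow> cuts x y (Suc p) = cuts x y (Suc q))"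
      unfolding sep_iff same_block_image by blast
    moreover have "sep (attach ?s 0 0 ` Q) x y \<longleftrightarrow>
      (\<forall>p q. same_block Q p q \<longrightarrow> (\<forall>p'\<in>attach ?s 0 0 {p}. \<forall>q'\<in>attach ?s 0 0 {q}. cuts x y p' = cuts x y q'))"
      (is "?A \<longleftrightarrow> ?B")
    proof -
      \<comment> \<open>\<open>attach ?s 0 0 {p}\<close> is the fibre over \<open>p\<close> of the
        retraction: \<open>{0, Suc i}\<close> for \<open>p = 0\<close> and a single point otherwise.
        Abbreviating the fibres by an opaque \<open>T\<close> leaves a purely logical
        equivalence.\<close>
      have "attach ?s 0 0 V = (\<Union>p\<in>V. attach ?s 0 0 {p})" for V
        by (auto simp: attach_def split: if_splits) (metis gr0I)
      then obtain T where T: "\<And>p. attach ?s 0 0 {p} = T p" "attach ?s 0 0 = (\<lambda>V. \<Union>p\<in>V. T p)"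
        by (metis (mono_tags, lifting) ext)
      show ?thesis unfolding T(1) unfolding T(2) sep_def same_block_def by blast
    qed
    ultimately show ?thesis unfolding glue_def sep_Un by simp
  qed
  have sL: "same_block ((`) ?s ` ?L) x y \<longleftrightarrow> i < x \<and> i < y \<and> sep Q (x - Suc i) (y - Suc i)"
  proof -
    have "same_block ((`) ?s ` ?L) x y \<longleftrightarrow> i < x \<and> i < y \<and> same_block ?L (x - Suc i) (y - Suc i)"
      unfolding same_block_image
      by (auto, rule exI[of _ "x - Suc i"], simp, rule exI[of _ "y - Suc i"], simp)
    moreover have "x - Suc i < m - i" "y - Suc i < m - i" if "i < x" "i < y"
      using that xy by linarith+
    ultimately show ?thesis
      using same_block_kreweras[OF assms(3), of "x - Suc i" "y - Suc i"] by blast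
  qed
  have sK: "same_block ?K x y \<longleftrightarrow> x \<le> i \<and> y \<le> i \<and> sep (lead P) x y"
    using same_block_kreweras[OF lead_NC[OF assms(2)], of x y] same_block_lt[OF K, of x y]
    by (auto simp: less_Suc_eq_le)
  have lead: "sep (lead P) x y \<longleftrightarrow> (\<forall>p q. same_block P p q \<longrightarrow> cuts x y (Suc p) = cuts x y (Suc q))"
  proof -
    have "sep (lead P) x y \<longleftrightarrow> sep ((`) Suc ` P) x y"
      using sep_Un[of "{{0}}" "(`) Suc ` P" x y] by (simp add: lead_def sep_def)
    then show ?thesis unfolding sep_iff[of "(`) Suc ` P"] same_block_image by blast
  qed
  consider "x \<le> i" "y \<le> i" | "i < x" "i < y" | "x \<le> i \<longleftrightarrow> i < y" by linarith
  then have "sep (glue i P Q) x y \<longleftrightarrow> i < x \<and> i < y \<and> sep Q (x - Suc i) (y - Suc i) \<or>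
      x \<le> i \<and> y \<le> i \<and> sep (lead P) x y"
  proof cases
    case 1
    have "cuts x y p'" if "p' \<in> attach ?s 0 0 {p}" for p' p
      using 1 that by (auto simp: cuts_def attach_def split: if_splits)
    then show ?thesis unfolding s0 lead using 1 by auto
  next
    case 2
    have A: "cuts x y (Suc p) = cuts x y (Suc q)" if "same_block P p q" for p q
      using 2 same_block_lt[OF P that] by (auto simp: cuts_def)
    have B: "cuts x y p' = cuts (x - Suc i) (y - Suc i) p" if "p' \<in> attach ?s 0 0 {p}" for p' p
      using 2 that by (auto simp: cuts_def attach_def split: if_splits)
    have C: "?s p \<in> attach ?s 0 0 {p}" for p by (auto simp: attach_def)
    have "sep (glue i P Q) x y \<longleftrightarrow> sep Q (x - Suc i) (y - Suc i)"
    proof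
      assume *: "sep (glue i P Q) x y"
      show "sep Q (x - Suc i) (y - Suc i)"
      proof (rule sepI)
        fix p q assume "same_block Q p q"
        then have "cuts x y (?s p) = cuts x y (?s q)"
          using *[unfolded s0] C by blast
        then show "cuts (x - Suc i) (y - Suc i) p = cuts (x - Suc i) (y - Suc i) q"
          using B[OF C] by simp
      qed
    next
      assume "sep Q (x - Suc i) (y - Suc i)"
      then show "sep (glue i P Q) x y"
        unfolding s0 using A B sepD by simp
    qed
    then show ?thesis using 2 by auto
  next
    case 3
    have "same_block Q 0 0" using Q assms(1) by (intro same_block_refl) auto
    moreover have "0 \<in> attach ?s 0 0 {0}" "Suc i \<in> attach ?s 0 0 {0}" by (auto simp: attach_def)
    moreover have "cuts x y 0 \<noteq> cuts x y (Suc i)" using 3 by (auto simp: cuts_def)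
    ultimately have "\<not> sep (glue i P Q) x y" unfolding s0 by blast
    then show ?thesis using 3 by auto
  qed
  then show "same_block (?K \<union> (`) ?s ` ?L) x y \<longleftrightarrow> sep (glue i P Q) x y"
    unfolding same_block_Un sL sK by blast
qed


section \<open>Decomposition along the block of the first point\<close>

lemma finite_NC: "finite (NC n)"
  by (rule finite_subset[OF _ finitely_many_partition_on[of "{..<n}"]]) (auto simp: NC_def)

lemma NC_0: "NC 0 = {{}}"
  by (auto simp: NC_def partition_on_empty noncrossing_def)

lemma noncrossing_vimage:
  assumes "noncrossing Q" "strict_mono f"
  shows "noncrossing ((-`) f ` Q - {{}})"
proof (rule noncrossingI)
  fix V W a b c d
  assume VW: "V \<in> (-`) f ` Q - {{}}" "W \<in> (-`) f ` Q - {{}}" "V \<noteq> W"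
    and abcd: "a \<in> V" "b \<in> W" "c \<in> V" "d \<in> W" "a < b" "b < c" "c < d"
  then obtain V' W' where "V' \<in> Q" "W' \<in> Q" "V = f -` V'" "W = f -` W'" by auto
  then show False
    using VW(3) abcd assms(2) by (intro noncrossingD[OF assms(1), of V' W' "f a" "f b" "f c" "f d"])
      (auto simp: strict_mono_less)
qed

lemma noncrossing_subset: "noncrossing P \<Longrightarrow> Q \<subseteq> P \<Longrightarrow> noncrossing Q"
proof (rule noncrossingI)
  fix V W a b c d
  assume "noncrossing P" "Q \<subseteq> P" and VW: "V \<in> Q" "W \<in> Q" "V \<noteq> W"
    and "a \<in> V" "b \<in> W" "c \<in> V" "d \<in> W" "a < b" "b < c" "c < d"
  then show False by (intro noncrossingD[of P V W a b c d]) (blast | assumption)+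
qed

lemma block_unique:
  assumes "partition_on A P" "V \<in> P" "W \<in> P" "x \<in> V" "x \<in> W"
  shows "V = W"
  using assms partition_onD2 by (auto dest: disjointD)

lemma lead_surj:
  assumes Q: "Q \<in> NC (Suc m)" and 0: "{0} \<in> Q"
  shows "\<exists>P\<in>NC m. Q = lead P"
proof
  let ?P = "(-`) Suc ` Q - {{}}"
  have part: "partition_on {..<Suc m} Q" and nc: "noncrossing Q" using Q by (auto simp: NC_def)
  have "Suc -` {..<Suc m} = {..<m}" by auto
  then show "?P \<in> NC m"
    using partition_on_vimage[OF part, of Suc] noncrossing_vimage[OF nc, of Suc]
    by (simp add: NC_def strict_mono_def)
  have *: "Suc ` (Suc -` V) = V \<and> Suc -` V \<noteq> {}" if V: "V \<in> Q" "V \<noteq> {0}" for V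
  proof -
    have "0 \<notin> V" using block_unique[OF part V(1) 0, of 0] V(2) by auto
    then have eq: "Suc ` (Suc -` V) = V" by (auto simp: image_iff) (metis not0_implies_Suc)
    moreover have "V \<noteq> {}" using V part partition_onD3 by blast
    ultimately show ?thesis by blast
  qed
  show "Q = lead ?P"
  proof
    show "Q \<subseteq> lead ?P"
    proof
      fix V assume V: "V \<in> Q"
      show "V \<in> lead ?P"
      proof (cases "V = {0}")
        case False
        with V have "Suc ` (Suc -` V) \<in> (`) Suc ` ?P"
          using * by (intro imageI) blast
        then show ?thesis using *[OF V False] by (simp add: lead_def)
      qed (simp add: lead_def)
    qed
    show "lead ?P \<subseteq> Q"
    proof
      fix W assume "W \<in> lead ?P"
      then consider "W = {0}" | V where "V \<in> Q" "Suc -` V \<noteq> {}" "W = Suc ` (Suc -` V)"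
        unfolding lead_def by blast
      then show "W \<in> Q"
      proof cases
        case 2
        then have "V \<noteq> {0}" by auto
        then show ?thesis using *[OF \<open>V \<in> Q\<close>] 2 by simp
      qed (simp add: 0)
    qed
  qed
qed

lemma glue_surj:
  assumes Q: "Q \<in> NC (Suc m)" and 0: "{0} \<notin> Q"
  shows "\<exists>i<m. \<exists>P1\<in>NC i. \<exists>P2\<in>NC (m - i). Q = glue i P1 P2"
proof -
  have part: "partition_on {..<Suc m} Q" and nc: "noncrossing Q" using Q by (auto simp: NC_def)
  have UQ: "\<Union> Q = {..<Suc m}" using part by (simp add: partition_on_def)
  obtain V0 where V0: "V0 \<in> Q" "0 \<in> V0" using UQ by (metis UnionE lessThan_iff zero_less_Suc)
  define p where "p = (LEAST x. x \<in> V0 \<and> x \<noteq> 0)"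
  have ex: "\<exists>x. x \<in> V0 \<and> x \<noteq> 0"
  proof (rule ccontr)
    assume "\<not> ?thesis"
    then have "V0 = {0}" using V0(2) by auto
    then show False using 0 V0(1) by simp
  qed
  have p: "p \<in> V0" "p \<noteq> 0" using LeastI_ex[OF ex] by (auto simp: p_def)
  have pmin: "x = 0 \<or> p \<le> x" if "x \<in> V0" for x using that by (auto simp: p_def intro: Least_le)
  obtain i where i: "p = Suc i" using p(2) by (cases p) auto
  have im: "i < m" using p(1) V0(1) UQ i by auto
  \<comment> \<open>A block with points on both sides of \<open>p\<close> would cross
    \<open>V0\<close> at 0 and \<open>p\<close>.\<close>
  have alt: "V \<subseteq> {1..i} \<or> V \<subseteq> {Suc (Suc i)..}" if V: "V \<in> Q" "V \<noteq> V0" for V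
  proof (rule ccontr)
    assume "\<not> ?thesis"
    then obtain x y where xy: "x \<in> V" "x \<notin> {1..i}" "y \<in> V" "y \<notin> {Suc (Suc i)..}" by blast
    have "0 \<notin> V" "p \<notin> V" using block_unique[OF part V(1) V0(1)] V0(2) p(1) V(2) by auto
    then have "y \<noteq> 0" "y \<noteq> p" "x \<noteq> 0" "x \<noteq> p" using xy(1,3) by metis+
    then have "0 < y" "y < p" "p < x" using xy i by auto
    then show False using noncrossingD[OF nc V0(1) V(1) V(2)[symmetric] V0(2) xy(3) p(1) xy(1)] by blast
  qed
  let ?P1 = "(-`) Suc ` {V\<in>Q. V \<subseteq> {1..i}}" and ?P2 = "(-`) ((+) (Suc i)) ` Q - {{}}"
  have p1: "partition_on {1..i} {V\<in>Q. V \<subseteq> {1..i}}"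
  proof (rule partition_onI)
    show "{} \<notin> {V\<in>Q. V \<subseteq> {1..i}}" using partition_onD3[OF part] by blast
    show "disjnt V W" if "V \<in> {V\<in>Q. V \<subseteq> {1..i}}" "W \<in> {V\<in>Q. V \<subseteq> {1..i}}" "V \<noteq> W" for V W
      using that partition_onD2[OF part] by (auto simp: pairwise_def)
    show "\<Union> {V\<in>Q. V \<subseteq> {1..i}} = {1..i}"
    proof
      show "{1..i} \<subseteq> \<Union> {V\<in>Q. V \<subseteq> {1..i}}"
      proof
        fix x assume x: "x \<in> {1..i}"
        then have "x \<in> \<Union> Q" using UQ im by auto
        then obtain V where V: "V \<in> Q" "x \<in> V" by blast
        moreover have "V \<noteq> V0" using pmin[of x] x V i by auto
        ultimately have "V \<subseteq> {1..i}" using alt[of V] x by fastforce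
        then show "x \<in> \<Union> {V\<in>Q. V \<subseteq> {1..i}}" using V by blast
      qed
    qed blast
  qed
  have P1_im: "Suc ` (Suc -` V) = V" if V: "V \<subseteq> {1..i}" for V
  proof -
    have "0 \<notin> V" using V by auto
    then show ?thesis by (auto simp: image_iff) (metis not0_implies_Suc)
  qed
  have P1: "?P1 \<in> NC i"
  proof -
    have "Suc -` {1..i} = {..<i}" by auto
    moreover have "{} \<notin> ?P1"
    proof
      assume "{} \<in> ?P1"
      then obtain V where "V \<in> Q" "V \<subseteq> {1..i}" "Suc -` V = {}" by auto
      then have "V = {}" using P1_im[of V] by simp
      then show False using \<open>V \<in> Q\<close> partition_onD3[OF part] by simp
    qed
    then have "?P1 - {{}} = ?P1" by simp
    ultimately show ?thesis
      using partition_on_vimage[OF p1, of Suc]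
        noncrossing_vimage[OF noncrossing_subset[OF nc], of "{V\<in>Q. V \<subseteq> {1..i}}" Suc]
      by (simp add: NC_def strict_mono_def)
  qed
  have P2: "?P2 \<in> NC (m - i)"
  proof -
    have "(+) (Suc i) -` {..<Suc m} = {..<m - i}" by auto
    then show ?thesis
      using partition_on_vimage[OF part, of "(+) (Suc i)"] noncrossing_vimage[OF nc, of "(+) (Suc i)"]
      by (simp add: NC_def strict_mono_def)
  qed
  have shift: "(+) (Suc i) ` ((+) (Suc i) -` V) = V" if V: "V \<subseteq> {Suc i..}" for V
  proof -
    have "V \<subseteq> range ((+) (Suc i))"
    proof
      fix x assume "x \<in> V"
      then have "x = Suc i + (x - Suc i)" using V by auto
      then show "x \<in> range ((+) (Suc i))" by (rule range_eqI)
    qed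
    then show ?thesis by (simp only: image_vimage_eq Int_absorb2)
  qed
  \<comment> \<open>The preimage under the shift forgets that 0 is in \<open>V0\<close>. Since
    \<open>p\<close> becomes the point 0 of the preimage, \<open>attach\<close> recognizes this
    block and restores 0.\<close>
  have at0: "attach ((+) (Suc i)) 0 0 ((+) (Suc i) -` V0) = V0"
  proof -
    have "(+) (Suc i) ` ((+) (Suc i) -` (V0 - {0})) = V0 - {0}" using pmin i by (intro shift) auto
    moreover have "(+) (Suc i) -` (V0 - {0}) = (+) (Suc i) -` V0" by auto
    ultimately have "(+) (Suc i) ` ((+) (Suc i) -` V0) = V0 - {0}" by (simp only:)
    moreover have "0 \<in> (+) (Suc i) -` V0" using p(1) i by simp
    ultimately show ?thesis using V0(2) by (simp only: attach_def if_True insert_Diff)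
  qed
  have at: "attach ((+) (Suc i)) 0 0 ((+) (Suc i) -` V) = V" if V: "V \<in> Q" "V \<subseteq> {Suc (Suc i)..}" for V
  proof -
    have "V \<subseteq> {Suc i..}" "0 \<notin> (+) (Suc i) -` V" using V(2) by auto
    then show ?thesis using shift[of V] by (simp only: attach_def if_False)
  qed
  have "Q = glue i ?P1 ?P2"
  proof
    show "Q \<subseteq> glue i ?P1 ?P2"
    proof
      fix V assume V: "V \<in> Q"
      then have ne: "V \<noteq> {}" using partition_onD3[OF part] by auto
      consider "V = V0" | "V \<subseteq> {1..i}" | "V \<subseteq> {Suc (Suc i)..}" using alt[OF V] by blast
      then show "V \<in> glue i ?P1 ?P2"
      proof cases
        case 1
        have "0 \<in> (+) (Suc i) -` V0" using p(1) i by simp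
        then have "(+) (Suc i) -` V0 \<in> ?P2" using V0(1) by blast
        from imageI[OF this, of "attach ((+) (Suc i)) 0 0"] show ?thesis
          unfolding glue_def 1 at0 by (rule UnI2)
      next
        case 2
        then have "Suc -` V \<in> ?P1" using V by blast
        from imageI[OF this, of "(`) Suc"] show ?thesis
          unfolding glue_def P1_im[OF 2] by (rule UnI1)
      next
        case 3
        then have "V \<subseteq> {Suc i..}" by auto
        then have "(+) (Suc i) -` V \<noteq> {}" using ne shift[of V] by (metis image_empty)
        then have "(+) (Suc i) -` V \<in> ?P2" using V by blast
        from imageI[OF this, of "attach ((+) (Suc i)) 0 0"] show ?thesis
          unfolding glue_def at[OF V 3] by (rule UnI2)
      qed
    qed
    show "glue i ?P1 ?P2 \<subseteq> Q"
    proof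
      fix W assume "W \<in> glue i ?P1 ?P2"
      then consider V where "V \<in> Q" "V \<subseteq> {1..i}" "W = Suc ` (Suc -` V)"
        | V where "V \<in> Q" "(+) (Suc i) -` V \<noteq> {}" "W = attach ((+) (Suc i)) 0 0 ((+) (Suc i) -` V)"
        unfolding glue_def by blast
      then show "W \<in> Q"
      proof cases
        case 1
        then show ?thesis by (simp only: P1_im)
      next
        case 2
        then have "\<not> V \<subseteq> {1..i}" by auto
        then consider "V = V0" | "V \<subseteq> {Suc (Suc i)..}" using alt[OF 2(1)] by blast
        then show ?thesis by cases (simp_all only: 2(3) at0 at[OF 2(1)] V0 2(1))
      qed
    qed
  qed
  then show ?thesis using im P1 P2 by blast
qed

text \<open>Position alone tells which blocks come from \<open>P\<close> and which from
  \<open>Q\<close>, so both can be read off from \<open>glue i P Q\<close>.\<close>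

lemma glue_parts:
  assumes "i < m" "P \<in> NC i" "Q \<in> NC (m - i)"
  shows "{V \<in> glue i P Q. V \<subseteq> {1..i}} = (`) Suc ` P"
    and "{V \<in> glue i P Q. \<not> V \<subseteq> {1..i}} = attach ((+) (Suc i)) 0 0 ` Q"
proof -
  have "Suc ` V \<subseteq> {1..i}" if "V \<in> P" for V
  proof -
    have "\<Union> P = {..<i}" using assms(2) by (simp add: NC_def partition_on_def)
    then have "V \<subseteq> {..<i}" using that by blast
    then show ?thesis by auto
  qed
  moreover have "\<not> attach ((+) (Suc i)) 0 0 V \<subseteq> {1..i}" if "V \<in> Q" for V
  proof -
    have "{} \<notin> Q" using assms(3) by (simp add: NC_def partition_on_def)
    then have "V \<noteq> {}" using that by blast
    then show ?thesis by (auto simp: attach_def)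
  qed
  ultimately show "{V \<in> glue i P Q. V \<subseteq> {1..i}} = (`) Suc ` P"
    and "{V \<in> glue i P Q. \<not> V \<subseteq> {1..i}} = attach ((+) (Suc i)) 0 0 ` Q"
    unfolding glue_def by blast+
qed

lemma inj_on_glue: "i < m \<Longrightarrow> inj_on (\<lambda>(P, Q). glue i P Q) (NC i \<times> NC (m - i))"
proof (rule inj_onI, clarify)
  fix P Q P' Q'
  assume *: "i < m" "P \<in> NC i" "Q \<in> NC (m - i)" "P' \<in> NC i" "Q' \<in> NC (m - i)" "glue i P Q = glue i P' Q'"
  have "(`) Suc ` P = (`) Suc ` P'"
    using glue_parts(1)[OF *(1-3)] glue_parts(1)[OF *(1,4,5)] *(6) by simp
  moreover have "attach ((+) (Suc i)) 0 0 ` Q = attach ((+) (Suc i)) 0 0 ` Q'"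
    using glue_parts(2)[OF *(1-3)] glue_parts(2)[OF *(1,4,5)] *(6) by simp
  moreover have "inj (attach ((+) (Suc i)) 0 0)" by (rule inj_on_attach) auto
  moreover have "inj ((`) Suc)" by (simp add: inj_on_image)
  ultimately show "P = P' \<and> Q = Q'" by (auto simp: inj_image_eq_iff)
qed

lemma inj_on_lead: "inj_on lead (NC m)"
proof (rule inj_onI)
  fix P P' assume "lead P = lead P'"
  moreover have "{0} \<notin> (`) Suc ` R" for R by auto
  ultimately have "(`) Suc ` P = (`) Suc ` P'" unfolding lead_def by (metis insert_ident)
  moreover have "inj ((`) Suc)" by (simp add: inj_on_image)
  ultimately show "P = P'" by (simp add: inj_image_eq_iff)
qed

lemma glue_zero_block:
  assumes "V \<in> glue i P Q" "0 \<in> V"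
  shows "Suc i \<in> V" "V \<subseteq> insert 0 {Suc i..}"
  using assms by (auto simp: glue_def attach_def split: if_splits)

lemma glue_ex_zero_block:
  assumes "i < m" "P \<in> NC i" "Q \<in> NC (m - i)"
  shows "\<exists>V\<in>glue i P Q. 0 \<in> V"
proof -
  have "\<Union> (glue i P Q) = {..<Suc m}" using glue_NC[OF assms] by (simp add: NC_def partition_on_def)
  then show ?thesis by (metis UnionE lessThan_iff zero_less_Suc)
qed

text \<open>\<open>Suc i\<close> is the second element of the block of 0, which determines
  \<open>i\<close>.\<close>

lemma glue_neq:
  assumes "i < m" "P \<in> NC i" "Q \<in> NC (m - i)" "i < j"
  shows "glue i P Q \<noteq> glue j P' Q'"
proof
  assume eq: "glue i P Q = glue j P' Q'"
  obtain V where V: "V \<in> glue i P Q" "0 \<in> V" using glue_ex_zero_block[OF assms(1-3)] by blast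
  then have "Suc i \<in> V" "V \<subseteq> insert 0 {Suc j..}" using glue_zero_block eq by blast+
  then show False using assms(4) by auto
qed

lemma lead_neq_glue: "lead P \<noteq> glue i P' Q'"
proof
  assume "lead P = glue i P' Q'"
  then have "{0} \<in> glue i P' Q'" by (auto simp: lead_def)
  then show False using glue_zero_block(1) by blast
qed

lemma NC_Suc: "NC (Suc m) = lead ` NC m \<union> (\<Union>i<m. (\<lambda>(P, Q). glue i P Q) ` (NC i \<times> NC (m - i)))"
proof
  show "NC (Suc m) \<subseteq> lead ` NC m \<union> (\<Union>i<m. (\<lambda>(P, Q). glue i P Q) ` (NC i \<times> NC (m - i)))"
  proof
    fix Q assume Q: "Q \<in> NC (Suc m)"
    show "Q \<in> lead ` NC m \<union> (\<Union>i<m. (\<lambda>(P, Q). glue i P Q) ` (NC i \<times> NC (m - i)))"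
    proof (cases "{0} \<in> Q")
      case True
      then show ?thesis using lead_surj[OF Q] by blast
    next
      case False
      then obtain i P1 P2 where "i < m" "P1 \<in> NC i" "P2 \<in> NC (m - i)" "Q = glue i P1 P2"
        using glue_surj[OF Q] by blast
      then show ?thesis by (intro UnI2 UN_I[of i] image_eqI[of _ _ "(P1, P2)"]) auto
    qed
  qed
qed (auto intro: lead_NC glue_NC)

lemma sum_NC_Suc:
  "(\<Sum>P\<in>NC (Suc m). h P) = (\<Sum>P\<in>NC m. h (lead P)) +
    (\<Sum>i<m. \<Sum>P\<in>NC i. \<Sum>Q\<in>NC (m - i). h (glue i P Q))"
proof -
  let ?G = "\<lambda>i. (\<lambda>(P, Q). glue i P Q) ` (NC i \<times> NC (m - i))"
  have "(\<Sum>P\<in>NC (Suc m). h P) = sum h (lead ` NC m) + sum h (\<Union>i<m. ?G i)"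
    unfolding NC_Suc using finite_NC lead_neq_glue by (intro sum.union_disjoint) auto
  also have "sum h (lead ` NC m) = (\<Sum>P\<in>NC m. h (lead P))"
    by (simp add: sum.reindex[OF inj_on_lead])
  also have "sum h (\<Union>i<m. ?G i) = (\<Sum>i<m. sum h (?G i))"
  proof (rule sum.UNION_disjoint)
    show "\<forall>i\<in>{..<m}. \<forall>j\<in>{..<m}. i \<noteq> j \<longrightarrow> ?G i \<inter> ?G j = {}"
    proof (intro ballI impI)
      fix i j assume ij: "i \<in> {..<m}" "j \<in> {..<m}" "i \<noteq> j"
      then consider "i < j" | "j < i" by linarith
      then show "?G i \<inter> ?G j = {}"
        using glue_neq[of i m] glue_neq[of j m] ij by cases (auto, metis+)
    qed
  qed (auto simp: finite_NC)
  also have "(\<Sum>i<m. sum h (?G i)) = (\<Sum>i<m. \<Sum>P\<in>NC i. \<Sum>Q\<in>NC (m - i). h (glue i P Q))"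
  proof (rule sum.cong[OF refl])
    fix i assume "i \<in> {..<m}"
    then have "sum h (?G i) = sum (h \<circ> (\<lambda>(P, Q). glue i P Q)) (NC i \<times> NC (m - i))"
      by (intro sum.reindex inj_on_glue) simp
    then show "sum h (?G i) = (\<Sum>P\<in>NC i. \<Sum>Q\<in>NC (m - i). h (glue i P Q))"
      by (simp add: sum.cartesian_product comp_def case_prod_unfold)
  qed
  finally show ?thesis .
qed


section \<open>Sums over non-crossing partitions\<close>

text \<open>The point \<open>c\<close> singles out the block with the free weight: the first point
  for a partition, the last point for its complement.\<close>

definition wprod :: "(nat list \<Rightarrow> 'k::comm_ring_1) \<Rightarrow> (nat list \<Rightarrow> 'k) \<Rightarrow> nat \<Rightarrow> nat list \<Rightarrow> nat set set \<Rightarrow> 'k"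
  where "wprod F f c w P = (\<Prod>V\<in>P. (if c \<in> V then F else f) (nths w V))"

definition nc_sum :: "(nat list \<Rightarrow> 'k::comm_ring_1) \<Rightarrow> (nat list \<Rightarrow> 'k) \<Rightarrow>
    (nat list \<Rightarrow> 'k) \<Rightarrow> (nat list \<Rightarrow> 'k) \<Rightarrow> nat list \<Rightarrow> 'k"
  where "nc_sum f g F G w = (\<Sum>P\<in>NC (length w). wprod F f 0 w P *
    wprod G g (length w - 1) w (kreweras (length w) P))"

lemma nths_Suc_image: "nths (a # w) (Suc ` V) = nths w V"
  by (simp add: nths_Cons image_iff)

lemma nths_insert_0: "nths (a # w) (insert 0 (Suc ` V)) = a # nths w V"
  by (simp add: nths_Cons image_iff)

lemma nths_plus_image: "nths w ((+) k ` V) = nths (drop k w) V"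
proof (induction k arbitrary: w)
  case 0
  have "(+) 0 ` V = V" by auto
  then show ?case by simp
next
  case (Suc k)
  have "(+) (Suc k) ` V = Suc ` ((+) k ` V)" by (auto simp: image_image)
  then show ?case by (cases w) (simp_all add: nths_Suc_image Suc)
qed

lemma nths_take_subset: "V \<subseteq> {..<k} \<Longrightarrow> nths (take k w) V = nths w V"
proof (induction k arbitrary: w V)
  case (Suc k)
  show ?case
  proof (cases w)
    case (Cons a v)
    have "{j. Suc j \<in> V} \<subseteq> {..<k}" using Suc.prems by auto
    then show ?thesis by (simp add: Cons nths_Cons Suc.IH)
  qed simp
qed simp

lemma finite_partition_lessThan: "partition_on {..<n::nat} P \<Longrightarrow> finite P"
  by (rule finite_elements) auto

lemma wprod_lead:
  assumes "P \<in> NC m" shows "wprod F f 0 (a # w) (lead P) = F [a] * (\<Prod>V\<in>P. f (nths w V))"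
proof -
  have fin: "finite P" using assms finite_partition_lessThan by (auto simp: NC_def)
  have "{0} \<notin> (`) Suc ` P" by auto
  moreover have "inj_on ((`) Suc) P" by (meson inj_Suc inj_on_image inj_on_subset subset_UNIV)
  ultimately show ?thesis
    using fin nths_insert_0[of a w "{}"]
    by (simp add: wprod_def lead_def prod.reindex nths_Suc_image comp_def)
qed

lemma wprod_const: "wprod f f c w P = (\<Prod>V\<in>P. f (nths w V))"
  by (simp add: wprod_def)

lemma wprod_attach_Suc:
  assumes "c \<notin> {0}"
  shows "wprod G g c (a # w) (attach Suc 0 (c - 1) ` Q) = wprod (\<lambda>u. G (a # u)) g (c - 1) w Q"
proof -
  have "inj_on (attach Suc 0 (c - 1)) Q" by (rule inj_on_attach) auto
  moreover have "c \<in> attach Suc 0 (c - 1) V \<longleftrightarrow> c - 1 \<in> V" for V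
    using assms by (auto simp: attach_def image_iff) (metis Suc_pred gr0I)
  ultimately show ?thesis
    unfolding wprod_def
    by (simp add: prod.reindex) (intro prod.cong refl, simp add: attach_def nths_insert_0 nths_Suc_image)
qed

lemma wprod_shift:
  assumes "k \<le> c"
  shows "wprod G g c w ((`) ((+) k) ` Q) = wprod G g (c - k) (drop k w) Q"
proof -
  have "inj_on ((`) ((+) k)) Q" by (rule inj_on_subset[of _ UNIV]) (auto simp: inj_on_image)
  moreover have "c \<in> (+) k ` V \<longleftrightarrow> c - k \<in> V" for V
    using assms by (auto simp: image_iff) (metis le_add_diff_inverse)
  ultimately show ?thesis
    unfolding wprod_def by (simp add: prod.reindex nths_plus_image)
qed

lemma wprod_attach_shift:
  "wprod F f 0 (a # w) (attach ((+) (Suc i)) 0 0 ` Q) = wprod (\<lambda>u. F (a # u)) f 0 (drop i w) Q"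
proof -
  have "inj_on (attach ((+) (Suc i)) 0 0) Q" by (rule inj_on_attach) auto
  moreover have "0 \<in> attach ((+) (Suc i)) 0 0 V \<longleftrightarrow> 0 \<in> V" for V
    by (auto simp: attach_def)
  moreover have "(+) (Suc i) ` V = Suc ` ((+) i ` V)" for V by (auto simp: image_image)
  ultimately show ?thesis
    unfolding wprod_def
    by (simp add: prod.reindex)
      (intro prod.cong refl, simp add: attach_def nths_insert_0 nths_Suc_image nths_plus_image)
qed

lemma wprod_Un:
  assumes "finite P" "finite Q" "P \<inter> Q = {}"
  shows "wprod F f c w (P \<union> Q) = wprod F f c w P * wprod F f c w Q"
  unfolding wprod_def using assms by (rule prod.union_disjoint)

lemma prod_nths_take:
  assumes "partition_on {..<i} P"
  shows "(\<Prod>V\<in>P. f (nths w V)) = (\<Prod>V\<in>P. f (nths (take i w) V))"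
proof (rule prod.cong[OF refl])
  fix V assume "V \<in> P"
  then have "V \<subseteq> {..<i}" using assms by (auto simp: partition_on_def)
  then show "f (nths w V) = f (nths (take i w) V)" by (simp add: nths_take_subset)
qed

text \<open>Needed twice: for the partitions \<open>lead P\<close> themselves, and with
  \<open>G = g\<close> for the stretch before the second point of the first block in
  \<open>glue\<close>, where the complement is again that of \<open>lead P\<close>. The empty rest
  is separate because \<open>nc_sum\<close> is 1 at \<open>[]\<close> and would lose the letter
  \<open>a\<close>.\<close>

lemma sum_lead:
  assumes "f [] = 1"
  shows "(\<Sum>P\<in>NC (length w). (\<Prod>V\<in>P. f (nths w V)) *
      wprod G g (length w) (a # w) (kreweras (Suc (length w)) (lead P))) =
    (if w = [] then G [a] else nc_sum f g f (\<lambda>u. G (a # u)) w)"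
proof (cases w)
  case Nil
  then show ?thesis
    using nths_insert_0[of a "[]" "{}"] by (simp add: NC_0 kreweras_lead_0 wprod_def)
next
  case (Cons b v)
  have "wprod G g (length w) (a # w) (kreweras (Suc (length w)) (lead P)) =
      wprod (\<lambda>u. G (a # u)) g (length w - 1) w (kreweras (length w) P)" if "P \<in> NC (length w)" for P
    using kreweras_lead[of P "length v"] that wprod_attach_Suc[of "length w" G g a w "kreweras (length w) P"]
    by (simp add: Cons)
  then show ?thesis
    by (simp add: nc_sum_def wprod_const) (simp add: Cons)
qed

theorem nc_sum_eq_nc_rec:
  assumes "f [] = 1" "w \<noteq> []"
  shows "nc_sum f g F G w = nc_rec f g F G w"
  using assms(2)
proof (induction w arbitrary: F G rule: length_induct)
  case (1 w)
  then obtain a v where w: "w = a # v" by (cases w) auto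
  define m where "m = length v"
  \<comment> \<open>Includes the empty word, which the induction hypothesis leaves out.\<close>
  have L: "(if u = [] then G [a] else nc_sum f g f (\<lambda>u. G (a # u)) u) = nc_rec f g f (\<lambda>u. G (a # u)) u"
    if "length u \<le> m" for u and G :: "nat list \<Rightarrow> 'a"
    using 1(1) that by (auto simp: assms w m_def)
  have "nc_sum f g F G w = F [a] * (\<Sum>P\<in>NC m. (\<Prod>V\<in>P. f (nths v V)) *
        wprod G g m w (kreweras (Suc m) (lead P)))
      + (\<Sum>i<m. \<Sum>P\<in>NC i. \<Sum>Q\<in>NC (m - i). wprod F f 0 w (glue i P Q) *
        wprod G g m w (kreweras (Suc m) (glue i P Q)))"
    unfolding nc_sum_def by (simp add: w m_def[symmetric] sum_NC_Suc wprod_lead sum_distrib_left mult_ac)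
  also have "(\<Sum>P\<in>NC m. (\<Prod>V\<in>P. f (nths v V)) * wprod G g m w (kreweras (Suc m) (lead P))) =
      nc_rec f g f (\<lambda>u. G (a # u)) v"
    using sum_lead[of f v G g a] L[of v G] assms by (simp add: m_def w)
  also have "(\<Sum>i<m. \<Sum>P\<in>NC i. \<Sum>Q\<in>NC (m - i). wprod F f 0 w (glue i P Q) *
        wprod G g m w (kreweras (Suc m) (glue i P Q))) =
      lconv (nc_rec f g f (\<lambda>u. g (a # u))) (nc_rec f g (\<lambda>u. F (a # u)) G) v"
    unfolding lconv_def m_def[symmetric]
  proof (rule sum.cong[OF refl])
    fix i assume "i \<in> {..<m}"
    then have i: "i < m" by simp
    let ?Pr = "\<lambda>P. (\<Prod>V\<in>P. f (nths (take i v) V))"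
    \<comment> \<open>The block of 0 contains \<open>Suc i\<close>, and the last point
      \<open>m\<close> belongs to the shifted complement of \<open>Q\<close>. Both free weights
      therefore go to the part on \<open>drop i v\<close>, while the stretch before it carries the
      plain \<open>f\<close> and \<open>g\<close>.\<close>
    have e: "wprod F f 0 w (glue i P Q) * wprod G g m w (kreweras (Suc m) (glue i P Q)) =
        (?Pr P * wprod g g i (a # take i v) (kreweras (Suc i) (lead P))) *
        (wprod (\<lambda>u. F (a # u)) f 0 (drop i v) Q * wprod G g (m - i - 1) (drop i v) (kreweras (m - i) Q))"
      if PQ: "P \<in> NC i" "Q \<in> NC (m - i)" for P Q
    proof -
      let ?K = "kreweras (Suc i) (lead P)" and ?L = "kreweras (m - i) Q" and ?s = "(+) (Suc i)"
      have P: "partition_on {..<i} P" and Q: "partition_on {..<m - i} Q"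
        and K: "partition_on {..<Suc i} ?K" and L: "partition_on {..<m - i} ?L"
        using PQ partition_on_kreweras lead_NC by (auto simp: NC_def)
      have fin: "finite P" "finite Q" "finite ?K" "finite ?L"
        using P Q K L finite_partition_lessThan by blast+
      have d1: "(`) Suc ` P \<inter> attach ?s 0 0 ` Q = {}"
        unfolding glue_parts[OF i PQ, symmetric] by blast
      have Kle: "V \<subseteq> {..<Suc i}" if "V \<in> ?K" for V using K that by (auto simp: partition_on_def)
      have d2: "?K \<inter> (`) ?s ` ?L = {}"
      proof (rule ccontr)
        assume "\<not> ?thesis"
        then obtain V where V: "?s ` V \<in> ?K" "V \<in> ?L" by blast
        then have "V \<noteq> {}" using partition_onD3[OF L] by blast
        then show False using Kle[OF V(1)] by auto
      qed
      have "wprod F f 0 w ((`) Suc ` P) = ?Pr P"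
      proof -
        have "inj_on ((`) Suc) P" by (meson inj_Suc inj_on_image inj_on_subset subset_UNIV)
        then show ?thesis
          by (simp add: wprod_def w prod.reindex nths_Suc_image comp_def prod_nths_take[OF P, symmetric])
      qed
      then have A: "wprod F f 0 w (glue i P Q) = ?Pr P * wprod (\<lambda>u. F (a # u)) f 0 (drop i v) Q"
        unfolding glue_def by (subst wprod_Un) (use fin d1 in \<open>auto simp: w wprod_attach_shift\<close>)
      have "wprod G g m w ?K = wprod g g i (a # take i v) ?K"
        unfolding wprod_def
      proof (rule prod.cong[OF refl])
        fix V assume V: "V \<in> ?K"
        then have "m \<notin> V" using Kle[OF V] i by auto
        moreover have "nths (a # take i v) V = nths w V"
          using nths_take_subset[OF Kle[OF V], of w] by (simp add: w)
        ultimately show "(if m \<in> V then G else g) (nths w V) =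
           (if i \<in> V then g else g) (nths (a # take i v) V)" by simp
      qed
      moreover have "wprod G g m w ((`) ?s ` ?L) = wprod G g (m - i - 1) (drop i v) ?L"
        using wprod_shift[of "Suc i" m G g w ?L] i by (simp add: w)
      ultimately have B: "wprod G g m w (kreweras (Suc m) (glue i P Q)) =
         wprod g g i (a # take i v) ?K * wprod G g (m - i - 1) (drop i v) ?L"
        unfolding kreweras_glue[OF i PQ] by (subst wprod_Un) (use fin d2 in auto)
      show ?thesis unfolding A B by (simp add: mult_ac)
    qed
    have "(\<Sum>P\<in>NC i. \<Sum>Q\<in>NC (m - i). wprod F f 0 w (glue i P Q) *
        wprod G g m w (kreweras (Suc m) (glue i P Q))) =
      (\<Sum>P\<in>NC i. ?Pr P * wprod g g i (a # take i v) (kreweras (Suc i) (lead P))) *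
      nc_sum f g (\<lambda>u. F (a # u)) G (drop i v)"
      by (simp add: e sum_product nc_sum_def m_def[symmetric])
    also have "(\<Sum>P\<in>NC i. ?Pr P * wprod g g i (a # take i v) (kreweras (Suc i) (lead P))) =
       nc_rec f g f (\<lambda>u. g (a # u)) (take i v)"
      using sum_lead[of f "take i v" g g a] L[of "take i v" g] i assms by (simp add: m_def)
    also have "nc_sum f g (\<lambda>u. F (a # u)) G (drop i v) = nc_rec f g (\<lambda>u. F (a # u)) G (drop i v)"
      using 1(1) i by (simp add: w m_def)
    finally show "(\<Sum>P\<in>NC i. \<Sum>Q\<in>NC (m - i). wprod F f 0 w (glue i P Q) *
        wprod G g m w (kreweras (Suc m) (glue i P Q))) =
      nc_rec f g f (\<lambda>u. g (a # u)) (take i v) * nc_rec f g (\<lambda>u. F (a # u)) G (drop i v)" .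
  qed
  finally show ?case by (simp add: w nc_rec_Cons)
qed


section \<open>The group of boxed convolution\<close>

text \<open>Families vanish at \<open>[]\<close>, since \<open>[]\<close> is not a word. The
  recursion evaluates weights at \<open>[]\<close> where nothing is left to read, and this must
  contribute the factor 1.\<close>

definition with_one :: "'k::field_char_0 family \<Rightarrow> 'k family" where
  "with_one f = f([] := 1)"

lemma with_one_simps [simp]: "with_one f [] = 1" "w \<noteq> [] \<Longrightarrow> with_one f w = f w"
  by (simp_all add: with_one_def)

lemma with_one_Cons [simp]: "with_one f (a # w) = f (a # w)"
  by simp

lemma words_iff: "w \<in> words s \<longleftrightarrow> w \<noteq> [] \<and> set w \<subseteq> {1..s}"
  by (simp add: words_def)

lemma long_words_iff: "w \<in> long_words s \<longleftrightarrow> set w \<subseteq> {1..s} \<and> 2 \<le> length w"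
  by (auto simp: long_words_def words_def)

lemma words_cases:
  assumes "w \<in> words s"
  obtains i where "i \<in> {1..s}" "w = [i]" | "w \<in> long_words s"
proof (cases "length w = 1")
  case True
  then obtain i where "w = [i]" by (auto simp: length_Suc_conv)
  then show ?thesis using that(1)[of i] assms by (auto simp: words_iff)
next
  case False
  then have "2 \<le> length w" using assms by (cases w rule: list.exhaust) (auto simp: words_iff Suc_le_eq)
  then show ?thesis using that(2) assms by (simp add: long_words_def)
qed

lemma gplusD:
  assumes "f \<in> gplus s"
  shows "i \<in> {1..s} \<Longrightarrow> f [i] = 1" "w \<notin> words s \<Longrightarrow> f w = 0"
  using assms by (auto simp: gplus_def)

lemma nths_neq_Nil:
  assumes "V \<noteq> {}" "V \<subseteq> {..<length w}"
  shows "nths w V \<noteq> []"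
proof -
  obtain i where "i \<in> V" "i < length w" using assms by auto
  then have "w ! i \<in> set (nths w V)" by (auto simp: set_nths)
  then show ?thesis by auto
qed

lemma part_coeff_with_one:
  assumes "partition_on {..<length w} P"
  shows "part_coeff f w P = wprod (with_one f) (with_one f) c w P"
  unfolding part_coeff_def wprod_def
proof (rule prod.cong[OF refl])
  fix V assume "V \<in> P"
  then have "V \<noteq> {}" "V \<subseteq> {..<length w}" using assms by (auto simp: partition_on_def)
  then show "f (nths w V) = (if c \<in> V then with_one f else with_one f) (nths w V)"
    by (simp add: nths_neq_Nil)
qed

abbreviation conv_rec :: "'k::field_char_0 family \<Rightarrow> 'k family \<Rightarrow> nat list \<Rightarrow> 'k" where
  "conv_rec f g \<equiv> nc_rec (with_one f) (with_one g) (with_one f) (with_one g)"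

lemma boxed_conv_eq_nc_rec:
  assumes "w \<in> words s"
  shows "boxed_conv s f g w = conv_rec f g w"
proof -
  have "boxed_conv s f g w =
      nc_sum (with_one f) (with_one g) (with_one f) (with_one g) w"
    using assms unfolding boxed_conv_def nc_sum_def
    by (auto intro!: sum.cong arg_cong2[where f="(*)"] part_coeff_with_one partition_on_kreweras simp: NC_def)
  then show ?thesis using assms by (simp add: nc_sum_eq_nc_rec words_iff)
qed

lemma boxed_conv_outside: "w \<notin> words s \<Longrightarrow> boxed_conv s f g w = 0"
  by (simp add: boxed_conv_def)

lemma with_one_boxed_conv:
  assumes "set w \<subseteq> {1..s}"
  shows "with_one (boxed_conv s f g) w = conv_rec f g w"
  using assms by (cases w) (simp_all add: boxed_conv_eq_nc_rec words_iff)

lemma boxed_conv_closed: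
  assumes "f \<in> gplus s" "g \<in> gplus s"
  shows "boxed_conv s f g \<in> gplus s"
  using assms by (auto simp: gplus_def boxed_conv_outside boxed_conv_eq_nc_rec words_iff nc_rec_Cons)

lemma boxed_conv_assoc:
  assumes "g \<in> gplus s"
  shows "boxed_conv s (boxed_conv s f g) h = boxed_conv s f (boxed_conv s g h)"
proof
  fix w
  show "boxed_conv s (boxed_conv s f g) h w = boxed_conv s f (boxed_conv s g h) w"
  proof (cases "w \<in> words s")
    case True
    let ?f = "with_one f" and ?g = "with_one g" and ?h = "with_one h"
    have w: "set w \<subseteq> {1..s}" using True by (simp add: words_iff)
    have "boxed_conv s (boxed_conv s f g) h w = nc_rec (nc_rec ?f ?g ?f ?g) ?h (nc_rec ?f ?g ?f ?g) ?h w"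
      unfolding boxed_conv_eq_nc_rec[OF True] using w
      by (intro nc_rec_cong[where S="{1..s}"]) (auto simp: with_one_boxed_conv)
    also have "\<dots> = nc_rec ?f (nc_rec ?g ?h ?g ?h) ?f (nc_rec ?g ?h ?g ?h) w"
      using w gplusD[OF assms] by (intro nc_rec_assoc[where S="{1..s}"]) auto
    also have "\<dots> = boxed_conv s f (boxed_conv s g h) w"
      unfolding boxed_conv_eq_nc_rec[OF True] using w
      by (intro nc_rec_cong[where S="{1..s}"]) (auto simp: with_one_boxed_conv)
    finally show ?thesis .
  qed (simp add: boxed_conv_outside)
qed

lemma boxed_unit_gplus: "boxed_unit s \<in> gplus s"
  by (auto simp: gplus_def boxed_unit_def words_iff)

lemma zeta_gplus: "zeta s \<in> gplus s"
  by (auto simp: gplus_def zeta_def words_iff)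

lemma boxed_unit_left:
  assumes "f \<in> gplus s"
  shows "boxed_conv s (boxed_unit s) f = f"
proof
  fix w show "boxed_conv s (boxed_unit s) f w = f w"
  proof (cases "w \<in> words s")
    case True
    then have "boxed_conv s (boxed_unit s) f w = with_one f w"
      unfolding boxed_conv_eq_nc_rec[OF True]
      by (intro nc_rec_unit_left[where S="{1..s}"]) (auto simp: words_iff boxed_unit_def with_one_def)
    then show ?thesis using True by (auto simp: words_iff)
  qed (simp add: boxed_conv_outside gplusD(2)[OF assms])
qed

text \<open>Says that \<open>E x w - x w\<close> depends only on the entries of \<open>x\<close> at
  shorter words, without naming this dependence; \<open>E\<close> may be non-linear.\<close>

definition unipotent :: "nat \<Rightarrow> ('k::field_char_0 family \<Rightarrow> 'k family) \<Rightarrow> bool" where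
  "unipotent s E \<longleftrightarrow> E \<in> coords s \<rightarrow> coords s \<and>
    (\<forall>x\<in>coords s. \<forall>y\<in>coords s. \<forall>w\<in>long_words s.
      (\<forall>v\<in>long_words s. length v < length w \<longrightarrow> x v = y v) \<longrightarrow> E x w - E y w = x w - y w)"

lemma unipotentD:
  assumes "unipotent s E" "x \<in> coords s" "y \<in> coords s" "w \<in> long_words s"
    and "\<And>v. v \<in> long_words s \<Longrightarrow> length v < length w \<Longrightarrow> x v = y v"
  shows "E x w - E y w = x w - y w"
  using assms unfolding unipotent_def by blast

lemma coords_eqI:
  assumes "x \<in> coords s" "y \<in> coords s"
    and "\<And>w. w \<in> long_words s \<Longrightarrow> (\<And>v. v \<in> long_words s \<Longrightarrow> length v < length w \<Longrightarrow> x v = y v) \<Longrightarrow> x w = y w"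
  shows "x = y"
proof
  fix w
  show "x w = y w"
  proof (induction w rule: length_induct)
    case (1 w)
    then show ?case using assms by (cases "w \<in> long_words s") (auto simp: coords_def)
  qed
qed

lemma unipotent_bij:
  assumes "unipotent s E"
  shows "bij_betw E (coords s) (coords s)"
  unfolding bij_betw_def
proof
  have Ec: "E x \<in> coords s" if "x \<in> coords s" for x
    using assms that by (auto simp: unipotent_def)
  show "inj_on E (coords s)"
  proof (rule inj_onI)
    fix x y assume xy: "x \<in> coords s" "y \<in> coords s" "E x = E y"
    show "x = y"
    proof (rule coords_eqI[OF xy(1,2)])
      fix w assume "w \<in> long_words s" "\<And>v. v \<in> long_words s \<Longrightarrow> length v < length w \<Longrightarrow> x v = y v"
      then show "x w = y w" using unipotentD[OF assms xy(1,2), of w] xy(3) by auto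
    qed
  qed
  show "E ` coords s = coords s"
  proof
    show "coords s \<subseteq> E ` coords s"
    proof
      fix z :: "'a family" assume z: "z \<in> coords s"
      \<comment> \<open>Successive approximation: stage \<open>Suc n\<close> corrects the entries at
        words of length \<open>Suc n\<close> by the defect that stage \<open>n\<close> leaves there.
        By unipotency this removes the defect, and shorter words are not disturbed.\<close>
      define X where "X = rec_nat (\<lambda>_. 0) (\<lambda>n x w. if w \<in> long_words s \<and> length w = Suc n
        then x w + (z w - E x w) else x w)"
      have X0: "X 0 = (\<lambda>_. 0)" and XS: "X (Suc n) = (\<lambda>w. if w \<in> long_words s \<and> length w = Suc n
        then X n w + (z w - E (X n) w) else X n w)" for n
        unfolding X_def by simp_all
      have Xc: "X n \<in> coords s" for n
        by (induction n) (auto simp: X0 XS coords_def)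
      have stab: "X (n + k) w = X n w" if "length w \<le> n" for n k w
        using that by (induction k) (auto simp: XS)
      define x where "x w = X (length w) w" for w
      have xc: "x \<in> coords s" using Xc by (auto simp: x_def coords_def)
      have xX: "x w = X n w" if "length w \<le> n" for w n
        using stab[of w "length w" "n - length w"] that by (simp add: x_def)
      have "E x = z"
      proof
        fix w
        show "E x w = z w"
        proof (cases "w \<in> long_words s")
          case True
          then obtain n where n: "length w = Suc n" by (cases "length w") (auto simp: long_words_iff)
          have "E x w - E (X n) w = x w - X n w"
            using True xX n by (intro unipotentD[OF assms xc Xc]) auto
          also have "x w - X n w = z w - E (X n) w"
            using True by (simp add: x_def n XS)
          finally show ?thesis by simp
        next
          case False
          then show ?thesis using Ec[OF xc] z by (simp add: coords_def)
        qed
      qed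
      then show "z \<in> E ` coords s" using xc by blast
    qed
  qed (use Ec in blast)
qed

lemma unipotent_comp:
  fixes E F :: "'k::field_char_0 family \<Rightarrow> 'k family"
  assumes "unipotent s E" "unipotent s F"
  shows "unipotent s (\<lambda>x. E (F x))"
proof -
  have Fc: "F x \<in> coords s" if "x \<in> coords s" for x :: "'k family" using assms(2) that by (auto simp: unipotent_def)
  have eq: "F x v = F y v" if "x \<in> coords s" "y \<in> coords s" "v \<in> long_words s" "length v < n"
    "\<And>v. v \<in> long_words s \<Longrightarrow> length v < n \<Longrightarrow> x v = y v" for x y :: "'k family" and v n
    using unipotentD[OF assms(2) that(1,2,3)] that(3-) by auto
  show ?thesis
    unfolding unipotent_def
  proof (intro conjI ballI impI)
    show "(\<lambda>x. E (F x)) \<in> coords s \<rightarrow> coords s" using Fc assms(1) by (auto simp: unipotent_def)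
    fix x y :: "'k family" and w
    assume xy: "x \<in> coords s" "y \<in> coords s" "w \<in> long_words s"
      and "\<forall>v\<in>long_words s. length v < length w \<longrightarrow> x v = y v"
    then have "\<And>v. v \<in> long_words s \<Longrightarrow> length v < length w \<Longrightarrow> x v = y v" by blast
    then show "E (F x) w - E (F y) w = x w - y w"
      using unipotentD[OF assms(1) Fc Fc, of x y w] unipotentD[OF assms(2), of x y w]
        eq[of x y _ "length w"] xy by simp
  qed
qed

section \<open>Translations in coordinates\<close>

lemma to_coords_closed:
  assumes "\<one>\<^bsub>G\<^esub> \<in> gplus s" "f \<in> gplus s"
  shows "to_coords G f \<in> coords s"
  unfolding coords_def to_coords_def
proof (intro CollectI allI impI)
  fix w assume "w \<notin> long_words s"
  then show "f w - \<one>\<^bsub>G\<^esub> w = 0"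
    using gplusD[OF assms(1)] gplusD[OF assms(2)] by (cases "w \<in> words s") (auto elim: words_cases)
qed

lemma of_coords_closed:
  assumes "\<one>\<^bsub>G\<^esub> \<in> gplus s" "x \<in> coords s"
  shows "of_coords G x \<in> gplus s"
  using assms by (auto simp: gplus_def coords_def of_coords_def long_words_def)

lemma to_of_coords [simp]: "to_coords G (of_coords G x) = x"
  by (simp add: to_coords_def of_coords_def)

lemma of_to_coords [simp]: "of_coords G (to_coords G x) = x"
  by (simp add: to_coords_def of_coords_def)

lemma of_coords_eq_iff: "of_coords G x w = of_coords G y w \<longleftrightarrow> x w = y w"
  by (simp add: of_coords_def)

lemma of_coords_agree:
  assumes "\<one>\<^bsub>G\<^esub> \<in> gplus s" "x \<in> coords s" "y \<in> coords s"
    and "\<And>v. v \<in> long_words s \<Longrightarrow> length v < n \<Longrightarrow> x v = y v" "set u \<subseteq> {1..s}" "length u < n"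
  shows "with_one (of_coords G x) u = with_one (of_coords G y) u"
proof (cases "u \<in> long_words s")
  case False
  then show ?thesis using assms(2,3) by (cases u) (simp_all add: of_coords_eq_iff coords_def)
qed (use assms in \<open>cases u; simp add: of_coords_eq_iff\<close>)

text \<open>The term of the single block is the only one to contain \<open>x w\<close>, with
  coefficient \<open>g [last w] = 1\<close>. Two different groups \<open>G\<close> and
  \<open>H\<close> are allowed because \<open>R\<close> passes from coordinates centred at one
  identity to coordinates centred at another.\<close>

lemma unipotent_boxed_left:
  fixes G H :: "'k::field_char_0 family monoid"
  assumes G: "\<one>\<^bsub>G\<^esub> \<in> gplus s" and H: "\<one>\<^bsub>H\<^esub> \<in> gplus s" and g: "g \<in> gplus s"
  shows "unipotent s (\<lambda>x. to_coords H (boxed_conv s (of_coords G x) g))"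
  unfolding unipotent_def
proof (intro conjI ballI impI funcsetI)
  fix x :: "'k family" assume "x \<in> coords s"
  then show "to_coords H (boxed_conv s (of_coords G x) g) \<in> coords s"
    by (intro to_coords_closed boxed_conv_closed of_coords_closed assms)
next
  fix x y :: "'k family" and w assume *: "x \<in> coords s" "y \<in> coords s" "w \<in> long_words s"
    "\<forall>v\<in>long_words s. length v < length w \<longrightarrow> x v = y v"
  have w: "w \<in> words s" "set w \<subseteq> {1..s}" "w \<noteq> []" using *(3) by (auto simp: long_words_def words_iff)
  let ?x = "of_coords G x" and ?y = "of_coords G y"
  have agree: "with_one ?x u = with_one ?y u" if "set u \<subseteq> {1..s}" "length u < length w" for u
    using *(4) that by (intro of_coords_agree[OF G *(1,2), of "length w"]) blast+
  have "conv_rec ?x g w - conv_rec ?y g w = (with_one ?x w - with_one ?y w) * with_one g [last w]"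
    by (rule nc_rec_diff_left[where S="{1..s}"]) (simp_all only: agree w gplusD[OF g] with_one_simps list.distinct
        simp_thms not_False_eq_True)
  moreover have "g [last w] = 1" using w gplusD(1)[OF g, of "last w"] last_in_set[OF w(3)] by blast
  ultimately show "to_coords H (boxed_conv s ?x g) w - to_coords H (boxed_conv s ?y g) w = x w - y w"
    using w by (simp add: to_coords_def boxed_conv_eq_nc_rec of_coords_def)
qed

lemma unipotent_boxed_right:
  fixes G H :: "'k::field_char_0 family monoid"
  assumes G: "\<one>\<^bsub>G\<^esub> \<in> gplus s" and H: "\<one>\<^bsub>H\<^esub> \<in> gplus s" and f: "f \<in> gplus s"
  shows "unipotent s (\<lambda>x. to_coords H (boxed_conv s f (of_coords G x)))"
  unfolding unipotent_def
proof (intro conjI ballI impI funcsetI)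
  fix x :: "'k family" assume "x \<in> coords s"
  then show "to_coords H (boxed_conv s f (of_coords G x)) \<in> coords s"
    by (intro to_coords_closed boxed_conv_closed of_coords_closed assms)
next
  fix x y :: "'k family" and w assume *: "x \<in> coords s" "y \<in> coords s" "w \<in> long_words s"
    "\<forall>v\<in>long_words s. length v < length w \<longrightarrow> x v = y v"
  have w: "w \<in> words s" "set w \<subseteq> {1..s}" "w \<noteq> []" using *(3) by (auto simp: long_words_def words_iff)
  let ?x = "of_coords G x" and ?y = "of_coords G y"
  have agree: "with_one ?x u = with_one ?y u" if "set u \<subseteq> {1..s}" "length u < length w" for u
    using *(4) that by (intro of_coords_agree[OF G *(1,2), of "length w"]) blast+
  have "conv_rec f ?x w - conv_rec f ?y w = with_one f [hd w] * (with_one ?x w - with_one ?y w)"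
    by (rule nc_rec_diff_right[where S="{1..s}"]) (simp_all only: agree w gplusD[OF f] with_one_simps list.distinct
        simp_thms not_False_eq_True)
  moreover have "f [hd w] = 1" using w gplusD(1)[OF f, of "hd w"] hd_in_set[OF w(3)] by blast
  ultimately show "to_coords H (boxed_conv s f ?x) w - to_coords H (boxed_conv s f ?y) w = x w - y w"
    using w by (simp add: to_coords_def boxed_conv_eq_nc_rec of_coords_def)
qed

section \<open>Group structure and the R-transform\<close>

lemma boxed_group_simps [simp]:
  "carrier (boxed_group s) = gplus s" "mult (boxed_group s) = boxed_conv s"
  "one (boxed_group s) = boxed_unit s"
  by (simp_all add: boxed_group_def)

text \<open>A left inverse of \<open>g\<close> is a preimage of the unit under right translation by
  \<open>g\<close>, which is onto by unipotency.\<close>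

lemma group_boxed_group: "group (boxed_group s :: 'k::field_char_0 family monoid)"
proof (rule groupI)
  let ?G = "boxed_group s :: 'k family monoid"
  fix g assume "g \<in> carrier ?G"
  then have g: "g \<in> gplus s" by simp
  have one: "\<one>\<^bsub>?G\<^esub> \<in> gplus s" by (simp add: boxed_unit_gplus)
  have "(\<lambda>x. to_coords ?G (boxed_conv s (of_coords ?G x) g)) ` coords s = coords s"
    using unipotent_bij[OF unipotent_boxed_left[OF one one g]] by (simp add: bij_betw_def)
  moreover have "to_coords ?G (boxed_unit s) \<in> coords s"
    by (intro to_coords_closed one boxed_unit_gplus)
  ultimately have "to_coords ?G (boxed_unit s) \<in> (\<lambda>x. to_coords ?G (boxed_conv s (of_coords ?G x) g)) ` coords s"
    by (simp only:)
  then obtain x where x: "to_coords ?G (boxed_unit s) = to_coords ?G (boxed_conv s (of_coords ?G x) g)"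
    "x \<in> coords s" by (rule imageE)
  have "boxed_conv s (of_coords ?G x) g = boxed_unit s"
    using arg_cong[OF x(1), of "of_coords ?G"] by simp
  then show "\<exists>f\<in>carrier ?G. f \<otimes>\<^bsub>?G\<^esub> g = \<one>\<^bsub>?G\<^esub>"
    using of_coords_closed[OF one x(2)] by auto
qed (simp_all add: boxed_conv_closed boxed_unit_gplus boxed_conv_assoc boxed_unit_left)

lemma moeb_gplus: "moeb s \<in> gplus s"
  using group.inv_closed[OF group_boxed_group[of s], of "zeta s"] by (simp add: moeb_def zeta_gplus)

lemma moeb_zeta: "boxed_conv s (moeb s) (zeta s) = boxed_unit s"
  using group.l_inv[OF group_boxed_group[of s], of "zeta s"] by (simp add: moeb_def zeta_gplus)

lemma zeta_moeb: "boxed_conv s (zeta s) (moeb s) = boxed_unit s"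
  using group.r_inv[OF group_boxed_group[of s], of "zeta s"] by (simp add: moeb_def zeta_gplus)

lemma boxed_unit_right:
  assumes "f \<in> gplus s"
  shows "boxed_conv s f (boxed_unit s) = f"
  using monoid.r_one[OF group.is_monoid[OF group_boxed_group[of s]], of f] assms by simp

lemma R_transform_gplus: "f \<in> gplus s \<Longrightarrow> R_transform s f \<in> gplus s"
  by (simp add: R_transform_def boxed_conv_closed moeb_gplus)

lemma R_transform_boxed_zeta:
  assumes "f \<in> gplus s" shows "boxed_conv s (R_transform s f) (zeta s) = f"
  using assms by (simp add: R_transform_def boxed_conv_assoc moeb_gplus moeb_zeta boxed_unit_right)

lemma bij_R_transform: "bij_betw (R_transform s) (gplus s) (gplus s :: 'k::field_char_0 family set)"
proof (rule bij_betw_byWitness[where f'="\<lambda>f. boxed_conv s f (zeta s)"])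
  show "\<forall>f\<in>gplus s. R_transform s (boxed_conv s f (zeta s)) = (f :: 'k family)"
    by (simp add: R_transform_def boxed_conv_assoc zeta_gplus zeta_moeb boxed_unit_right)
qed (auto simp: R_transform_boxed_zeta R_transform_gplus boxed_conv_closed zeta_gplus)


section \<open>Freeness\<close>

text \<open>\<open>mixed_moment k g s r\<close> is the joint moment of \<open>y\<^sub>s r\<close>, for \<open>k\<close> the cumulants of the \<open>x\<close>-letters and \<open>g\<close> the
  moments of the \<open>y\<close>-letters. In \<open>open_block k g s v r\<close> the first \<open>x\<close>-block, with letters \<open>v\<close> so far, may still be
  continued in \<open>r\<close>.\<close>

function mixed_moment :: "(nat list \<Rightarrow> 'k::comm_ring_1) \<Rightarrow> (nat list \<Rightarrow> 'k) \<Rightarrow> nat list \<Rightarrow> (nat + nat) list \<Rightarrow> 'k"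
  and open_block :: "(nat list \<Rightarrow> 'k) \<Rightarrow> (nat list \<Rightarrow> 'k) \<Rightarrow> nat list \<Rightarrow> nat list \<Rightarrow> (nat + nat) list \<Rightarrow> 'k"
  where
  "mixed_moment k g s [] = g s"
| "mixed_moment k g s (Inr y # r) = mixed_moment k g (s @ [y]) r"
| "mixed_moment k g s (Inl x # r) = open_block k g s [x] r"
| "open_block k g s v r = k v * mixed_moment k g s r + (\<Sum>i<length r. if isl (r ! i)
     then mixed_moment k g [] (take i r) * open_block k g s (v @ [projl (r ! i)]) (drop (Suc i) r) else 0)"
  by pat_completeness auto
termination
  by (relation "measure (case_sum (\<lambda>(k, g, s, r). 2 * length r) (\<lambda>(k, g, s, v, r). 2 * length r + 1))") auto

declare open_block.simps [simp del]

text \<open>The counterpart of \<open>lconv\<close> for mixed words: a cut removes an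
  \<open>x\<close>-letter, the candidate for the next letter of the open block, and hands it to
  \<open>h2\<close>.\<close>

definition splits :: "((nat + nat) list \<Rightarrow> 'k::comm_ring_1) \<Rightarrow> (nat \<Rightarrow> (nat + nat) list \<Rightarrow> 'k) \<Rightarrow> (nat + nat) list \<Rightarrow> 'k"
  where "splits h1 h2 r =
    (\<Sum>i<length r. if isl (r ! i) then h1 (take i r) * h2 (projl (r ! i)) (drop (Suc i) r) else 0)"

lemma open_block_splits: "open_block k g s v r = k v * mixed_moment k g s r + splits (mixed_moment k g []) (\<lambda>x. open_block k g s (v @ [x])) r"
  by (simp add: open_block.simps[of k g s v r] splits_def)

lemma splits_Nil [simp]: "splits h1 h2 [] = 0"
  by (simp add: splits_def)

lemma splits_Cons: "splits h1 h2 (c # r) =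
    (if isl c then h1 [] * h2 (projl c) r else 0) + splits (\<lambda>p. h1 (c # p)) h2 r"
  by (simp add: splits_def sum.lessThan_Suc_shift del: sum.lessThan_Suc cong: if_cong)

lemma splits_append: "splits h1 h2 (b @ r) =
    splits h1 (\<lambda>x q. h2 x (q @ r)) b + splits (\<lambda>p. h1 (b @ p)) h2 r"
  by (induction b arbitrary: h1) (simp_all add: splits_Cons add.assoc)

lemma splits_diff: "splits (\<lambda>p. h1 p - c * h1' p) h2 r = splits h1 h2 r - c * splits h1' h2 r"
  unfolding splits_def sum_distrib_left sum_subtractf[symmetric]
  by (intro sum.cong refl) (simp add: algebra_simps)

lemma splits_scale_right: "splits h1 (\<lambda>x q. h2 x q * c) r = splits h1 h2 r * c"
  unfolding splits_def sum_distrib_right by (intro sum.cong refl) (simp add: algebra_simps)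

lemma splits_cong:
  assumes "\<And>p x q. r = p @ Inl x # q \<Longrightarrow> h1 p * h2 x q = h1' p * h2' x q"
  shows "splits h1 h2 r = splits h1' h2' r"
  unfolding splits_def
proof (intro sum.cong refl if_cong)
  fix i assume i: "i \<in> {..<length r}" and "isl (r ! i)"
  then have "r = take i r @ Inl (projl (r ! i)) # drop (Suc i) r" by (simp add: id_take_nth_drop[symmetric])
  then show "h1 (take i r) * h2 (projl (r ! i)) (drop (Suc i) r) =
      h1' (take i r) * h2' (projl (r ! i)) (drop (Suc i) r)" by (rule assms)
qed

text \<open>\<open>centred X bs H\<close> is the value of the linear functional \<open>H\<close> at the product of the centred
  monomials \<open>b - X b\<close>, for \<open>b\<close> in \<open>bs\<close>.\<close>

fun centred :: "('a list \<Rightarrow> 'k::comm_ring_1) \<Rightarrow> 'a list list \<Rightarrow> ('a list \<Rightarrow> 'k) \<Rightarrow> 'k" where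
  "centred X [] H = H []"
| "centred X (b # bs) H = centred X bs (\<lambda>r. H (b @ r)) - X b * centred X bs H"

lemma centred_add: "centred X bs (\<lambda>r. H r + H' r) = centred X bs H + centred X bs H'"
  by (induction bs arbitrary: H H') (simp_all add: algebra_simps)

lemma centred_scale: "centred X bs (\<lambda>r. c * H r) = c * centred X bs H"
  by (induction bs arbitrary: H) (simp_all add: algebra_simps)

lemma centred_zero: "centred X bs (\<lambda>r. 0) = 0"
  using centred_scale[of X bs 0 "\<lambda>_. 0"] by simp

lemma centred_sum: "centred X bs (\<lambda>r. \<Sum>i\<in>A. H i r) = (\<Sum>i\<in>A. centred X bs (H i))"
  by (induction A rule: infinite_finite_induct) (simp_all add: centred_zero centred_add)

lemma centred_append: "centred X (bs @ [b]) H = centred X bs (\<lambda>p. H (p @ b)) - X b * centred X bs H"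
proof (induction bs arbitrary: H)
  case (Cons c bs)
  show ?case by (simp add: Cons.IH) (simp add: algebra_simps)
qed simp

lemma centred_splits: "centred X bs (\<lambda>r. splits h1 (\<lambda>x q. h2 x q r) b) = splits h1 (\<lambda>x q. centred X bs (h2 x q)) b"
  unfolding splits_def centred_sum
  by (intro sum.cong refl) (simp add: centred_scale centred_zero)

text \<open>When the centred factors are multiplied out, a cut falls inside one of them, and the
  left part is the centred product of the earlier factors followed by a prefix of that one. If
  \<open>h1\<close> vanishes on all these left parts, the sum vanishes for every
  \<open>h2\<close>.\<close>

lemma centred_splits_eq_0:
  assumes "\<And>bs1 p x q bs2. bs = bs1 @ (p @ Inl x # q) # bs2 \<Longrightarrow> centred X bs1 (\<lambda>r. h1 (r @ p)) = 0"
  shows "centred X bs (splits h1 h2) = 0"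
  using assms
proof (induction bs arbitrary: h1)
  case (Cons b bs)
  have "splits h1 (\<lambda>x q. h2 x (q @ r)) b = splits (\<lambda>_. 0) (\<lambda>_ _. 0) b" for r
    using Cons.prems[of "[]"] by (intro splits_cong) auto
  then have "splits h1 (\<lambda>x q. h2 x (q @ r)) b = 0" for r
    by (simp add: splits_def cong: if_cong)
  then have "centred X (b # bs) (splits h1 h2) =
      centred X bs (splits (\<lambda>p. h1 (b @ p)) h2) - X b * centred X bs (splits h1 h2)"
    by (simp add: splits_append)
  also have "\<dots> = centred X bs (splits (\<lambda>p. h1 (b @ p) - X b * h1 p) h2)"
  proof -
    have "splits (\<lambda>p. h1 (b @ p) - X b * h1 p) h2 =
        (\<lambda>r. splits (\<lambda>p. h1 (b @ p)) h2 r + (- X b) * splits h1 h2 r)"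
      by (simp add: splits_diff fun_eq_iff)
    then show ?thesis by (simp only: centred_add centred_scale) simp
  qed
  also have "\<dots> = 0"
  proof (rule Cons.IH)
    fix bs1 p x q bs2 assume "bs = bs1 @ (p @ Inl x # q) # bs2"
    then have "centred X (b # bs1) (\<lambda>r. h1 (r @ p)) = 0"
      using Cons.prems[of "b # bs1" p x q bs2] by simp
    moreover have "(\<lambda>r. h1 (b @ r @ p) - X b * h1 (r @ p)) = (\<lambda>r. h1 (b @ r @ p) + (- X b) * h1 (r @ p))"
      by simp
    ultimately show "centred X bs1 (\<lambda>r. h1 (b @ r @ p) - X b * h1 (r @ p)) = 0"
      by (simp only: centred_add centred_scale) simp
  qed
  finally show ?case .
qed simp

fun runs :: "bool \<Rightarrow> (nat + nat) list list \<Rightarrow> bool" where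
  "runs c [] \<longleftrightarrow> True"
| "runs c (b # bs) \<longleftrightarrow> b \<noteq> [] \<and> (\<forall>a\<in>set b. isl a = c) \<and> runs (\<not> c) bs"

lemma runs_appendD: "runs c (bs @ bs') \<Longrightarrow> runs c bs"
  by (induction bs arbitrary: c) auto

lemma runs_prefix: "runs c (bs @ (p @ q) # bs') \<Longrightarrow> p \<noteq> [] \<Longrightarrow> runs c (bs @ [p])"
  by (induction bs arbitrary: c) auto

lemma mixed_moment_map_Inr: "mixed_moment k g s (map Inr q @ r) = mixed_moment k g (s @ q) r"
  by (induction q arbitrary: s) simp_all

lemma list_all_isr: "(\<forall>a\<in>set b. \<not> isl a) \<Longrightarrow> \<exists>q. b = map Inr q"
  by (intro exI[of _ "map projr b"]) (auto simp: map_idI)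

text \<open>The induction behind freeness: a run of \<open>x\<close>-letters factors out of a centred product.\<close>

lemma centred_open_block:
  assumes g: "g [] = 1"
  shows "\<forall>a\<in>set b. isl a \<Longrightarrow> runs False bs \<Longrightarrow>
    centred (mixed_moment k g []) bs (\<lambda>r. open_block k g s v (b @ r)) =
      open_block k g [] v b * centred (mixed_moment k g []) bs (mixed_moment k g s)"
proof (induction "length b + length (concat bs)" arbitrary: s v b bs rule: less_induct)
  case less
  let ?X = "mixed_moment k g []"
  define n where "n = length b + length (concat bs)"
  have IH: "centred ?X bs (\<lambda>r. open_block k g s v (b @ r)) = open_block k g [] v b * centred ?X bs (mixed_moment k g s)"
    if "length b + length (concat bs) < n" "\<forall>a\<in>set b. isl a" "runs False bs" for s v b bs
    using less.hyps that by (simp add: n_def)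
  \<comment> \<open>For a product that starts with an \<open>x\<close>-run, the induction hypothesis
    factors out the value of this run; centring subtracts exactly the same term.\<close>
  have V: "centred ?X bs (mixed_moment k g s) = 0"
    if prem: "runs True bs" "bs \<noteq> []" "length (concat bs) \<le> n" for bs s
  proof -
    obtain x b bs' where bs: "bs = (Inl x # b) # bs'"
      using prem(1,2) by (cases bs; cases "hd bs") (auto simp: isl_def)
    then show ?thesis using IH[of b bs' s "[x]"] prem by simp
  qed
  \<comment> \<open>A leading \<open>y\<close>-run only changes the seed \<open>s\<close>, and
    \<open>V\<close> covers every seed.\<close>
  have V': "centred ?X bs ?X = 0" if prem: "runs c bs" "bs \<noteq> []" "length (concat bs) \<le> n" for c bs
  proof (cases c)
    case True
    then show ?thesis using V prem by simp
  next
    case False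
    then obtain b bs' where bs: "bs = b # bs'" "\<forall>a\<in>set b. \<not> isl a" "runs True bs'"
      using prem(1,2) False by (cases bs) auto
    then obtain q where q: "b = map Inr q" using list_all_isr by blast
    show ?thesis
    proof (cases "bs' = []")
      case True
      then show ?thesis using mixed_moment_map_Inr[of k g "[]" q "[]"] by (simp add: bs q g)
    next
      case False
      then show ?thesis using V[of bs'] bs prem by (simp add: q mixed_moment_map_Inr)
    qed
  qed
  \<comment> \<open>The prefix \<open>p\<close> may be replaced by its centred version, because the
    correction is a multiple of a product that vanishes already.\<close>
  have gap0: "centred ?X bs (\<lambda>r. ?X (r @ p)) = 0"
    if "runs c bs" "bs \<noteq> []" "p = [] \<or> runs c (bs @ [p])" "length (concat bs) + length p \<le> n" for c bs p
    using that V'[of c bs] V'[of c "bs @ [p]"] centred_append[of ?X bs p ?X] by (cases "p = []") auto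
  have gap: "centred ?X bs1 (\<lambda>r. ?X (b @ r @ p)) = 0"
    if "runs False bs1" "bs1 \<noteq> []" "p = [] \<or> runs False (bs1 @ [p])"
      "length b + length (concat bs1) + length p \<le> n" "\<forall>a\<in>set b. isl a" for b bs1 p
    using that gap0[of False bs1 p] gap0[of True "b # bs1" p] by (cases "b = []") auto
  let ?C = "centred ?X bs (mixed_moment k g s)"
  have M0: "centred ?X bs (\<lambda>r. mixed_moment k g s (b @ r)) = ?X b * ?C"
  proof (cases b)
    case (Cons c b')
    then obtain x where "c = Inl x" using less.prems by (auto simp: isl_def)
    then show ?thesis using IH[of b' bs s "[x]"] less.prems Cons by (simp add: n_def)
  qed (simp add: g)
  have S1: "splits ?X (\<lambda>x q. centred ?X bs (\<lambda>r. open_block k g s (v @ [x]) (q @ r))) b =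
      splits ?X (\<lambda>x q. open_block k g [] (v @ [x]) q * ?C) b"
  proof (rule splits_cong)
    fix p x q assume b: "b = p @ Inl x # q"
    then have "centred ?X bs (\<lambda>r. open_block k g s (v @ [x]) (q @ r)) = open_block k g [] (v @ [x]) q * ?C"
      using less.prems by (intro IH) (auto simp: n_def)
    then show "?X p * centred ?X bs (\<lambda>r. open_block k g s (v @ [x]) (q @ r)) =
        ?X p * (open_block k g [] (v @ [x]) q * ?C)" by simp
  qed
  \<comment> \<open>Continuing the open block inside a later factor contributes nothing:
    \<open>bs\<close> starts with a \<open>y\<close>-run, where no cut can fall, so the skipped part
    contains at least one centred factor and its moment vanishes by \<open>gap\<close>.\<close>
  have S2: "centred ?X bs (splits (\<lambda>p. ?X (b @ p)) (\<lambda>x. open_block k g s (v @ [x]))) = 0"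
  proof (rule centred_splits_eq_0)
    fix bs1 p x q bs2 assume bs: "bs = bs1 @ (p @ Inl x # q) # bs2"
    have "bs1 \<noteq> []" using less.prems(2) bs by (cases bs1) auto
    moreover have "runs False bs1" using runs_appendD less.prems(2) bs by blast
    moreover have "p = [] \<or> runs False (bs1 @ [p])" using runs_prefix less.prems(2) bs by blast
    ultimately show "centred ?X bs1 (\<lambda>r. ?X (b @ r @ p)) = 0"
      using less.prems(1) by (intro gap) (auto simp: n_def bs)
  qed
  have "centred ?X bs (\<lambda>r. open_block k g s v (b @ r)) = k v * (?X b * ?C) +
      splits ?X (\<lambda>x q. open_block k g [] (v @ [x]) q * ?C) b"
    unfolding open_block_splits[of k g s v] splits_append
    by (simp add: centred_add centred_scale M0 centred_splits S1 S2)
  also have "\<dots> = open_block k g [] v b * ?C"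
    by (simp only: open_block_splits[of k g "[]" v] splits_scale_right distrib_right mult.assoc)
  finally show ?case .
qed

lemma centred_mixed_moment_left:
  assumes "g [] = 1" "runs True bs" "bs \<noteq> []"
  shows "centred (mixed_moment k g []) bs (mixed_moment k g s) = 0"
proof -
  obtain x b bs' where bs: "bs = (Inl x # b) # bs'"
    using assms(2,3) by (cases bs; cases "hd bs") (auto simp: isl_def)
  then show ?thesis using centred_open_block[where g=g and k=k, OF assms(1), of b bs' s "[x]"] assms(2) by simp
qed

lemma centred_mixed_moment:
  assumes "g [] = 1" "runs c bs" "bs \<noteq> []"
  shows "centred (mixed_moment k g []) bs (mixed_moment k g []) = 0"
proof (cases c)
  case True
  then show ?thesis using centred_mixed_moment_left assms by simp
next
  case False
  then obtain b bs' where bs: "bs = b # bs'" "\<forall>a\<in>set b. \<not> isl a" "runs True bs'"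
    using assms by (cases bs) auto
  then obtain q where q: "b = map Inr q" using list_all_isr by blast
  show ?thesis
  proof (cases "bs' = []")
    case True
    then show ?thesis using mixed_moment_map_Inr[of k g "[]" q "[]"] by (simp add: bs q assms)
  next
    case False
    then show ?thesis using centred_mixed_moment_left[of g bs'] bs assms by (simp add: q mixed_moment_map_Inr)
  qed
qed

section \<open>Comparison with the defining recursion of the free product\<close>

lemma sum_Pow_Suc:
  fixes h :: "nat set \<Rightarrow> 'k::comm_ring_1"
  shows "(\<Sum>I\<in>Pow {..<Suc m}. h I) = (\<Sum>I\<in>Pow {..<m}. h (insert 0 (Suc ` I))) + (\<Sum>I\<in>Pow {..<m}. h (Suc ` I))"
proof -
  have "Pow {..<Suc m} = (\<lambda>I. insert 0 (Suc ` I)) ` Pow {..<m} \<union> (`) Suc ` Pow {..<m}"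
    unfolding lessThan_Suc_eq_insert_0 Pow_insert image_Pow_surj[OF refl, symmetric] image_image by blast
  moreover have "inj_on (\<lambda>I. insert 0 (Suc ` I)) (Pow {..<m})"
  proof (rule inj_on_inverseI)
    show "Suc -` insert 0 (Suc ` I) = I" for I by auto
  qed
  moreover have "inj_on ((`) Suc) (Pow {..<m})" by (rule inj_on_image_Pow) simp
  moreover have "(\<lambda>I. insert 0 (Suc ` I)) ` Pow {..<m} \<inter> (`) Suc ` Pow {..<m} = {}" by auto
  ultimately show ?thesis by (simp add: sum.union_disjoint sum.reindex)
qed

text \<open>This multiplies out the product of the \<open>b - X b\<close>, with \<open>I\<close> the
  set of factors from which \<open>b\<close> is taken.\<close>

lemma centred_eq_sum:
  fixes X :: "'a list \<Rightarrow> 'k::comm_ring_1"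
  shows "centred X bs H = (\<Sum>I\<in>Pow {..<length bs}. (- 1) ^ (length bs - card I) * H (concat (nths bs I)) *
     (\<Prod>i\<in>{..<length bs} - I. X (bs ! i)))"
proof (induction bs arbitrary: H)
  case (Cons b bs)
  let ?m = "length bs"
  have fin: "finite I" "card I \<le> ?m" if "I \<subseteq> {..<?m}" for I
    using that finite_subset[OF that] card_mono[OF _ that] by auto
  have 1: "(\<Prod>i\<in>{..<Suc ?m} - insert 0 (Suc ` I). X ((b # bs) ! i)) = (\<Prod>i\<in>{..<?m} - I. X (bs ! i))" for I
  proof -
    have "{..<Suc ?m} - insert 0 (Suc ` I) = Suc ` ({..<?m} - I)"
      by (auto simp: lessThan_Suc_eq_insert_0)
    then show ?thesis by (simp add: prod.reindex)
  qed
  have 2: "(\<Prod>i\<in>{..<Suc ?m} - Suc ` I. X ((b # bs) ! i)) = X b * (\<Prod>i\<in>{..<?m} - I. X (bs ! i))" for I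
  proof -
    have "{..<Suc ?m} - Suc ` I = insert 0 (Suc ` ({..<?m} - I))"
      by (auto simp: lessThan_Suc_eq_insert_0)
    then show ?thesis by (simp add: prod.reindex)
  qed
  have 3: "concat (nths (b # bs) (insert 0 (Suc ` I))) = b @ concat (nths bs I)"
    "concat (nths (b # bs) (Suc ` I)) = concat (nths bs I)" for I
    by (simp_all add: nths_Cons image_iff)
  have 4: "(- 1 :: 'k) ^ (Suc ?m - card (insert 0 (Suc ` I))) = (- 1) ^ (?m - card I)"
    "(- 1 :: 'k) ^ (Suc ?m - card (Suc ` I)) = - ((- 1) ^ (?m - card I))" if "I \<subseteq> {..<?m}" for I
    using fin[OF that] by (simp_all add: card_image Suc_diff_le)
  let ?t = "\<lambda>I. (- 1) ^ (Suc ?m - card I) * H (concat (nths (b # bs) I)) *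
     (\<Prod>i\<in>{..<Suc ?m} - I. X ((b # bs) ! i))"
  have "(\<Sum>I\<in>Pow {..<?m}. ?t (insert 0 (Suc ` I))) = centred X bs (\<lambda>r. H (b @ r))"
    unfolding Cons.IH by (rule sum.cong[OF refl]) (simp only: 1 3 4 Pow_iff)
  moreover have "(\<Sum>I\<in>Pow {..<?m}. ?t (Suc ` I)) = (- X b) * centred X bs H"
    unfolding Cons.IH sum_distrib_left
    by (rule sum.cong[OF refl]) (simp only: 2 3 4 Pow_iff mult_minus_left mult_minus_right mult_ac)
  ultimately show ?case by (simp only: length_Cons sum_Pow_Suc centred.simps) simp
qed simp

lemma factors_runs:
  assumes "u \<noteq> []"
  shows "factors u \<noteq> [] \<and> hd (hd (factors u)) = hd u \<and> runs (isl (hd u)) (factors u)"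
  using assms
proof (induction u)
  case (Cons a u)
  show ?case
  proof (cases "u = []")
    case False
    then obtain b bs where f: "factors u = b # bs" "hd b = hd u" "runs (isl (hd u)) (b # bs)"
      using Cons.IH by (cases "factors u") auto
    then show ?thesis by (cases "isl a"; cases "isl (hd u)") auto
  qed simp
qed simp

text \<open>Up to a common sign, the recursion has all terms of the expanded centred product except
  the one for the full set of factors, which is the moment of \<open>u\<close>. As the whole
  expansion is 0, the two functionals agree by induction on the length. \<open>S\<close> bounds the
  \<open>x\<close>-letters for which the moments are known to be given by \<open>f\<close>.\<close>

lemma free_product_functional_eq_mixed_moment:
  assumes g: "\<And>w. w \<noteq> [] \<Longrightarrow> g w = g' w" "g' [] = 1"
    and f: "\<And>w. w \<noteq> [] \<Longrightarrow> set w \<subseteq> S \<Longrightarrow> mixed_moment k g' [] (map Inl w) = f w"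
    and u: "\<And>x. Inl x \<in> set u \<Longrightarrow> x \<in> S"
  shows "free_product_functional f g u = mixed_moment k g' [] u"
  using u
proof (induction u rule: length_induct)
  case (1 u)
  show ?case
  proof (cases "u = []")
    case True
    then show ?thesis by (simp add: free_product_functional.simps g)
  next
    case False
    let ?X = "mixed_moment k g' []" and ?as = "factors u"
    let ?m = "length ?as"
    have runs: "runs (isl (hd u)) ?as" "?as \<noteq> []" using factors_runs[OF False] by auto
    have mono: "\<exists>c. \<forall>a\<in>set b. isl a = c" if "b \<in> set bs" "runs c bs" for b c bs
      using that by (induction bs arbitrary: c) auto
    have rv: "run_value f g b = ?X b" if b: "b \<in> set ?as" for b
    proof -
      have "b \<noteq> []" using b factors_nonempty by metis
      obtain c where c: "\<forall>a\<in>set b. isl a = c" using mono[OF b runs(1)] by blast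
      show ?thesis
      proof (cases c)
        case True
        then have eq: "b = map Inl (map projl b)" using c by (auto simp: map_idI)
        have "x \<in> S" if "x \<in> set (map projl b)" for x
        proof -
          obtain a where "a \<in> set b" "x = projl a" using \<open>x \<in> set (map projl b)\<close> by auto
          then have "Inl x \<in> set b" using c True by (metis sum.collapse(1))
          then have "Inl x \<in> set (concat ?as)" using b by auto
          then show ?thesis using 1(2) concat_factors by metis
        qed
        then have "?X (map Inl (map projl b)) = f (map projl b)"
          using \<open>b \<noteq> []\<close> by (intro f) auto
        moreover have "isl (hd b)" using c True \<open>b \<noteq> []\<close> by simp
        ultimately show ?thesis using eq by (simp add: run_value_def)
      next
        case False
        then obtain q where q: "b = map Inr q" using c list_all_isr by blast
        then have "q \<noteq> []" using \<open>b \<noteq> []\<close> by auto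
        then show ?thesis
          using mixed_moment_map_Inr[of k g' "[]" q "[]"] g(1)[of q] by (simp add: q run_value_def hd_map comp_def)
      qed
    qed
    have IH: "free_product_functional f g (concat (nths ?as I)) = ?X (concat (nths ?as I))"
      if "I \<subset> {..<?m}" for I
    proof (rule 1(1)[rule_format])
      show "length (concat (nths ?as I)) < length u"
        using length_concat_nths_less[OF factors_nonempty that] by (simp only: concat_factors)
      fix x assume "Inl x \<in> set (concat (nths ?as I))"
      then have "Inl x \<in> set (concat ?as)" by (auto dest: in_set_nthsD)
      then show "x \<in> S" using 1(2) concat_factors by metis
    qed
    have "free_product_functional f g u = (\<Sum>I\<in>{I. I \<subset> {..<?m}}. (-1) ^ (?m - card I + 1)
          * free_product_functional f g (concat (nths ?as I))
          * (\<Prod>i\<in>{..<?m} - I. run_value f g (?as ! i)))"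
      using False by (subst free_product_functional.simps) (simp add: Let_def)
    also have "\<dots> = (\<Sum>I\<in>{I. I \<subset> {..<?m}}. - ((-1) ^ (?m - card I)
          * ?X (concat (nths ?as I)) * (\<Prod>i\<in>{..<?m} - I. ?X (?as ! i))))"
      by (intro sum.cong refl) (simp add: IH rv)
    also have "\<dots> = ?X u - centred ?X ?as ?X"
    proof -
      have "Pow {..<?m} = insert {..<?m} {I. I \<subset> {..<?m}}" by auto
      moreover have "finite {I. I \<subset> {..<?m}}" by (rule finite_subset[of _ "Pow {..<?m}"]) auto
      moreover have "nths ?as {..<?m} = ?as" by (simp add: nths_all)
      ultimately show ?thesis
        by (simp add: centred_eq_sum sum_negf concat_factors)
    qed
    also have "centred ?X ?as ?X = 0" using centred_mixed_moment[where k=k and g=g', OF g(2) runs] .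
    finally show ?thesis by simp
  qed
qed

section \<open>Moments of pure and of alternating words\<close>

lemma drop_eq_Cons: "i < length w \<Longrightarrow> drop i w = w ! i # drop (Suc i) w"
  by (simp add: Cons_nth_drop_Suc)

text \<open>Without \<open>y\<close>-letters every complementary block has the weight
  \<open>g [] = 1\<close>, and the moment-cumulant formula remains. The prefix \<open>p\<close> is
  the part of the open block already read.\<close>

lemma open_block_x_word:
  assumes "k [] = 1" "g [] = 1"
  shows "open_block k g [] (p @ [a]) (map Inl w) = nc_rec k (\<lambda>_. 1) (\<lambda>u. k (p @ u)) (\<lambda>_. 1) (a # w)"
proof (induction w arbitrary: p a rule: length_induct)
  case (1 w)
  have mixed_moment: "mixed_moment k g [] (map Inl v) = nc_rec k (\<lambda>_. 1) k (\<lambda>_. 1) v" if "length v \<le> length w" for v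
  proof (cases v)
    case (Cons b t)
    then show ?thesis using 1[rule_format, of t "[]" b] that by simp
  qed (simp add: assms)
  have "splits (mixed_moment k g []) (\<lambda>x. open_block k g [] (p @ [a, x])) (map Inl w) =
      lconv (nc_rec k (\<lambda>_. 1) k (\<lambda>_. 1)) (nc_rec k (\<lambda>_. 1) (\<lambda>u. k (p @ a # u)) (\<lambda>_. 1)) w"
    unfolding splits_def lconv_def
  proof (rule sum.cong)
    fix i assume "i \<in> {..<length w}"
    then have i: "i < length w" by simp
    then have "open_block k g [] ((p @ [a]) @ [w ! i]) (map Inl (drop (Suc i) w)) =
        nc_rec k (\<lambda>_. 1) (\<lambda>u. k ((p @ [a]) @ u)) (\<lambda>_. 1) (w ! i # drop (Suc i) w)"
      by (intro 1[rule_format]) simp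
    then show "(if isl (map Inl w ! i) then mixed_moment k g [] (take i (map Inl w)) *
          open_block k g [] (p @ [a, projl (map Inl w ! i)]) (drop (Suc i) (map Inl w)) else 0) =
        nc_rec k (\<lambda>_. 1) k (\<lambda>_. 1) (take i w) * nc_rec k (\<lambda>_. 1) (\<lambda>u. k (p @ a # u)) (\<lambda>_. 1) (drop i w)"
      using i mixed_moment[of "take i w"] by (simp add: take_map drop_map drop_eq_Cons)
  qed simp
  then show ?case using mixed_moment[of w] by (simp add: open_block_splits[of k g "[]"] nc_rec_Cons)
qed

lemma mixed_moment_x_word:
  assumes "k [] = 1" "g [] = 1"
  shows "mixed_moment k g [] (map Inl w) = nc_rec k (\<lambda>_. 1) k (\<lambda>_. 1) w"
  using open_block_x_word[where k=k and g=g, OF assms, of "[]"] assms by (cases w) simp_all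

abbreviation xy_word :: "nat list \<Rightarrow> (nat + nat) list" where
  "xy_word w \<equiv> concat (map (\<lambda>i. [Inl i, Inr i]) w)"

lemma splits_xy_word: "splits h1 h2 (xy_word w) =
    (\<Sum>i<length w. h1 (xy_word (take i w)) * h2 (w ! i) (Inr (w ! i) # xy_word (drop (Suc i) w)))"
  by (induction w arbitrary: h1) (simp_all add: splits_Cons sum.lessThan_Suc_shift del: sum.lessThan_Suc)

text \<open>A letter \<open>a\<close> of \<open>w\<close> stands for an \<open>x\<close> followed by
  a \<open>y\<close>, both with index \<open>a\<close>. If the open block ends at this
  \<open>x\<close>, the \<open>y\<close> joins the seed \<open>s\<close>; if it continues, the
  \<open>y\<close> starts the \<open>y\<close>-word of the gap, whence the weight
  \<open>g (a # u)\<close>. These are the two kinds of terms in \<open>nc_rec\<close>.\<close>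

lemma open_block_xy_word:
  assumes "k [] = 1"
  shows "open_block k g s (p @ [a]) (Inr a # xy_word w) = nc_rec k g (\<lambda>u. k (p @ u)) (\<lambda>u. g (s @ u)) (a # w)"
proof (induction w arbitrary: s p a rule: length_induct)
  case (1 w)
  have mixed_moment: "mixed_moment k g s (xy_word v) = nc_rec k g k (\<lambda>u. g (s @ u)) v" if "length v \<le> length w" for s v
  proof (cases v)
    case (Cons b t)
    then show ?thesis using 1[rule_format, of t s "[]" b] that by simp
  qed (simp add: assms)
  have "splits (mixed_moment k g []) (\<lambda>x. open_block k g s (p @ [a, x])) (Inr a # xy_word w) =
      lconv (nc_rec k g k (\<lambda>u. g (a # u))) (nc_rec k g (\<lambda>u. k (p @ a # u)) (\<lambda>u. g (s @ u))) w"
    unfolding splits_Cons splits_xy_word lconv_def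
  proof (simp, rule sum.cong)
    fix i assume "i \<in> {..<length w}"
    then have i: "i < length w" by simp
    then have "open_block k g s ((p @ [a]) @ [w ! i]) (Inr (w ! i) # xy_word (drop (Suc i) w)) =
        nc_rec k g (\<lambda>u. k ((p @ [a]) @ u)) (\<lambda>u. g (s @ u)) (w ! i # drop (Suc i) w)"
      by (intro 1[rule_format]) simp
    then show "mixed_moment k g [a] (xy_word (take i w)) *
        open_block k g s (p @ [a, w ! i]) (Inr (w ! i) # xy_word (drop (Suc i) w)) =
      nc_rec k g k (\<lambda>u. g (a # u)) (take i w) * nc_rec k g (\<lambda>u. k (p @ a # u)) (\<lambda>u. g (s @ u)) (drop i w)"
      using i mixed_moment[of "take i w" "[a]"] by (simp add: drop_eq_Cons)
  qed simp
  then show ?case using mixed_moment[of w "s @ [a]"] by (simp add: open_block_splits[of k g s] nc_rec_Cons)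
qed

lemma mixed_moment_xy_word:
  assumes "k [] = 1"
  shows "mixed_moment k g [] (xy_word w) = nc_rec k g k g w"
  using open_block_xy_word[where k=k, OF assms, of g "[]" "[]"] assms by (cases w) simp_all

text \<open>The boxed convolution of \<open>R_transform s f\<close> with \<open>zeta s\<close> is
  \<open>f\<close>. On \<open>x\<close>-words this is the moment-cumulant formula, so
  \<open>mixed_moment\<close> has the moments \<open>f\<close> there, and freeness fixes its values
  on all other words.\<close>

theorem free_mult_conv_eq_boxed_conv:
  assumes f: "f \<in> gplus s"
  shows "free_mult_conv s f g = boxed_conv s (R_transform s f) g"
proof
  fix w
  show "free_mult_conv s f g w = boxed_conv s (R_transform s f) g w"
  proof (cases "w \<in> words s")
    case True
    let ?k = "with_one (R_transform s f)" and ?g = "with_one g"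
    have "mixed_moment ?k ?g [] (map Inl v) = f v" if v: "v \<noteq> []" "set v \<subseteq> {1..s}" for v
    proof -
      have vw: "v \<in> words s" using v by (simp add: words_iff)
      have "f v = conv_rec (R_transform s f) (zeta s) v"
        using R_transform_boxed_zeta[OF f] boxed_conv_eq_nc_rec[OF vw, of "R_transform s f" "zeta s"] by simp
      also have "\<dots> = nc_rec ?k (\<lambda>_. 1) ?k (\<lambda>_. 1) v"
        using v by (intro nc_rec_cong[where S="{1..s}"]) (auto simp: with_one_def zeta_def words_iff)
      finally show ?thesis by (simp add: mixed_moment_x_word)
    qed
    then have "free_product_functional f g (xy_word w) = mixed_moment ?k ?g [] (xy_word w)"
      using True by (intro free_product_functional_eq_mixed_moment[where S="{1..s}"]) (auto simp: words_iff)
    then show ?thesis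
      using True by (simp add: free_mult_conv_def mixed_moment_xy_word boxed_conv_eq_nc_rec)
  qed (simp add: free_mult_conv_def boxed_conv_outside)
qed

section \<open>Transfer of the group structure along the R-transform\<close>

lemma free_mult_group_simps [simp]:
  "carrier (free_mult_group s) = gplus s" "mult (free_mult_group s) = free_mult_conv s"
  "one (free_mult_group s) = zeta s"
  by (simp_all add: free_mult_group_def)

lemma R_transform_zeta: "R_transform s (zeta s) = boxed_unit s"
  by (simp add: R_transform_def zeta_moeb)

lemma R_transform_mult:
  assumes "f \<in> gplus s" "g \<in> gplus s"
  shows "R_transform s (free_mult_conv s f g) = boxed_conv s (R_transform s f) (R_transform s g)"
  unfolding free_mult_conv_eq_boxed_conv[OF assms(1)]
  using assms by (simp add: R_transform_def[of s g] R_transform_def[of s "boxed_conv s _ _"] boxed_conv_assoc)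

lemma free_mult_conv_closed: "f \<in> gplus s \<Longrightarrow> g \<in> gplus s \<Longrightarrow> free_mult_conv s f g \<in> gplus s"
  by (simp add: free_mult_conv_eq_boxed_conv boxed_conv_closed R_transform_gplus)

text \<open>Both bracketings of a triple product are the boxed product of \<open>R x\<close>,
  \<open>R y\<close> and \<open>z\<close>. A left inverse is the preimage under \<open>R\<close> of
  a boxed inverse.\<close>

lemma group_free_mult_group: "group (free_mult_group s :: 'k::field_char_0 family monoid)"
proof (rule groupI)
  let ?G = "free_mult_group s :: 'k family monoid" and ?B = "boxed_group s :: 'k family monoid"
  interpret B: group ?B by (rule group_boxed_group)
  show "x \<otimes>\<^bsub>?G\<^esub> y \<otimes>\<^bsub>?G\<^esub> z = x \<otimes>\<^bsub>?G\<^esub> (y \<otimes>\<^bsub>?G\<^esub> z)"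
    if "x \<in> carrier ?G" "y \<in> carrier ?G" "z \<in> carrier ?G" for x y z
    using that
    by (simp add: free_mult_conv_closed free_mult_conv_eq_boxed_conv[of "free_mult_conv s x y"]
        R_transform_mult) (simp add: free_mult_conv_eq_boxed_conv boxed_conv_assoc R_transform_gplus)
  show "\<one>\<^bsub>?G\<^esub> \<otimes>\<^bsub>?G\<^esub> x = x" if "x \<in> carrier ?G" for x
    using that by (simp add: free_mult_conv_eq_boxed_conv zeta_gplus R_transform_zeta boxed_unit_left)
  fix g assume "g \<in> carrier ?G"
  then have g: "g \<in> gplus s" by simp
  have inv: "inv\<^bsub>?B\<^esub> (R_transform s g) \<in> gplus s"
    using B.inv_closed[of "R_transform s g"] R_transform_gplus[OF g] by simp
  then obtain h where h: "h \<in> gplus s" "R_transform s h = inv\<^bsub>?B\<^esub> (R_transform s g)"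
    using bij_R_transform[of s, where 'k='k] unfolding bij_betw_def by (metis imageE)
  have "R_transform s (free_mult_conv s h g) = R_transform s (zeta s)"
    using B.l_inv[of "R_transform s g"] by (simp add: R_transform_mult h g R_transform_zeta R_transform_gplus)
  then have "free_mult_conv s h g = zeta s"
    using bij_R_transform[of s, where 'k='k] h(1) g unfolding bij_betw_def
    by (meson inj_onD free_mult_conv_closed zeta_gplus)
  then show "\<exists>h\<in>carrier ?G. h \<otimes>\<^bsub>?G\<^esub> g = \<one>\<^bsub>?G\<^esub>" using h(1) by auto
qed (simp_all add: free_mult_conv_closed zeta_gplus)

lemma R_transform_iso: "R_transform s \<in> iso (free_mult_group s) (boxed_group s)"
  by (auto simp: iso_def hom_def R_transform_gplus R_transform_mult bij_R_transform)


section \<open>Polynomial maps and exponential curves\<close>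

text \<open>Polynomial functions of infinitely many coordinates are handled through their values on
  polynomial curves, so that the chain rule for compositions is immediate.\<close>

definition has_diff :: "(('i \<Rightarrow> 'k::field_char_0) \<Rightarrow> 'k) \<Rightarrow> (('i \<Rightarrow> 'k) \<Rightarrow> ('i \<Rightarrow> 'k) \<Rightarrow> 'k) \<Rightarrow> bool" where
  "has_diff F D \<longleftrightarrow>
     (\<forall>c. \<exists>q. \<forall>t. poly q t = F (\<lambda>v. poly (c v) t) \<and>
        poly (pderiv q) t = D (\<lambda>v. poly (c v) t) (\<lambda>v. poly (pderiv (c v)) t)) \<and>
     (\<forall>x a \<xi> \<eta>. D x (\<lambda>v. a * \<xi> v + \<eta> v) = a * D x \<xi> + D x \<eta>) \<and>
     (\<exists>S. finite S \<and> (\<forall>x \<xi> \<eta>. (\<forall>v\<in>S. \<xi> v = \<eta> v) \<longrightarrow> D x \<xi> = D x \<eta>))"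

lemma has_diff_curve:
  assumes "has_diff F D"
  obtains q where "\<And>t. poly q t = F (\<lambda>v. poly (c v) t)"
    "\<And>t. poly (pderiv q) t = D (\<lambda>v. poly (c v) t) (\<lambda>v. poly (pderiv (c v)) t)"
  using assms unfolding has_diff_def by metis

lemma has_diff_linear: "has_diff F D \<Longrightarrow> D x (\<lambda>v. a * \<xi> v + \<eta> v) = a * D x \<xi> + D x \<eta>"
  unfolding has_diff_def by blast

lemma has_diff_zero:
  assumes "has_diff F D" shows "D x (\<lambda>_. 0) = 0"
  using has_diff_linear[OF assms, of x "-1" "\<lambda>_. 0" "\<lambda>_. 0"] by simp

lemma has_diff_support:
  assumes "has_diff F D"
  obtains S where "finite S" "\<And>x \<xi> \<eta>. (\<And>v. v \<in> S \<Longrightarrow> \<xi> v = \<eta> v) \<Longrightarrow> D x \<xi> = D x \<eta>"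
  using assms unfolding has_diff_def by metis

lemma has_diff_sum_basis:
  assumes "has_diff F D" "finite S" "\<And>x \<xi> \<eta>. (\<And>v. v \<in> S \<Longrightarrow> \<xi> v = \<eta> v) \<Longrightarrow> D x \<xi> = D x \<eta>"
  shows "D x \<xi> = (\<Sum>v\<in>S. \<xi> v * D x (\<lambda>u. if u = v then 1 else 0))"
proof -
  have "D x (\<lambda>u. if u \<in> T then \<xi> u else 0) = (\<Sum>v\<in>T. \<xi> v * D x (\<lambda>u. if u = v then 1 else 0))"
    if "finite T" for T
    using that
  proof (induction T)
    case (insert a T)
    have "(\<lambda>u. if u \<in> insert a T then \<xi> u else 0) =
        (\<lambda>u. \<xi> a * (if u = a then 1 else 0) + (if u \<in> T then \<xi> u else 0))"
      using insert.hyps by (auto simp: fun_eq_iff)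
    then show ?case using insert by (simp add: has_diff_linear[OF assms(1)])
  qed (simp add: has_diff_zero[OF assms(1)])
  from this[OF assms(2)] show ?thesis
    using assms(3)[of \<xi> "\<lambda>u. if u \<in> S then \<xi> u else 0" x] by simp
qed

lemma has_diff_const: "has_diff (\<lambda>_. a) (\<lambda>_ _. 0)"
  unfolding has_diff_def by (auto intro!: exI[of _ "[:a:]"])

lemma has_diff_coord: "has_diff (\<lambda>x. x v) (\<lambda>_ \<xi>. \<xi> v)"
  unfolding has_diff_def by (auto intro!: exI[of _ "{v}"])

lemma has_diff_add:
  assumes "has_diff F D" "has_diff F' D'"
  shows "has_diff (\<lambda>x. F x + F' x) (\<lambda>x \<xi>. D x \<xi> + D' x \<xi>)"
  unfolding has_diff_def
proof (intro conjI allI)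
  fix c
  obtain q where q: "\<And>t. poly q t = F (\<lambda>v. poly (c v) t)"
    "\<And>t. poly (pderiv q) t = D (\<lambda>v. poly (c v) t) (\<lambda>v. poly (pderiv (c v)) t)"
    using has_diff_curve[OF assms(1), of c] by blast
  obtain q' where q': "\<And>t. poly q' t = F' (\<lambda>v. poly (c v) t)"
    "\<And>t. poly (pderiv q') t = D' (\<lambda>v. poly (c v) t) (\<lambda>v. poly (pderiv (c v)) t)"
    using has_diff_curve[OF assms(2), of c] by blast
  show "\<exists>q. \<forall>t. poly q t = F (\<lambda>v. poly (c v) t) + F' (\<lambda>v. poly (c v) t) \<and>
      poly (pderiv q) t = D (\<lambda>v. poly (c v) t) (\<lambda>v. poly (pderiv (c v)) t) +
        D' (\<lambda>v. poly (c v) t) (\<lambda>v. poly (pderiv (c v)) t)"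
    by (intro exI[of _ "q + q'"]) (simp add: pderiv_add q q')
next
  obtain S where S: "finite S" "\<And>x \<xi> \<eta>. (\<And>v. v \<in> S \<Longrightarrow> \<xi> v = \<eta> v) \<Longrightarrow> D x \<xi> = D x \<eta>"
    using has_diff_support[OF assms(1)] by blast
  obtain S' where S': "finite S'" "\<And>x \<xi> \<eta>. (\<And>v. v \<in> S' \<Longrightarrow> \<xi> v = \<eta> v) \<Longrightarrow> D' x \<xi> = D' x \<eta>"
    using has_diff_support[OF assms(2)] by blast
  show "\<exists>S. finite S \<and> (\<forall>x \<xi> \<eta>. (\<forall>v\<in>S. \<xi> v = \<eta> v) \<longrightarrow> D x \<xi> + D' x \<xi> = D x \<eta> + D' x \<eta>)"
    by (intro exI[of _ "S \<union> S'"] conjI allI impI finite_UnI S(1) S'(1) arg_cong2[where f="(+)"] S(2) S'(2)) auto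
qed (simp only: has_diff_linear[OF assms(1)] has_diff_linear[OF assms(2)], simp add: algebra_simps)

lemma has_diff_mult:
  assumes "has_diff F D" "has_diff F' D'"
  shows "has_diff (\<lambda>x. F x * F' x) (\<lambda>x \<xi>. D x \<xi> * F' x + F x * D' x \<xi>)"
  unfolding has_diff_def
proof (intro conjI allI)
  fix c
  obtain q where q: "\<And>t. poly q t = F (\<lambda>v. poly (c v) t)"
    "\<And>t. poly (pderiv q) t = D (\<lambda>v. poly (c v) t) (\<lambda>v. poly (pderiv (c v)) t)"
    using has_diff_curve[OF assms(1), of c] by blast
  obtain q' where q': "\<And>t. poly q' t = F' (\<lambda>v. poly (c v) t)"
    "\<And>t. poly (pderiv q') t = D' (\<lambda>v. poly (c v) t) (\<lambda>v. poly (pderiv (c v)) t)"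
    using has_diff_curve[OF assms(2), of c] by blast
  show "\<exists>q. \<forall>t. poly q t = F (\<lambda>v. poly (c v) t) * F' (\<lambda>v. poly (c v) t) \<and>
      poly (pderiv q) t = D (\<lambda>v. poly (c v) t) (\<lambda>v. poly (pderiv (c v)) t) * F' (\<lambda>v. poly (c v) t) +
        F (\<lambda>v. poly (c v) t) * D' (\<lambda>v. poly (c v) t) (\<lambda>v. poly (pderiv (c v)) t)"
    by (intro exI[of _ "q * q'"]) (simp add: pderiv_mult q q')
next
  obtain S where S: "finite S" "\<And>x \<xi> \<eta>. (\<And>v. v \<in> S \<Longrightarrow> \<xi> v = \<eta> v) \<Longrightarrow> D x \<xi> = D x \<eta>"
    using has_diff_support[OF assms(1)] by blast
  obtain S' where S': "finite S'" "\<And>x \<xi> \<eta>. (\<And>v. v \<in> S' \<Longrightarrow> \<xi> v = \<eta> v) \<Longrightarrow> D' x \<xi> = D' x \<eta>"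
    using has_diff_support[OF assms(2)] by blast
  show "\<exists>S. finite S \<and> (\<forall>x \<xi> \<eta>. (\<forall>v\<in>S. \<xi> v = \<eta> v) \<longrightarrow>
      D x \<xi> * F' x + F x * D' x \<xi> = D x \<eta> * F' x + F x * D' x \<eta>)"
    by (intro exI[of _ "S \<union> S'"] conjI allI impI finite_UnI S(1) S'(1)
        arg_cong2[where f="(+)"] arg_cong2[where f="(*)"] S(2) S'(2) refl) auto
qed (simp only: has_diff_linear[OF assms(1)] has_diff_linear[OF assms(2)], simp add: algebra_simps)

lemma has_diff_sum:
  assumes "\<And>i. i \<in> A \<Longrightarrow> has_diff (F i) (D i)"
  shows "has_diff (\<lambda>x. \<Sum>i\<in>A. F i x) (\<lambda>x \<xi>. \<Sum>i\<in>A. D i x \<xi>)"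
  using assms
  by (induction A rule: infinite_finite_induct) (auto intro: has_diff_const has_diff_add)

lemma has_diff_scale: "has_diff F D \<Longrightarrow> has_diff (\<lambda>x. a * F x) (\<lambda>x \<xi>. a * D x \<xi>)"
  using has_diff_mult[OF has_diff_const[of a]] by fastforce

section \<open>Polynomial functions and Jacobians\<close>

definition polynomial_fun :: "(('i \<Rightarrow> 'k::field_char_0) \<Rightarrow> 'k) \<Rightarrow> bool" where
  "polynomial_fun F \<longleftrightarrow> (\<exists>D. has_diff F D)"

lemma polynomial_fun_intros:
  shows polynomial_fun_const: "polynomial_fun (\<lambda>_. a)"
    and polynomial_fun_coord: "polynomial_fun (\<lambda>x. x v)"
    and polynomial_fun_add: "polynomial_fun F \<Longrightarrow> polynomial_fun F' \<Longrightarrow> polynomial_fun (\<lambda>x. F x + F' x)"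
    and polynomial_fun_mult: "polynomial_fun F \<Longrightarrow> polynomial_fun F' \<Longrightarrow> polynomial_fun (\<lambda>x. F x * F' x)"
  unfolding polynomial_fun_def
  by ((rule exI, rule has_diff_const has_diff_coord) | (elim exE, rule exI, rule has_diff_add has_diff_mult; assumption))+

lemma polynomial_fun_sum: "(\<And>i. i \<in> A \<Longrightarrow> polynomial_fun (F i)) \<Longrightarrow> polynomial_fun (\<lambda>x. \<Sum>i\<in>A. F i x)"
  by (induction A rule: infinite_finite_induct) (auto intro: polynomial_fun_intros)

lemma polynomial_fun_prod: "(\<And>i. i \<in> A \<Longrightarrow> polynomial_fun (F i)) \<Longrightarrow> polynomial_fun (\<lambda>x. \<Prod>i\<in>A. F i x)"
  by (induction A rule: infinite_finite_induct) (auto intro: polynomial_fun_intros)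

lemma polynomial_fun_curve:
  assumes "polynomial_fun F"
  shows "\<exists>q. \<forall>t. poly q t = F (\<lambda>v. poly (c v) t)"
proof -
  obtain D where "has_diff F D" using assms unfolding polynomial_fun_def by blast
  then obtain q where "\<And>t. poly q t = F (\<lambda>v. poly (c v) t)" using has_diff_curve[of F D c] by blast
  then show ?thesis by blast
qed

lemma poly_ext: "(\<And>t::'k::field_char_0. poly p t = poly q t) \<Longrightarrow> p = q"
  by (metis ext poly_eq_poly_eq_iff)

lemma jacobian_has_diff:
  assumes "has_diff (\<lambda>x. \<Phi> x w) D"
  shows "jacobian \<Phi> a w v = D a (\<lambda>u. if u = v then 1 else 0)"
proof -
  \<comment> \<open>This curve moves only the coordinate \<open>v\<close>; along it
    \<open>\<Phi>\<close> is the polynomial in one variable that \<open>jacobian\<close>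
    differentiates.\<close>
  define c where "c u = (if u = v then [:0, 1:] else [:a u:])" for u
  have at: "(\<lambda>u. poly (c u) t) = a(v := t)" for t
    by (auto simp: c_def)
  have at': "(\<lambda>u. poly (pderiv (c u)) t) = (\<lambda>u. if u = v then 1 else 0)" for t
    by (auto simp: c_def pderiv_pCons)
  obtain q where q: "\<And>t. poly q t = \<Phi> (a(v := t)) w"
    "\<And>t. poly (pderiv q) t = D (a(v := t)) (\<lambda>u. if u = v then 1 else 0)"
    using has_diff_curve[OF assms, of c] unfolding at at' by blast
  have "(THE p. \<forall>t. poly p t = \<Phi> (a(v := t)) w) = q"
    using q(1) by (intro the_equality) (auto intro: poly_ext)
  then show ?thesis by (simp add: jacobian_def poly_fun_deriv_def q(2))
qed

text \<open>Outside a finite set the basis vectors have derivative 0, so the row of \<open>w\<close>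
  is finite, and the sum in \<open>mat_vec\<close> is the expansion of the linear map
  \<open>D a\<close>.\<close>

lemma mat_vec_jacobian:
  assumes D: "has_diff (\<lambda>x. \<Phi> x w) D" and w: "w \<in> long_words s" and \<xi>: "\<xi> \<in> coords s"
  shows "mat_vec s (jacobian \<Phi> a) \<xi> w = D a \<xi>"
proof -
  let ?e = "\<lambda>v u. if u = v then 1 else (0 :: 'a)"
  obtain S where S: "finite S" "\<And>x \<xi> \<eta>. (\<And>v. v \<in> S \<Longrightarrow> \<xi> v = \<eta> v) \<Longrightarrow> D x \<xi> = D x \<eta>"
    using has_diff_support[OF D] by blast
  have zero: "D a (?e v) = 0" if "v \<notin> S" for v
  proof -
    have "D a (?e v) = D a (\<lambda>_. 0)" using that by (intro S(2)) auto
    then show ?thesis by (simp add: has_diff_zero[OF D])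
  qed
  have "D a \<xi> = (\<Sum>v\<in>S. \<xi> v * D a (?e v))" by (rule has_diff_sum_basis[OF D S])
  also have "\<dots> = (\<Sum>v | v \<in> long_words s \<and> D a (?e v) \<noteq> 0. D a (?e v) * \<xi> v)"
    using S(1) zero \<xi> by (intro sum.mono_neutral_cong_right) (auto simp: coords_def)
  finally show ?thesis
    using w by (simp add: mat_vec_def jacobian_has_diff[where \<Phi>=\<Phi> and w=w and D=D, OF D])
qed

lemma mat_vec_coords: "mat_vec s A x \<in> coords s"
  by (simp add: coords_def mat_vec_def)

text \<open>The two functions are compared only along lines through 0, where just their difference
  has to be affine. This suits unipotent maps, whose dependence on shorter words cancels in
  differences.\<close>

lemma has_diff_lines:
  assumes "has_diff F D" "has_diff F' D'"
    and "\<And>t. F (\<lambda>v. t * \<xi> v) - F' (\<lambda>v. t * \<xi>' v) = a + t * b"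
  shows "D (\<lambda>_. 0) \<xi> - D' (\<lambda>_. 0) \<xi>' = b"
proof -
  obtain q where q: "\<And>t. poly q t = F (\<lambda>v. poly [:0, \<xi> v:] t)"
    "\<And>t. poly (pderiv q) t = D (\<lambda>v. poly [:0, \<xi> v:] t) (\<lambda>v. poly (pderiv [:0, \<xi> v:]) t)"
    using has_diff_curve[OF assms(1), of "\<lambda>v. [:0, \<xi> v:]"] by blast
  obtain q' where q': "\<And>t. poly q' t = F' (\<lambda>v. poly [:0, \<xi>' v:] t)"
    "\<And>t. poly (pderiv q') t = D' (\<lambda>v. poly [:0, \<xi>' v:] t) (\<lambda>v. poly (pderiv [:0, \<xi>' v:]) t)"
    using has_diff_curve[OF assms(2), of "\<lambda>v. [:0, \<xi>' v:]"] by blast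
  have "q - q' = [:a, b:]" by (rule poly_ext) (simp add: q(1) q'(1) assms(3))
  then have "poly (pderiv q - pderiv q') 0 = b"
    by (simp add: pderiv_diff[symmetric] pderiv_pCons)
  then show ?thesis using q(2)[of 0] q'(2)[of 0] by (simp add: pderiv_pCons)
qed

section \<open>Triangular systems of differential equations\<close>

lemma poly_antiderivative: "\<exists>q. pderiv q = (p :: 'k::field_char_0 poly) \<and> poly q 0 = 0"
proof -
  define q where "q = (\<Sum>i\<le>degree p. monom (coeff p i / of_nat (Suc i)) (Suc i))"
  have pderiv_sum: "pderiv (\<Sum>i\<in>A. f i) = (\<Sum>i\<in>A. pderiv (f i))" for f :: "nat \<Rightarrow> 'k poly" and A
    by (induction A rule: infinite_finite_induct) (simp_all add: pderiv_add)
  have "pderiv q = (\<Sum>i\<le>degree p. monom (coeff p i) i)"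
    unfolding q_def by (simp add: pderiv_sum pderiv_monom del: of_nat_Suc)
  also have "\<dots> = p" by (simp add: poly_as_sum_of_monoms)
  finally show ?thesis by (auto simp: q_def poly_sum poly_monom)
qed

lemma pderiv_unique:
  assumes "\<And>t::'k::field_char_0. poly (pderiv p) t = poly (pderiv q) t" "poly p 0 = poly q 0"
  shows "p = q"
proof -
  have "pderiv (p - q) = 0" using poly_ext[OF assms(1)] by (simp add: pderiv_diff)
  then obtain a where "p - q = [:a:]" by (metis pderiv_iszero)
  moreover from this have "a = 0" using assms(2) by (metis poly_diff poly_pCons mult_zero_left add_0_right right_minus_eq)
  ultimately show ?thesis by simp
qed

definition coord_curve :: "nat \<Rightarrow> (nat list \<Rightarrow> 'k::field_char_0 poly) \<Rightarrow> bool" where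
  "coord_curve s c \<longleftrightarrow> (\<forall>w. w \<notin> long_words s \<longrightarrow> c w = 0)"

lemma coord_curveD: "coord_curve s c \<Longrightarrow> (\<lambda>v. poly (c v) t) \<in> coords s"
  by (simp add: coord_curve_def coords_def)

text \<open>The right-hand side at \<open>w\<close> involves only shorter words, so each entry is
  found by integrating a polynomial that is already known; this is where characteristic 0 enters.
  Uniqueness holds because derivative and initial value determine a polynomial.\<close>

lemma triangular_ode:
  fixes vf :: "'k::field_char_0 family \<Rightarrow> 'k family"
  assumes vf: "\<And>x y w. x \<in> coords s \<Longrightarrow> y \<in> coords s \<Longrightarrow> w \<in> long_words s \<Longrightarrow>
      (\<And>v. v \<in> long_words s \<Longrightarrow> length v < length w \<Longrightarrow> x v = y v) \<Longrightarrow> vf x w = vf y w"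
    and poly: "\<And>c w. coord_curve s c \<Longrightarrow> w \<in> long_words s \<Longrightarrow> \<exists>q. \<forall>t. poly q t = vf (\<lambda>v. poly (c v) t) w"
  shows "\<exists>!\<gamma>. coord_curve s \<gamma> \<and> (\<forall>w\<in>long_words s. poly (\<gamma> w) 0 = 0) \<and>
    (\<forall>w\<in>long_words s. \<forall>t. poly (pderiv (\<gamma> w)) t = vf (\<lambda>v. poly (\<gamma> v) t) w)"
proof (rule ex_ex1I)
  define \<Gamma> where "\<Gamma> = rec_nat (\<lambda>_. 0) (\<lambda>n c w. if w \<in> long_words s \<and> length w = Suc n
    then SOME q. poly q 0 = 0 \<and> (\<forall>t. poly (pderiv q) t = vf (\<lambda>v. poly (c v) t) w) else c w)"
  have \<Gamma>0: "\<Gamma> 0 = (\<lambda>_. 0)" and \<Gamma>S: "\<Gamma> (Suc n) = (\<lambda>w. if w \<in> long_words s \<and> length w = Suc n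
    then SOME q. poly q 0 = 0 \<and> (\<forall>t. poly (pderiv q) t = vf (\<lambda>v. poly (\<Gamma> n v) t) w) else \<Gamma> n w)" for n
    unfolding \<Gamma>_def by simp_all
  have cc: "coord_curve s (\<Gamma> n)" for n
    by (induction n) (auto simp: \<Gamma>0 \<Gamma>S coord_curve_def)
  have stab: "\<Gamma> (n + k) w = \<Gamma> n w" if "length w \<le> n" for n k w
    using that by (induction k) (auto simp: \<Gamma>S)
  define \<gamma> where "\<gamma> w = \<Gamma> (length w) w" for w
  have \<gamma>\<Gamma>: "\<gamma> w = \<Gamma> n w" if "length w \<le> n" for w n
    using stab[of w "length w" "n - length w"] that by (simp add: \<gamma>_def)
  have \<gamma>c: "coord_curve s \<gamma>" using cc by (auto simp: coord_curve_def \<gamma>_def)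
  have main: "poly (\<gamma> w) 0 = 0 \<and> (\<forall>t. poly (pderiv (\<gamma> w)) t = vf (\<lambda>v. poly (\<gamma> v) t) w)"
    if w: "w \<in> long_words s" for w
  proof -
    obtain n where n: "length w = Suc n" using w by (cases "length w") (auto simp: long_words_iff)
    have eq: "vf (\<lambda>v. poly (\<Gamma> n v) t) w = vf (\<lambda>v. poly (\<gamma> v) t) w" for t
      using n by (intro vf coord_curveD cc \<gamma>c w) (simp add: \<gamma>\<Gamma>[of _ n])
    obtain p where p: "\<And>t. poly p t = vf (\<lambda>v. poly (\<Gamma> n v) t) w" using poly[OF cc w] by metis
    obtain q where q: "pderiv q = p" "poly q 0 = 0" using poly_antiderivative by metis
    have "\<exists>q. poly q 0 = 0 \<and> (\<forall>t. poly (pderiv q) t = vf (\<lambda>v. poly (\<Gamma> n v) t) w)"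
      using p q by (intro exI[of _ q]) simp
    from someI_ex[OF this] show ?thesis
      using w n by (simp add: \<gamma>_def \<Gamma>S eq)
  qed
  show "\<exists>\<gamma>. coord_curve s \<gamma> \<and> (\<forall>w\<in>long_words s. poly (\<gamma> w) 0 = 0) \<and>
    (\<forall>w\<in>long_words s. \<forall>t. poly (pderiv (\<gamma> w)) t = vf (\<lambda>v. poly (\<gamma> v) t) w)"
    using \<gamma>c main by blast
next
  fix \<gamma> \<delta>
  assume \<gamma>: "coord_curve s \<gamma> \<and> (\<forall>w\<in>long_words s. poly (\<gamma> w) 0 = 0) \<and>
      (\<forall>w\<in>long_words s. \<forall>t. poly (pderiv (\<gamma> w)) t = vf (\<lambda>v. poly (\<gamma> v) t) w)"
    and \<delta>: "coord_curve s \<delta> \<and> (\<forall>w\<in>long_words s. poly (\<delta> w) 0 = 0) \<and>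
      (\<forall>w\<in>long_words s. \<forall>t. poly (pderiv (\<delta> w)) t = vf (\<lambda>v. poly (\<delta> v) t) w)"
  show "\<gamma> = \<delta>"
  proof
    fix w show "\<gamma> w = \<delta> w"
    proof (induction w rule: length_induct)
      case (1 w)
      show ?case
      proof (cases "w \<in> long_words s")
        case True
        have "vf (\<lambda>v. poly (\<gamma> v) t) w = vf (\<lambda>v. poly (\<delta> v) t) w" for t
          using 1 \<gamma> \<delta> True by (intro vf coord_curveD) auto
        then show ?thesis using \<gamma> \<delta> True by (intro pderiv_unique) simp_all
      qed (use \<gamma> \<delta> in \<open>simp add: coord_curve_def\<close>)
    qed
  qed
qed

text \<open>The requirements of the exponential map: \<open>D x w\<close> is the derivative of left
  translation by \<open>x\<close>, unipotency in each argument makes the left-invariant fields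
  triangular, and \<open>polynomial\<close> keeps their integral curves polynomial.\<close>

locale unipotent_law =
  fixes s :: nat and G :: "'k::field_char_0 family monoid"
    and D :: "'k family \<Rightarrow> nat list \<Rightarrow> 'k family \<Rightarrow> 'k family \<Rightarrow> 'k"
  assumes closed: "x \<in> coords s \<Longrightarrow> y \<in> coords s \<Longrightarrow> coord_law G x y \<in> coords s"
    and right_zero: "x \<in> coords s \<Longrightarrow> coord_law G x (\<lambda>_. 0) = x"
    and unipotent_right: "x \<in> coords s \<Longrightarrow> unipotent s (coord_law G x)"
    and unipotent_left: "y \<in> coords s \<Longrightarrow> unipotent s (\<lambda>x. coord_law G x y)"
    and diff: "x \<in> coords s \<Longrightarrow> has_diff (\<lambda>y. coord_law G x y w) (D x w)"
    and polynomial: "coord_curve s c \<Longrightarrow> \<exists>q. \<forall>t. poly q t = D (\<lambda>v. poly (c v) t) w (\<lambda>_. 0) \<xi>"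
begin

definition field :: "'k family \<Rightarrow> 'k family \<Rightarrow> 'k family" where
  "field \<xi> x = mat_vec s (jacobian (coord_law G x) (\<lambda>_. 0)) \<xi>"

lemma zero_coords: "(\<lambda>_. 0) \<in> coords s"
  by (simp add: coords_def)

lemma scale_coords: "\<xi> \<in> coords s \<Longrightarrow> (\<lambda>v. t * \<xi> v) \<in> coords s"
  by (simp add: coords_def)

lemma field_eq:
  assumes "x \<in> coords s" "\<xi> \<in> coords s" "w \<in> long_words s"
  shows "field \<xi> x w = D x w (\<lambda>_. 0) \<xi>"
  unfolding field_def using assms by (intro mat_vec_jacobian[where D="D x w"] diff)

lemma field_coords: "field \<xi> x \<in> coords s"
  by (simp add: field_def mat_vec_coords)

lemma field_diff:
  assumes "x \<in> coords s" "y \<in> coords s" "\<xi> \<in> coords s" "\<eta> \<in> coords s" "w \<in> long_words s"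
    and "\<And>v. v \<in> long_words s \<Longrightarrow> length v < length w \<Longrightarrow> x v = y v"
    and "\<And>v. v \<in> long_words s \<Longrightarrow> length v < length w \<Longrightarrow> \<xi> v = \<eta> v"
  shows "field \<xi> x w - field \<eta> y w = \<xi> w - \<eta> w"
proof -
  \<comment> \<open>First \<xi> is exchanged for \<eta> in the right argument, then \<open>x\<close>
    for \<open>y\<close> in the left one. The contributions of shorter words cancel each time, which
    leaves an affine function of \<open>t\<close>.\<close>
  have "coord_law G x (\<lambda>v. t * \<xi> v) w - coord_law G y (\<lambda>v. t * \<eta> v) w = (x w - y w) + t * (\<xi> w - \<eta> w)" for t
    using unipotentD[OF unipotent_right[OF assms(1)] scale_coords[OF assms(3)] scale_coords[OF assms(4)] assms(5), of t t]
      unipotentD[OF unipotent_left[OF scale_coords[OF assms(4)]] assms(1,2,5,6), of t] assms(7)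
    by (simp add: algebra_simps)
  then have "D x w (\<lambda>_. 0) \<xi> - D y w (\<lambda>_. 0) \<eta> = \<xi> w - \<eta> w"
    by (rule has_diff_lines[OF diff[OF assms(1)] diff[OF assms(2)]])
  then show ?thesis using assms by (simp add: field_eq)
qed

lemma exp_curve_iff: "exp_curve s G \<xi> \<gamma> \<longleftrightarrow> coord_curve s \<gamma> \<and> (\<forall>w\<in>long_words s. poly (\<gamma> w) 0 = 0) \<and>
    (\<forall>w\<in>long_words s. \<forall>t. poly (pderiv (\<gamma> w)) t = field \<xi> (\<lambda>v. poly (\<gamma> v) t) w)"
  by (simp add: exp_curve_def coord_curve_def field_def)

lemma ex1_exp_curve:
  assumes \<xi>: "\<xi> \<in> coords s"
  shows "\<exists>!\<gamma>. exp_curve s G \<xi> \<gamma>"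
  unfolding exp_curve_iff
proof (rule triangular_ode)
  fix x y :: "'k family" and w assume "x \<in> coords s" "y \<in> coords s" "w \<in> long_words s"
    "\<And>v. v \<in> long_words s \<Longrightarrow> length v < length w \<Longrightarrow> x v = y v"
  then have "field \<xi> x w - field \<xi> y w = \<xi> w - \<xi> w" using \<xi> by (intro field_diff) auto
  then show "field \<xi> x w = field \<xi> y w" by simp
next
  fix c :: "nat list \<Rightarrow> 'k poly" and w assume c: "coord_curve s c" and "w \<in> long_words s"
  then have "field \<xi> (\<lambda>v. poly (c v) t) w = D (\<lambda>v. poly (c v) t) w (\<lambda>_. 0) \<xi>" for t
    using \<xi> coord_curveD by (intro field_eq)
  then show "\<exists>q. \<forall>t. poly q t = field \<xi> (\<lambda>v. poly (c v) t) w" using polynomial[OF c] by simp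
qed

lemma EXP_eq:
  assumes "\<xi> \<in> coords s" "exp_curve s G \<xi> \<gamma>"
  shows "EXP s G \<xi> = (\<lambda>w. poly (\<gamma> w) 1)"
proof -
  have "(THE \<gamma>. exp_curve s G \<xi> \<gamma>) = \<gamma>"
    using ex1_exp_curve[OF assms(1)] assms(2) by (intro the_equality) auto
  then show ?thesis by (simp add: EXP_def)
qed

lemma EXP_curve:
  assumes "\<xi> \<in> coords s"
  obtains \<gamma> where "exp_curve s G \<xi> \<gamma>" "EXP s G \<xi> = (\<lambda>w. poly (\<gamma> w) 1)"
  using ex1_exp_curve[OF assms] EXP_eq[OF assms] by blast

lemma EXP_coords: "\<xi> \<in> coords s \<Longrightarrow> EXP s G \<xi> \<in> coords s"
  by (erule EXP_curve) (simp add: exp_curve_iff coord_curveD)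

lemma unipotent_EXP: "unipotent s (EXP s G)"
  unfolding unipotent_def
proof (intro conjI ballI impI funcsetI EXP_coords)
  fix \<xi> \<eta> :: "'k family" and w
  assume \<xi>: "\<xi> \<in> coords s" and \<eta>: "\<eta> \<in> coords s" and w: "w \<in> long_words s"
    and eq: "\<forall>v\<in>long_words s. length v < length w \<longrightarrow> \<xi> v = \<eta> v"
  obtain \<gamma> where \<gamma>: "exp_curve s G \<xi> \<gamma>" "EXP s G \<xi> = (\<lambda>w. poly (\<gamma> w) 1)" using EXP_curve[OF \<xi>] .
  obtain \<delta> where \<delta>: "exp_curve s G \<eta> \<delta>" "EXP s G \<eta> = (\<lambda>w. poly (\<delta> w) 1)" using EXP_curve[OF \<eta>] .
  have cc: "(\<lambda>v. poly (\<gamma> v) t) \<in> coords s" "(\<lambda>v. poly (\<delta> v) t) \<in> coords s" for t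
    using \<gamma>(1) \<delta>(1) by (simp_all add: exp_curve_iff coord_curveD)
  \<comment> \<open>The two fields differ at \<open>u\<close> by the constant
    \<open>\<xi> u - \<eta> u\<close>, hence the curves differ by this multiple of the time.\<close>
  have step: "\<gamma> u = \<delta> u + [:0, \<xi> u - \<eta> u:]"
    if u: "u \<in> long_words s" "length u \<le> length w"
      and IH: "\<And>v. v \<in> long_words s \<Longrightarrow> length v < length u \<Longrightarrow> \<gamma> v = \<delta> v" for u
  proof (rule pderiv_unique)
    show "poly (\<gamma> u) 0 = poly (\<delta> u + [:0, \<xi> u - \<eta> u:]) 0"
      using \<gamma>(1) \<delta>(1) u by (simp add: exp_curve_iff)
    fix t
    have "field \<xi> (\<lambda>v. poly (\<gamma> v) t) u - field \<eta> (\<lambda>v. poly (\<delta> v) t) u = \<xi> u - \<eta> u"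
      using eq u IH by (intro field_diff cc \<xi> \<eta>) auto
    then show "poly (pderiv (\<gamma> u)) t = poly (pderiv (\<delta> u + [:0, \<xi> u - \<eta> u:])) t"
      using \<gamma>(1) \<delta>(1) u by (simp add: exp_curve_iff pderiv_add pderiv_pCons algebra_simps)
  qed
  have short: "\<gamma> u = \<delta> u" if "u \<in> long_words s" "length u < length w" for u
    using that
  proof (induction u rule: length_induct)
    case (1 u)
    then have "\<gamma> u = \<delta> u + [:0, \<xi> u - \<eta> u:]" by (intro step) auto
    then show ?case using eq 1 by simp
  qed
  have "\<gamma> w = \<delta> w + [:0, \<xi> w - \<eta> w:]" using w short by (intro step) auto
  then show "EXP s G \<xi> w - EXP s G \<eta> w = \<xi> w - \<eta> w" by (simp add: \<gamma>(2) \<delta>(2))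
qed

lemma bij_EXP: "bij_betw (EXP s G) (coords s) (coords s)"
  by (rule unipotent_bij[OF unipotent_EXP])

lemma LOG_EXP: "\<xi> \<in> coords s \<Longrightarrow> LOG s G (EXP s G \<xi>) = \<xi>"
  unfolding LOG_def using bij_EXP by (intro the_inv_into_f_f) (auto simp: bij_betw_def)

lemma EXP_LOG: "x \<in> coords s \<Longrightarrow> EXP s G (LOG s G x) = x"
  unfolding LOG_def by (rule f_the_inv_into_f_bij_betw[OF bij_EXP])

lemma LOG_coords: "x \<in> coords s \<Longrightarrow> LOG s G x \<in> coords s"
  unfolding LOG_def using bij_betw_the_inv_into[OF bij_EXP] by (rule bij_betwE[THEN bspec])

lemma EXP_BCH:
  assumes "\<xi> \<in> coords s" "\<eta> \<in> coords s"
  shows "EXP s G (BCH_law s G \<xi> \<eta>) = coord_law G (EXP s G \<xi>) (EXP s G \<eta>)"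
  unfolding BCH_law_def using assms by (intro EXP_LOG closed EXP_coords)

lemma BCH_coords: "\<xi> \<in> coords s \<Longrightarrow> \<eta> \<in> coords s \<Longrightarrow> BCH_law s G \<xi> \<eta> \<in> coords s"
  unfolding BCH_law_def by (intro LOG_coords closed EXP_coords)

end

locale law_morphism = dom: unipotent_law s G D + cod: unipotent_law s H D'
  for s :: nat and G H :: "'k::field_char_0 family monoid" and D D' +
  fixes \<Phi> :: "'k family \<Rightarrow> 'k family" and E
  assumes maps: "x \<in> coords s \<Longrightarrow> \<Phi> x \<in> coords s"
    and zero: "\<Phi> (\<lambda>_. 0) = (\<lambda>_. 0)"
    and hom: "x \<in> coords s \<Longrightarrow> y \<in> coords s \<Longrightarrow> \<Phi> (coord_law G x y) = coord_law H (\<Phi> x) (\<Phi> y)"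
    and diff: "has_diff (\<lambda>x. \<Phi> x w) (E w)"
begin

definition d\<Phi> :: "'k family \<Rightarrow> 'k family" where
  "d\<Phi> = mat_vec s (jacobian \<Phi> (\<lambda>_. 0))"

lemma d\<Phi>_coords: "d\<Phi> \<xi> \<in> coords s"
  by (simp add: d\<Phi>_def mat_vec_coords)

lemma d\<Phi>_eq: "w \<in> long_words s \<Longrightarrow> \<xi> \<in> coords s \<Longrightarrow> d\<Phi> \<xi> w = E w (\<lambda>_. 0) \<xi>"
  unfolding d\<Phi>_def by (intro mat_vec_jacobian[where D="E w"] diff)

text \<open>Differentiating \<open>\<Phi> (x \<circ> t \<xi>) = \<Phi> x \<circ> \<Phi> (t \<xi>)\<close> at \<open>t = 0\<close>: the morphism relates the
  left-invariant vector fields.\<close>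

lemma field_related:
  assumes x: "x \<in> coords s" and \<xi>: "\<xi> \<in> coords s" and w: "w \<in> long_words s"
  shows "E w x (dom.field \<xi> x) = cod.field (d\<Phi> \<xi>) (\<Phi> x) w"
proof -
  have line: "(\<lambda>v. t * \<xi> v) \<in> coords s" for t using \<xi> by (rule dom.scale_coords)
  have "\<exists>r. \<forall>t. poly r t = coord_law G x (\<lambda>v. t * \<xi> v) v \<and> poly (pderiv r) 0 = dom.field \<xi> x v" for v
  proof (cases "v \<in> long_words s")
    case True
    obtain r where "\<And>t. poly r t = coord_law G x (\<lambda>u. poly [:0, \<xi> u:] t) v"
      "\<And>t. poly (pderiv r) t = D x v (\<lambda>u. poly [:0, \<xi> u:] t) (\<lambda>u. poly (pderiv [:0, \<xi> u:]) t)"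
      using has_diff_curve[OF dom.diff[OF x, of v], of "\<lambda>v. [:0, \<xi> v:]"] by blast
    then show ?thesis
      by (intro exI[of _ r]) (simp add: pderiv_pCons dom.field_eq[OF x \<xi> True])
  next
    case False
    then show ?thesis
      using dom.closed[OF x line] dom.field_coords[of \<xi> x] by (intro exI[of _ 0]) (simp add: coords_def)
  qed
  then obtain r where r: "\<And>v t. poly (r v) t = coord_law G x (\<lambda>v. t * \<xi> v) v"
    "\<And>v. poly (pderiv (r v)) 0 = dom.field \<xi> x v" by metis
  have "\<exists>p. \<forall>t. poly p t = \<Phi> (\<lambda>v. t * \<xi> v) v \<and> poly (pderiv p) 0 = d\<Phi> \<xi> v" for v
  proof (cases "v \<in> long_words s")
    case True
    obtain p where "\<And>t. poly p t = \<Phi> (\<lambda>u. poly [:0, \<xi> u:] t) v"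
      "\<And>t. poly (pderiv p) t = E v (\<lambda>u. poly [:0, \<xi> u:] t) (\<lambda>u. poly (pderiv [:0, \<xi> u:]) t)"
      using has_diff_curve[OF diff[of v], of "\<lambda>v. [:0, \<xi> v:]"] by blast
    then show ?thesis
      by (intro exI[of _ p]) (simp add: pderiv_pCons d\<Phi>_eq[OF True \<xi>])
  next
    case False
    then show ?thesis
      using maps[OF line] d\<Phi>_coords[of \<xi>] by (intro exI[of _ 0]) (simp add: coords_def)
  qed
  then obtain p where p: "\<And>v t. poly (p v) t = \<Phi> (\<lambda>v. t * \<xi> v) v"
    "\<And>v. poly (pderiv (p v)) 0 = d\<Phi> \<xi> v" by metis
  obtain q where q0: "\<And>t. poly q t = \<Phi> (\<lambda>v. poly (r v) t) w"
    "\<And>t. poly (pderiv q) t = E w (\<lambda>v. poly (r v) t) (\<lambda>v. poly (pderiv (r v)) t)"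
    using has_diff_curve[OF diff[of w], of r] by blast
  have q: "poly q t = \<Phi> (coord_law G x (\<lambda>v. t * \<xi> v)) w" for t
    by (simp only: q0(1) r(1))
  have qd: "poly (pderiv q) 0 = E w x (dom.field \<xi> x)"
    unfolding q0(2) r by (simp add: dom.right_zero[OF x])
  obtain q' where q'0: "\<And>t. poly q' t = coord_law H (\<Phi> x) (\<lambda>v. poly (p v) t) w"
    "\<And>t. poly (pderiv q') t = D' (\<Phi> x) w (\<lambda>v. poly (p v) t) (\<lambda>v. poly (pderiv (p v)) t)"
    using has_diff_curve[OF cod.diff[OF maps[OF x], of w], of p] by blast
  have q': "poly q' t = coord_law H (\<Phi> x) (\<Phi> (\<lambda>v. t * \<xi> v)) w" for t
    by (simp only: q'0(1) p(1))
  have q'd: "poly (pderiv q') 0 = D' (\<Phi> x) w (\<lambda>_. 0) (d\<Phi> \<xi>)"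
    unfolding q'0(2) p by (simp add: zero)
  have "q = q'" by (rule poly_ext) (simp add: q q' hom[OF x line])
  then show ?thesis using qd q'd cod.field_eq[OF maps[OF x] d\<Phi>_coords w] by simp
qed

theorem EXP_natural:
  assumes \<xi>: "\<xi> \<in> coords s"
  shows "EXP s H (d\<Phi> \<xi>) = \<Phi> (EXP s G \<xi>)"
proof -
  obtain \<gamma> where \<gamma>: "exp_curve s G \<xi> \<gamma>" "EXP s G \<xi> = (\<lambda>w. poly (\<gamma> w) 1)"
    using dom.EXP_curve[OF \<xi>] .
  have \<gamma>c: "(\<lambda>v. poly (\<gamma> v) t) \<in> coords s" for t
    using \<gamma>(1) by (simp add: dom.exp_curve_iff coord_curveD)
  have \<gamma>': "(\<lambda>v. poly (pderiv (\<gamma> v)) t) = dom.field \<xi> (\<lambda>v. poly (\<gamma> v) t)" for t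
  proof
    fix v show "poly (pderiv (\<gamma> v)) t = dom.field \<xi> (\<lambda>v. poly (\<gamma> v) t) v"
      using \<gamma>(1) dom.field_coords[of \<xi> "\<lambda>v. poly (\<gamma> v) t"]
      by (cases "v \<in> long_words s") (auto simp: dom.exp_curve_iff coord_curve_def coords_def)
  qed
  \<comment> \<open>The value along the curve and the chain rule are joined in one condition, so
    that a single choice of \<open>\<delta>\<close> provides both.\<close>
  define Q where "Q w q \<longleftrightarrow> (\<forall>t. poly q t = \<Phi> (\<lambda>v. poly (\<gamma> v) t) w \<and>
      poly (pderiv q) t = E w (\<lambda>v. poly (\<gamma> v) t) (dom.field \<xi> (\<lambda>v. poly (\<gamma> v) t)))" for w q
  have "\<exists>q. Q w q" for w
    by (rule has_diff_curve[OF diff[of w], of \<gamma>]) (auto simp only: \<gamma>' Q_def)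
  then obtain \<delta> where "\<And>w. Q w (\<delta> w)" by metis
  then have \<delta>: "poly (\<delta> w) t = \<Phi> (\<lambda>v. poly (\<gamma> v) t) w"
    "poly (pderiv (\<delta> w)) t = E w (\<lambda>v. poly (\<gamma> v) t) (dom.field \<xi> (\<lambda>v. poly (\<gamma> v) t))" for w t
    unfolding Q_def by blast+
  have \<delta>at: "(\<lambda>w. poly (\<delta> w) t) = \<Phi> (\<lambda>v. poly (\<gamma> v) t)" for t using \<delta>(1) by auto
  have "exp_curve s H (d\<Phi> \<xi>) \<delta>"
    unfolding cod.exp_curve_iff
  proof (intro conjI ballI allI)
    show "coord_curve s \<delta>"
      unfolding coord_curve_def
    proof (intro allI impI)
      fix w assume "w \<notin> long_words s"
      then show "\<delta> w = 0" using maps[OF \<gamma>c] by (intro poly_ext) (simp add: \<delta>(1) coords_def)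
    qed
  next
    fix w assume w: "w \<in> long_words s"
    have "(\<lambda>v. poly (\<gamma> v) 0) = (\<lambda>_. 0)"
      using \<gamma>(1) by (auto simp: fun_eq_iff dom.exp_curve_iff coord_curve_def)
    then show "poly (\<delta> w) 0 = 0" by (simp add: \<delta>(1) zero)
    show "poly (pderiv (\<delta> w)) t = cod.field (d\<Phi> \<xi>) (\<lambda>v. poly (\<delta> v) t) w" for t
      unfolding \<delta>at \<delta>(2) by (rule field_related[OF \<gamma>c \<xi> w])
  qed
  then show ?thesis using cod.EXP_eq[OF d\<Phi>_coords] by (simp add: \<gamma>(2) \<delta>at)
qed

text \<open>\<open>EXP s H\<close> turns the left side into the image under \<open>\<Phi>\<close> of
  a product in \<open>G\<close>, hence into the product in \<open>H\<close> of the exponentials of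
  \<open>d\<Phi> \<xi>\<close> and \<open>d\<Phi> \<eta>\<close>; taking \<open>LOG\<close> gives
  the claim.\<close>

theorem BCH_natural:
  assumes "\<xi> \<in> coords s" "\<eta> \<in> coords s"
  shows "d\<Phi> (BCH_law s G \<xi> \<eta>) = BCH_law s H (d\<Phi> \<xi>) (d\<Phi> \<eta>)"
proof -
  have "EXP s H (d\<Phi> (BCH_law s G \<xi> \<eta>)) = coord_law H (EXP s H (d\<Phi> \<xi>)) (EXP s H (d\<Phi> \<eta>))"
    using assms by (simp add: EXP_natural dom.BCH_coords dom.EXP_BCH hom dom.EXP_coords)
  then show ?thesis
    using cod.LOG_EXP[OF d\<Phi>_coords] by (metis BCH_law_def)
qed

lemma unit_lower_triangular_d\<Phi>:
  assumes "unipotent s \<Phi>"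
  shows "unit_lower_triangular s (jacobian \<Phi> (\<lambda>_. 0))"
proof -
  let ?e = "\<lambda>v u. if u = v then 1 else (0 :: 'k)"
  \<comment> \<open>At columns \<open>v\<close> not shorter than \<open>w\<close> the row agrees
    with the identity matrix. This covers all words that follow \<open>w\<close>, since the order
    compares lengths first.\<close>
  have "jacobian \<Phi> (\<lambda>_. 0) w v = ?e v w"
    if w: "w \<in> long_words s" and v: "v \<in> long_words s" and "length w \<le> length v" for w v
  proof -
    have e: "(\<lambda>u. t * ?e v u) \<in> coords s" for t
      using v by (auto simp: coords_def)
    have "\<Phi> (\<lambda>u. t * ?e v u) w - (\<lambda>_. 0) (\<lambda>u. t * ?e v u) = 0 + t * ?e v w" for t
    proof -
      have "\<Phi> (\<lambda>u. t * ?e v u) w - \<Phi> (\<lambda>_. 0) w = t * ?e v w - 0"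
        using that(3) by (intro unipotentD[OF assms e dom.zero_coords w]) auto
      then show ?thesis by (simp add: zero)
    qed
    then have "E w (\<lambda>_. 0) (?e v) - 0 = ?e v w"
      by (rule has_diff_lines[OF diff has_diff_const])
    then show ?thesis by (simp add: jacobian_has_diff[where \<Phi>=\<Phi> and w=w and D="E w", OF diff])
  qed
  note J = this
  show ?thesis
    unfolding unit_lower_triangular_def
  proof (intro conjI ballI impI)
    fix w v assume w: "w \<in> long_words s" and v: "v \<in> long_words s" and "(w, v) \<in> lenlex less_than"
    then have "length w \<le> length v" "w \<noteq> v"
      using lenlex_length lenlex_irreflexive[of less_than] by auto
    then show "jacobian \<Phi> (\<lambda>_. 0) w v = 0" by (simp add: J[OF w v])
  qed (simp add: J)
qed

end

section \<open>The two group laws in coordinates, and the theorem\<close>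

lemma polynomial_fun_boxed_left:
  assumes "\<And>v. polynomial_fun (\<lambda>x. f x v)"
  shows "polynomial_fun (\<lambda>x. boxed_conv s (f x) g w)"
proof (cases "w \<in> words s")
  case True
  then show ?thesis
    unfolding boxed_conv_def part_coeff_def
    by (simp, intro polynomial_fun_sum polynomial_fun_mult polynomial_fun_prod polynomial_fun_const assms)
qed (simp add: boxed_conv_outside polynomial_fun_const)

lemma polynomial_fun_of_coords: "polynomial_fun (\<lambda>x. of_coords G x v)"
  unfolding of_coords_def by (intro polynomial_fun_intros)

lemma polynomial_fun_to_coords: "polynomial_fun (\<lambda>x. f x v) \<Longrightarrow> polynomial_fun (\<lambda>x. to_coords G (f x) v)"
  using polynomial_fun_add[OF _ polynomial_fun_const[of "- \<one>\<^bsub>G\<^esub> v"], of "\<lambda>x. f x v"]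
  by (simp add: to_coords_def)

text \<open>Both group laws have the form \<open>(x, y) \<mapsto> h x \<boxtimes> y\<close>, with \<open>h\<close> the identity or the
  \<open>R\<close>-transform.\<close>

lemma unipotent_law_boxed:
  fixes G :: "'k::field_char_0 family monoid"
  assumes "group G" and G: "carrier G = gplus s"
    and law: "\<And>f g. f \<in> gplus s \<Longrightarrow> f \<otimes>\<^bsub>G\<^esub> g = boxed_conv s (h f) g"
    and h: "\<And>f. f \<in> gplus s \<Longrightarrow> h f \<in> gplus s"
      "unipotent s (\<lambda>x. to_coords G (h (of_coords G x)))"
      "\<And>v. polynomial_fun (\<lambda>x. h (of_coords G x) v)"
  shows "\<exists>D. unipotent_law s G D"
proof -
  interpret group G by fact
  have one: "\<one>\<^bsub>G\<^esub> \<in> gplus s" using one_closed G by simp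
  note closed = of_coords_closed[OF one]
  have law': "coord_law G x y = to_coords G (boxed_conv s (h (of_coords G x)) (of_coords G y))"
    if "x \<in> coords s" for x y
    by (simp add: coord_law_def law closed that)
  \<comment> \<open>The derivatives \<open>d\<close> are chosen before \<open>x\<close> is fixed, so
    that \<open>D\<close> depends on \<open>x\<close> only through the coefficients of
    \<open>h\<close>, which are polynomial.\<close>
  have "\<exists>d. \<forall>P. has_diff (\<lambda>y. part_coeff (of_coords G y) w (kreweras (length w) P)) (d P)" for w
  proof -
    have "polynomial_fun (\<lambda>y. part_coeff (of_coords G y) w (kreweras (length w) P))" for P
      unfolding part_coeff_def by (intro polynomial_fun_prod polynomial_fun_of_coords)
    then show ?thesis unfolding polynomial_fun_def by metis
  qed
  then obtain d where d: "\<And>w P. has_diff (\<lambda>y. part_coeff (of_coords G y) w (kreweras (length w) P)) (d w P)"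
    by metis
  define D where "D x w = (\<lambda>y \<xi>. if w \<in> words s then
    \<Sum>P\<in>NC (length w). part_coeff (h (of_coords G x)) w P * d w P y \<xi> else 0)" for x w
  have "unipotent_law s G D"
  proof
    fix x :: "'k family" assume x: "x \<in> coords s"
    show "coord_law G x y \<in> coords s" if "y \<in> coords s" for y
      using x that by (simp add: law' to_coords_closed[OF one] boxed_conv_closed h closed)
    show "coord_law G x (\<lambda>_. 0) = x"
    proof -
      have "of_coords G (\<lambda>_. 0) = \<one>\<^bsub>G\<^esub>" by (simp add: of_coords_def)
      moreover have "of_coords G x \<otimes>\<^bsub>G\<^esub> \<one>\<^bsub>G\<^esub> = of_coords G x" using closed[OF x] G by (intro r_one) simp
      ultimately show ?thesis by (simp add: coord_law_def)
    qed
    show "unipotent s (coord_law G x)"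
      using unipotent_boxed_right[OF one one h(1)[OF closed[OF x]]] by (simp add: law'[OF x, abs_def] eta_contract_eq)
    show "has_diff (\<lambda>y. coord_law G x y w) (D x w)" for w
    proof (cases "w \<in> words s")
      case True
      have "has_diff (\<lambda>y. (\<Sum>P\<in>NC (length w). part_coeff (h (of_coords G x)) w P *
          part_coeff (of_coords G y) w (kreweras (length w) P)) + - \<one>\<^bsub>G\<^esub> w)
         (\<lambda>y \<xi>. (\<Sum>P\<in>NC (length w). part_coeff (h (of_coords G x)) w P * d w P y \<xi>) + 0)"
        by (intro has_diff_add has_diff_const has_diff_sum has_diff_scale d)
      then show ?thesis using True by (simp add: law'[OF x] to_coords_def D_def boxed_conv_def)
    next
      case False
      then show ?thesis
        using has_diff_const[of "- \<one>\<^bsub>G\<^esub> w"] by (simp add: law'[OF x] to_coords_def D_def boxed_conv_def)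
    qed
  next
    fix y :: "'k family" assume y: "y \<in> coords s"
    \<comment> \<open>Varying the left argument is \<open>h\<close> in coordinates followed by a
      boxed translation; passing through \<open>to_coords\<close> and back exhibits this
      composite.\<close>
    have u: "unipotent s (\<lambda>x. to_coords G (boxed_conv s (of_coords G (to_coords G (h (of_coords G x)))) (of_coords G y)))"
      using unipotent_comp[OF unipotent_boxed_left[OF one one closed[OF y]] h(2)] .
    show "unipotent s (\<lambda>x. coord_law G x y)"
      using u unfolding unipotent_def by (auto simp: law')
  next
    fix c :: "nat list \<Rightarrow> 'k poly" and w \<xi> assume "coord_curve s c"
    have "polynomial_fun (\<lambda>x. D x w (\<lambda>_. 0) \<xi>)"
      unfolding D_def part_coeff_def
      by (cases "w \<in> words s"; simp)
        (intro polynomial_fun_sum polynomial_fun_mult polynomial_fun_prod polynomial_fun_const h(3))+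
    then show "\<exists>q. \<forall>t. poly q t = D (\<lambda>v. poly (c v) t) w (\<lambda>_. 0) \<xi>"
      by (rule polynomial_fun_curve)
  qed
  then show ?thesis by blast
qed

theorem theorem5p15:
  fixes s :: nat
    and GV GB :: "('k::field_char_0) family monoid"
  assumes "1 \<le> s"
    and GV: "GV = free_mult_group s"
    and GB: "GB = boxed_group s"
  shows "(group GV \<and> group GB \<and> R_transform s \<in> iso GV GB) \<and>
    (\<exists>A. unit_lower_triangular s A \<and>
       (\<forall>\<xi>\<in>coords s. \<forall>\<eta>\<in>coords s.
          mat_vec s A (BCH_law s GV \<xi> \<eta>) = BCH_law s GB (mat_vec s A \<xi>) (mat_vec s A \<eta>))) \<and>
    (\<forall>f\<in>gplus s.
       of_coords GB (EXP s GB (differential_at_one s GV GB (R_transform s)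
         (LOG s GV (to_coords GV f)))) = R_transform s f)"
proof -
  have gV: "group GV" and gB: "group GB" and R: "R_transform s \<in> iso GV GB"
    unfolding GV GB by (rule group_free_mult_group group_boxed_group R_transform_iso)+
  have oneV: "\<one>\<^bsub>GV\<^esub> \<in> gplus s" and oneB: "\<one>\<^bsub>GB\<^esub> \<in> gplus s"
    by (simp_all add: GV GB zeta_gplus boxed_unit_gplus)
  let ?\<Phi> = "\<lambda>x. to_coords GB (R_transform s (of_coords GV x))"
  have uR: "unipotent s (\<lambda>x. to_coords H (R_transform s (of_coords GV x)))" if "\<one>\<^bsub>H\<^esub> \<in> gplus s"
    for H :: "'k family monoid"
    unfolding R_transform_def using oneV that moeb_gplus by (rule unipotent_boxed_left)
  have pR: "polynomial_fun (\<lambda>x. R_transform s (of_coords GV x) v)" for v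
    unfolding R_transform_def by (intro polynomial_fun_boxed_left polynomial_fun_of_coords)
  obtain DV where DV: "unipotent_law s GV DV"
    using unipotent_law_boxed[OF gV, of s "R_transform s"] uR[OF oneV] pR
    by (auto simp: GV free_mult_conv_eq_boxed_conv R_transform_gplus)
  obtain DB where DB: "unipotent_law s GB DB"
    using unipotent_law_boxed[OF gB, of s "\<lambda>f. f"] polynomial_fun_of_coords[of GB]
    by (auto simp: GB unipotent_def)
  have "\<exists>E. has_diff (\<lambda>x. ?\<Phi> x w) E" for w
    using polynomial_fun_to_coords[OF pR] unfolding polynomial_fun_def .
  then obtain E where E: "\<And>w. has_diff (\<lambda>x. ?\<Phi> x w) (E w)" by metis
  interpret V: unipotent_law s GV DV by (rule DV)
  interpret B: unipotent_law s GB DB by (rule DB)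
  interpret law_morphism s GV GB DV DB ?\<Phi> E
  proof
    show "?\<Phi> x \<in> coords s" if "x \<in> coords s" for x
      using that by (intro to_coords_closed oneB R_transform_gplus of_coords_closed oneV)
    show "?\<Phi> (\<lambda>_. 0) = (\<lambda>_. 0)"
      by (simp add: of_coords_def to_coords_def GV GB R_transform_zeta)
    show "?\<Phi> (coord_law GV x y) = coord_law GB (?\<Phi> x) (?\<Phi> y)" if "x \<in> coords s" "y \<in> coords s" for x y
      using of_coords_closed[OF oneV that(1)] of_coords_closed[OF oneV that(2)]
      by (simp add: coord_law_def) (simp add: GV GB R_transform_mult)
  qed (rule E)
  have d: "differential_at_one s GV GB (R_transform s) = d\<Phi>"
    by (simp add: differential_at_one_def d\<Phi>_def)
  \<comment> \<open>Naturality of the exponential, taken at the logarithm of the coordinates of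
    \<open>f\<close>.\<close>
  have "of_coords GB (EXP s GB (d\<Phi> (LOG s GV (to_coords GV f)))) = R_transform s f" if "f \<in> gplus s" for f
    using to_coords_closed[OF oneV that] by (simp add: EXP_natural V.LOG_coords V.EXP_LOG)
  then show ?thesis
    unfolding d using gV gB R unit_lower_triangular_d\<Phi>[OF uR[OF oneB]] BCH_natural[unfolded d\<Phi>_def] by blast
qed

end
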